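(* Let $L$ and $M$ be differential graded Lie algebras over a field $\mathbb{K}$ of characteristic $0$ and let $H\subseteq M$ be a differential graded Lie subalgebra. Assume that there exists a linear map of degree $-1$ $$\boldsymbol{i}\in \operatorname{Hom}^{-1}_{\mathbb{K}}(L,M),\qquad a\mapsto \boldsymbol{i}_a,$$ such that: (1) $[\boldsymbol{i}_a,\boldsymbol{i}_b]=0$ and $\boldsymbol{i}_{[a,b]}=[\boldsymbol{i}_a,d\boldsymbol{i}_b]$ for every $a,b\in L$; (2) $d\boldsymbol{i}_a+\boldsymbol{i}_{da}\in H$ for every $a\in L$; (3) the inclusion $H\hookrightarrow M$ is injective in cohomology; (4) the induced morphism of complexes $\boldsymbol{i}\colon L\to (M/H)[-1]$ is injective in cohomology. Then the differential graded Lie algebra $L$ is homotopy abelian.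
   Context: A differential graded Lie algebra (DG-Lie algebra) over $\mathbb{K}$ is a triple $(L,d,[\,,\,])$ where $L=\bigoplus_{i\in\mathbb{Z}}L^i$ is a graded $\mathbb{K}$-vector space, $d$ is a differential of degree $+1$ with $d^2=0$, and $[\,,\,]\colon L\times L\to L$ is a bilinear map of degree $0$ such that: $[x,y]=-(-1)^{ij}[y,x]$ for $x\in L^i,y\in L^j$; $[x,[y,z]]=[[x,y],z]+(-1)^{ij}[y,[x,z]]$ for $x\in L^i,y\in L^j,z\in L$; $d[x,y]=[dx,y]+(-1)^i[x,dy]$ for $x\in L^i,y\in L$. A DG-Lie subalgebra is a graded subspace closed under the differential and the bracket. A morphism of DG-Lie algebras is a degree-preserving linear map commuting with brackets and differentials; it is a quasi-isomorphism if it induces an isomorphism in cohomology. Two DG-Lie algebras are quasi-isomorphic if they are equivalent under the equivalence relation generated by quasi-isomorphisms (i.e. connected by a finite zigzag of quasi-isomorphisms). A DG-Lie algebra is abelian if its bracket is trivial, and homotopy abelian if it is quasi-isomorphic to an abelian DG-Lie algebra. $\operatorname{Hom}^{-1}_{\mathbb{K}}(L,M)$ is the space of linear maps $L\to M$ of degree $-1$, i.e. sending $L^i$ to $M^{i-1}$. The shift of a complex $V$ is $V[-1]^i=V^{i-1}$ with differential $-d_V$; in particular $(M/H)[-1]$ is the shift of the quotient complex $M/H$, and condition (2) guarantees that $a\mapsto \boldsymbol{i}_a \bmod H$ is a morphism of complexes $L\to(M/H)[-1]$. "Injective in cohomology" means that the induced map on cohomology is injective in all degrees. *)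

theory Defs
  imports
    Complex_Main
    "HOL-Algebra.Coset"
    "HOL-Library.Function_Algebras"
    "HOL-Library.Product_Plus"
begin

section \<open>Cochain complexes and their cohomology\<close>

text \<open>
  A complex is recorded through the additive groups of its graded pieces (written
  multiplicatively, as everywhere in HOL-Algebra) and its differential
  \<open>cdiff C n\<close> from degree \<open>n\<close> to degree \<open>n + 1\<close>.  Scalars are not recorded:
  a linear map is injective, or an isomorphism, on cohomology iff it is so on the
  underlying abelian groups.
\<close>

record 'a cochain =
  grp :: "int \<Rightarrow> 'a monoid"
  cdiff :: "int \<Rightarrow> 'a \<Rightarrow> 'a"

definition cocycles :: "'a cochain \<Rightarrow> int \<Rightarrow> 'a set" where
  "cocycles C n = kernel (grp C n) (grp C (n + 1)) (cdiff C n)"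

definition coboundaries :: "'a cochain \<Rightarrow> int \<Rightarrow> 'a set" where
  "coboundaries C n = cdiff C (n - 1) ` carrier (grp C (n - 1))"

definition cohomology :: "'a cochain \<Rightarrow> int \<Rightarrow> 'a set monoid" where
  "cohomology C n = (grp C n)\<lparr>carrier := cocycles C n\<rparr> Mod coboundaries C n"

text \<open>For a morphism of complexes \<open>f\<close>, the class \<open>B + x\<close> is sent to
  \<open>B' + f (B + x) = B' + f x\<close>.\<close>

definition cohomology_map ::
    "'a cochain \<Rightarrow> 'b cochain \<Rightarrow> (int \<Rightarrow> 'a \<Rightarrow> 'b) \<Rightarrow> int \<Rightarrow> 'a set \<Rightarrow> 'b set" where
  "cohomology_map C D f n X = coboundaries D n <#>\<^bsub>grp D n\<^esub> (f n ` X)"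

definition injective_in_cohomology ::
    "'a cochain \<Rightarrow> 'b cochain \<Rightarrow> (int \<Rightarrow> 'a \<Rightarrow> 'b) \<Rightarrow> bool" where
  "injective_in_cohomology C D f \<longleftrightarrow>
     (\<forall>n. inj_on (cohomology_map C D f n) (carrier (cohomology C n)))"

definition iso_in_cohomology ::
    "'a cochain \<Rightarrow> 'b cochain \<Rightarrow> (int \<Rightarrow> 'a \<Rightarrow> 'b) \<Rightarrow> bool" where
  "iso_in_cohomology C D f \<longleftrightarrow>
     (\<forall>n. cohomology_map C D f n \<in> iso (cohomology C n) (cohomology D n))"

text \<open>The shift \<open>V[-1]\<close>, with differential \<open>- d\<close>.\<close>

definition shift :: "'a cochain \<Rightarrow> 'a cochain" where
  "shift C = \<lparr>grp = (\<lambda>n. grp C (n - 1)),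
              cdiff = (\<lambda>n x. inv\<^bsub>grp C n\<^esub> (cdiff C (n - 1) x))\<rparr>"

section \<open>DG-Lie algebras\<close>

text \<open>
  A DG-Lie algebra lives inside an ambient vector space (the type \<open>'a\<close> with scalar
  multiplication \<open>scal L\<close>), of which it need only be a subspace: \<open>homog L i\<close> is the
  piece of degree \<open>i\<close>, and \<open>space_of L\<close> is the (internal) direct sum of these pieces.
  The values of \<open>dif L\<close> and \<open>brack L\<close> outside \<open>space_of L\<close> are irrelevant.
\<close>

record ('k, 'a) dgla =
  scal :: "'k \<Rightarrow> 'a \<Rightarrow> 'a"
  homog :: "int \<Rightarrow> 'a set"
  dif :: "'a \<Rightarrow> 'a"
  brack :: "'a \<Rightarrow> 'a \<Rightarrow> 'a"

definition space_of :: "('k::field, 'a::ab_group_add) dgla \<Rightarrow> 'a set" where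
  "space_of L = module.span (scal L) (\<Union>i. homog L i)"

definition linear_on ::
    "'a set \<Rightarrow> ('k \<Rightarrow> 'a \<Rightarrow> 'a) \<Rightarrow> ('k \<Rightarrow> 'b \<Rightarrow> 'b)
     \<Rightarrow> ('a::ab_group_add \<Rightarrow> 'b::ab_group_add) \<Rightarrow> bool" where
  "linear_on S s t f \<longleftrightarrow>
     (\<forall>x\<in>S. \<forall>y\<in>S. f (x + y) = f x + f y) \<and> (\<forall>c. \<forall>x\<in>S. f (s c x) = t c (f x))"

locale dg_lie_algebra =
  fixes L :: "('k::field, 'a::ab_group_add) dgla"
  assumes ambient: "vector_space (scal L)"
    and homog_subspace: "module.subspace (scal L) (homog L i)"
    and homog_independent:
      "\<lbrakk>finite I; \<And>i. i \<in> I \<Longrightarrow> v i \<in> homog L i; (\<Sum>i\<in>I. v i) = 0; j \<in> I\<rbrakk> \<Longrightarrow> v j = 0"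
    and dif_linear: "linear_on (space_of L) (scal L) (scal L) (dif L)"
    and dif_degree: "x \<in> homog L i \<Longrightarrow> dif L x \<in> homog L (i + 1)"
    and dif_dif: "x \<in> space_of L \<Longrightarrow> dif L (dif L x) = 0"
    and brack_linear_right:
      "x \<in> space_of L \<Longrightarrow> linear_on (space_of L) (scal L) (scal L) (\<lambda>y. brack L x y)"
    and brack_linear_left:
      "y \<in> space_of L \<Longrightarrow> linear_on (space_of L) (scal L) (scal L) (\<lambda>x. brack L x y)"
    and brack_degree:
      "\<lbrakk>x \<in> homog L i; y \<in> homog L j\<rbrakk> \<Longrightarrow> brack L x y \<in> homog L (i + j)"
    and brack_antisym:
      "\<lbrakk>x \<in> homog L i; y \<in> homog L j\<rbrakk>
        \<Longrightarrow> brack L x y = - scal L ((-1) powi (i * j)) (brack L y x)"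
    and brack_jacobi:
      "\<lbrakk>x \<in> homog L i; y \<in> homog L j; z \<in> space_of L\<rbrakk>
        \<Longrightarrow> brack L x (brack L y z)
          = brack L (brack L x y) z + scal L ((-1) powi (i * j)) (brack L y (brack L x z))"
    and brack_leibniz:
      "\<lbrakk>x \<in> homog L i; y \<in> space_of L\<rbrakk>
        \<Longrightarrow> dif L (brack L x y) = brack L (dif L x) y + scal L ((-1) powi i) (brack L x (dif L y))"

text \<open>A graded subspace is one spanned by its homogeneous elements.\<close>

definition dg_lie_subalgebra ::
    "'a set \<Rightarrow> ('k::field, 'a::ab_group_add) dgla \<Rightarrow> bool" where
  "dg_lie_subalgebra H M \<longleftrightarrow>
     H = module.span (scal M) (\<Union>i. H \<inter> homog M i) \<and>
     (\<forall>x\<in>H. dif M x \<in> H) \<and> (\<forall>x\<in>H. \<forall>y\<in>H. brack M x y \<in> H)"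

definition restrict_dgla :: "('k, 'a) dgla \<Rightarrow> 'a set \<Rightarrow> ('k, 'a) dgla" where
  "restrict_dgla M H = M\<lparr>homog := \<lambda>i. H \<inter> homog M i\<rparr>"

definition homog_group :: "('k, 'a::ab_group_add) dgla \<Rightarrow> int \<Rightarrow> 'a monoid" where
  "homog_group L n = \<lparr>carrier = homog L n, mult = (+), one = 0\<rparr>"

definition complex_of :: "('k, 'a::ab_group_add) dgla \<Rightarrow> 'a cochain" where
  "complex_of L = \<lparr>grp = homog_group L, cdiff = (\<lambda>n. dif L)\<rparr>"

text \<open>The quotient complex \<open>M/H\<close>; its differential sends \<open>H + x\<close> to
  \<open>H + d (H + x) = H + d x\<close>.\<close>

definition quotient_complex ::
    "('k, 'a::ab_group_add) dgla \<Rightarrow> 'a set \<Rightarrow> 'a set cochain" where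
  "quotient_complex M H =
     \<lparr>grp = (\<lambda>n. homog_group M n Mod (H \<inter> homog M n)),
      cdiff = (\<lambda>n X. (H \<inter> homog M (n + 1)) <#>\<^bsub>homog_group M (n + 1)\<^esub> (dif M ` X))\<rparr>"

text \<open>The map \<open>L \<rightarrow> (M/H)[-1]\<close> induced by a degree \<open>-1\<close> map \<open>\<ii> : L \<rightarrow> M\<close>.\<close>

definition induced_map ::
    "('k, 'b::ab_group_add) dgla \<Rightarrow> 'b set \<Rightarrow> ('a \<Rightarrow> 'b) \<Rightarrow> int \<Rightarrow> 'a \<Rightarrow> 'b set" where
  "induced_map M H \<ii> n a = (H \<inter> homog M (n - 1)) #>\<^bsub>homog_group M (n - 1)\<^esub> \<ii> a"

definition degree_map ::
    "int \<Rightarrow> ('k::field, 'a::ab_group_add) dgla \<Rightarrow> ('k, 'b::ab_group_add) dgla \<Rightarrow> ('a \<Rightarrow> 'b) \<Rightarrow> bool"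
    where
  "degree_map k L M f \<longleftrightarrow>
     linear_on (space_of L) (scal L) (scal M) f \<and> (\<forall>i. f ` homog L i \<subseteq> homog M (i + k))"

definition dgla_morphism ::
    "('k::field, 'a::ab_group_add) dgla \<Rightarrow> ('k, 'b::ab_group_add) dgla \<Rightarrow> ('a \<Rightarrow> 'b) \<Rightarrow> bool" where
  "dgla_morphism L M f \<longleftrightarrow>
     degree_map 0 L M f \<and>
     (\<forall>x\<in>space_of L. \<forall>y\<in>space_of L. f (brack L x y) = brack M (f x) (f y)) \<and>
     (\<forall>x\<in>space_of L. f (dif L x) = dif M (f x))"

definition quasi_isomorphism_to ::
    "('k::field, 'a::ab_group_add) dgla \<Rightarrow> ('k, 'b::ab_group_add) dgla \<Rightarrow> bool" where
  "quasi_isomorphism_to L M \<longleftrightarrow>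
     dg_lie_algebra L \<and> dg_lie_algebra M \<and>
     (\<exists>f. dgla_morphism L M f \<and>
          iso_in_cohomology (complex_of L) (complex_of M) (\<lambda>n. f))"

definition abelian_dgla :: "('k::field, 'a::ab_group_add) dgla \<Rightarrow> bool" where
  "abelian_dgla L \<longleftrightarrow> (\<forall>x\<in>space_of L. \<forall>y\<in>space_of L. brack L x y = 0)"

text \<open>
  HOL cannot quantify over types inside a formula, so the type \<open>'u\<close> in which the
  intermediate DG-Lie algebras of the zigzag live is a parameter.  The first step of the
  zigzag moves from the type of \<open>L\<close> to \<open>'u\<close>.  Whatever \<open>'u\<close> is, the predicate implies that
  \<open>L\<close> is homotopy abelian, and it is equivalent to it as soon as \<open>'u\<close> is large enough.
\<close>

definition homotopy_abelian ::
    "'u::ab_group_add itself \<Rightarrow> ('k::field, 'a::ab_group_add) dgla \<Rightarrow> bool" where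
  "homotopy_abelian U L \<longleftrightarrow>
     (\<exists>(X :: ('k, 'u) dgla) A.
        (quasi_isomorphism_to L X \<or> quasi_isomorphism_to X L) \<and>
        equivclp quasi_isomorphism_to X A \<and> abelian_dgla A)"

end

theory Submission
  imports Defs "HOL-Library.Countable"
begin

text \<open>
  Write \<open>l\<^sub>a = d i\<^sub>a + i\<^bsub>da\<^esub>\<close>. The two Cartan identities say precisely that
  \<open>a + \<epsilon> b \<mapsto> l\<^sub>a + i\<^sub>b\<close> is a morphism of DG-Lie algebras from the acyclic cone
  \<open>L \<oplus> \<epsilon> L\<close>, \<open>d \<epsilon> = 1\<close>, to \<open>M\<close>. Consequently it maps the algebra \<open>L'\<close> of polynomial paths in the
  cone from \<open>0\<close> to a point of \<open>L\<close>, which is quasi-isomorphic to \<open>L\<close>, to the homotopy fibre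
  \<open>T = {m \<in> M[t, dt]. m(0) = 0, m(1) \<in> H}\<close>. By (3), if \<open>V\<close> is a complement of the cocycles of
  \<open>H + d M\<close> in the cocycles of \<open>M\<close>, then the inclusion of \<open>dt V\<close> in \<open>T\<close> is a quasi-isomorphism; and
  \<open>dt V\<close> is abelian with zero differential because \<open>dt dt = 0\<close>. The homotopy pullback \<open>P\<close> of
  \<open>L' \<rightarrow> T \<leftarrow> dt V\<close> is therefore quasi-isomorphic to \<open>L\<close>, and by (4) the projection \<open>P \<rightarrow> dt V\<close> is
  injective in cohomology. Composing it with a linear projection of \<open>V\<close> onto the image of the
  cohomology yields a quasi-isomorphism from \<open>P\<close> to an abelian DG-Lie algebra.
\<close>

section \<open>Graded Lie algebras with a degree-indexed bracket\<close>

text \<open>The naive lift \<open>a \<mapsto> t l + dt i\<close> of \<open>L\<close> into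
  \<open>T\<close> does not preserve brackets, since \<open>t\<close> turns into \<open>t t\<close>.
  Paths in the cone repair this: a strict morphism exists on them, and
  \<open>t a + dt \<epsilon> a\<close>, a path ending at \<open>a\<close>, is sent to that same
  lift.

  By (3), the cohomology of \<open>M/H\<close> is the quotient of that of \<open>M\<close> by that
  of \<open>H\<close>; \<open>V\<close> represents this quotient, and the factor \<open>dt\<close>
  accounts for the shift. The two maps into \<open>T\<close> need not be onto, so a strict fibre
  product could have the wrong cohomology; an element of \<open>P\<close> therefore carries a path
  in \<open>T\<close> joining its two images. Integrating along this path shows that, for a cocycle,
  the \<open>V\<close>-component equals \<open>i\<close> of the \<open>L\<close>-component modulo
  \<open>H + d M\<close>, and this is what (4) controls. Integrating polynomials means dividing by
  positive integers, hence characteristic 0.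

  All intermediate algebras of the zigzag must inhabit one type. Their elements are families of
  elements of \<open>L\<close> and \<open>M\<close> with countable index sets, so the constructions
  are carried out degree by degree on pairs and sequences and encoded only at the end.\<close>

definition sg :: "int \<Rightarrow> 'a::ab_group_add \<Rightarrow> 'a" where
  "sg m x = (if even m then x else - x)"

text \<open>Only homogeneous arguments matter; \<open>gb G m x y\<close> is the bracket of \<open>x\<close>, of degree \<open>m\<close>, with
  \<open>y\<close>. Passing the degree lets signs be written without decomposing \<open>x\<close>.\<close>

record ('k, 'a) graded_alg =
  gscal :: "'k \<Rightarrow> 'a \<Rightarrow> 'a"
  gh :: "int \<Rightarrow> 'a set"
  gd :: "'a \<Rightarrow> 'a"
  gb :: "int \<Rightarrow> 'a \<Rightarrow> 'a \<Rightarrow> 'a"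

locale graded_lie =
  fixes G :: "('k::field_char_0, 'a::ab_group_add) graded_alg" (structure)
  assumes vs: "vector_space (gscal G)"
    and subsp: "module.subspace (gscal G) (gh G n)"
    and br_in: "\<lbrakk>x \<in> gh G m; y \<in> gh G n\<rbrakk> \<Longrightarrow> gb G m x y \<in> gh G (m + n)"
    and br_add_right:
      "\<lbrakk>x \<in> gh G m; y \<in> gh G n; z \<in> gh G n\<rbrakk> \<Longrightarrow> gb G m x (y + z) = gb G m x y + gb G m x z"
    and br_scale_right:
      "\<lbrakk>x \<in> gh G m; y \<in> gh G n\<rbrakk> \<Longrightarrow> gb G m x (gscal G c y) = gscal G c (gb G m x y)"
    and antisym: "\<lbrakk>x \<in> gh G m; y \<in> gh G n\<rbrakk> \<Longrightarrow> gb G m x y = - sg (m * n) (gb G n y x)"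
    and jacobi: "\<lbrakk>x \<in> gh G m; y \<in> gh G n; z \<in> gh G p\<rbrakk> \<Longrightarrow>
        gb G m x (gb G n y z) = gb G (m + n) (gb G m x y) z + sg (m * n) (gb G n y (gb G m x z))"
begin

sublocale V: vector_space "gscal G" by (rule vs)

lemma zero_in [simp]: "0 \<in> gh G n"
  by (rule V.subspace_0[OF subsp])

lemma add_in: "\<lbrakk>x \<in> gh G n; y \<in> gh G n\<rbrakk> \<Longrightarrow> x + y \<in> gh G n"
  by (rule V.subspace_add[OF subsp])

lemma scale_in: "x \<in> gh G n \<Longrightarrow> gscal G c x \<in> gh G n"
  by (rule V.subspace_scale[OF subsp])

lemma neg_in: "x \<in> gh G n \<Longrightarrow> - x \<in> gh G n"
  by (rule V.subspace_neg[OF subsp])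

lemma diff_in: "\<lbrakk>x \<in> gh G n; y \<in> gh G n\<rbrakk> \<Longrightarrow> x - y \<in> gh G n"
  by (rule V.subspace_diff[OF subsp])

lemma sum_in: "(\<And>i. i \<in> I \<Longrightarrow> f i \<in> gh G n) \<Longrightarrow> sum f I \<in> gh G n"
  by (rule V.subspace_sum[OF subsp])

lemma sg_in: "x \<in> gh G n \<Longrightarrow> sg m x \<in> gh G n"
  by (simp add: sg_def neg_in)

text \<open>Antisymmetry exchanges the two arguments, so the locale assumes linearity only on the
  right.\<close>

lemma br_add_left:
  "\<lbrakk>x \<in> gh G m; y \<in> gh G m; z \<in> gh G n\<rbrakk> \<Longrightarrow> gb G m (x + y) z = gb G m x z + gb G m y z"
  using antisym[of "x + y" m z n] antisym[of x m z n] antisym[of y m z n] br_add_right[of z n x m y]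
  by (simp add: add_in sg_def)

lemma br_scale_left:
  "\<lbrakk>x \<in> gh G m; y \<in> gh G n\<rbrakk> \<Longrightarrow> gb G m (gscal G c x) y = gscal G c (gb G m x y)"
  using antisym[of "gscal G c x" m y n] antisym[of x m y n] br_scale_right[of y n x m c]
  by (simp add: scale_in sg_def)

lemma br_zero_right [simp]: "x \<in> gh G m \<Longrightarrow> gb G m x 0 = 0"
  using br_add_right[of x m 0 m 0] by simp

lemma br_zero_left [simp]: "y \<in> gh G n \<Longrightarrow> gb G m 0 y = 0"
  using br_add_left[of 0 m 0 y n] by simp

lemma br_neg_right: "\<lbrakk>x \<in> gh G m; y \<in> gh G n\<rbrakk> \<Longrightarrow> gb G m x (- y) = - gb G m x y"
  using br_add_right[of x m y n "- y"] by (simp add: neg_in eq_neg_iff_add_eq_0 add.commute)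

lemma br_neg_left: "\<lbrakk>x \<in> gh G m; y \<in> gh G n\<rbrakk> \<Longrightarrow> gb G m (- x) y = - gb G m x y"
  using br_add_left[of x m "- x" y n] by (simp add: neg_in eq_neg_iff_add_eq_0 add.commute)

lemma br_sg_right: "\<lbrakk>x \<in> gh G m; y \<in> gh G n\<rbrakk> \<Longrightarrow> gb G m x (sg k y) = sg k (gb G m x y)"
  by (simp add: sg_def br_neg_right)

lemma br_sg_left: "\<lbrakk>x \<in> gh G m; y \<in> gh G n\<rbrakk> \<Longrightarrow> gb G m (sg k x) y = sg k (gb G m x y)"
  by (simp add: sg_def br_neg_left)

lemma br_sum_right:
  assumes "x \<in> gh G m" "\<And>i. i \<in> I \<Longrightarrow> f i \<in> gh G n"
  shows "gb G m x (sum f I) = (\<Sum>i\<in>I. gb G m x (f i))"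
  using assms(2)
proof (induction I rule: infinite_finite_induct)
  case (insert i I)
  then show ?case using br_add_right[OF assms(1), of "f i" n "sum f I"] by (simp add: sum_in)
qed (use assms(1) in auto)

lemma br_sum_left:
  assumes "y \<in> gh G n" "\<And>i. i \<in> I \<Longrightarrow> f i \<in> gh G m"
  shows "gb G m (sum f I) y = (\<Sum>i\<in>I. gb G m (f i) y)"
  using assms(2)
proof (induction I rule: infinite_finite_induct)
  case (insert i I)
  then show ?case using br_add_left[of "f i" m "sum f I" y n] assms(1) by (simp add: sum_in)
qed (use assms(1) in auto)

end

locale dg_lie = graded_lie +
  assumes d_in: "x \<in> gh G n \<Longrightarrow> gd G x \<in> gh G (n + 1)"
    and d_add: "\<lbrakk>x \<in> gh G n; y \<in> gh G n\<rbrakk> \<Longrightarrow> gd G (x + y) = gd G x + gd G y"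
    and d_scale: "x \<in> gh G n \<Longrightarrow> gd G (gscal G c x) = gscal G c (gd G x)"
    and d_d: "x \<in> gh G n \<Longrightarrow> gd G (gd G x) = 0"
    and leibniz: "\<lbrakk>x \<in> gh G m; y \<in> gh G n\<rbrakk> \<Longrightarrow>
        gd G (gb G m x y) = gb G (m + 1) (gd G x) y + sg m (gb G m x (gd G y))"
begin

lemma d_zero [simp]: "gd G 0 = 0"
  using d_add[of 0 0 0] by simp

lemma d_neg: "x \<in> gh G n \<Longrightarrow> gd G (- x) = - gd G x"
  using d_add[of x n "- x"] by (simp add: neg_in eq_neg_iff_add_eq_0 add.commute)

lemma d_diff: "\<lbrakk>x \<in> gh G n; y \<in> gh G n\<rbrakk> \<Longrightarrow> gd G (x - y) = gd G x - gd G y"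
  using d_add[of x n "- y"] by (simp add: neg_in d_neg)

lemma d_sg: "x \<in> gh G n \<Longrightarrow> gd G (sg k x) = sg k (gd G x)"
  by (simp add: sg_def d_neg)

lemma d_sum: "(\<And>i. i \<in> I \<Longrightarrow> f i \<in> gh G n) \<Longrightarrow> gd G (sum f I) = (\<Sum>i\<in>I. gd G (f i))"
proof (induction I rule: infinite_finite_induct)
  case (insert i I)
  then show ?case using d_add[of "f i" n "sum f I"] by (simp add: sum_in)
qed auto

text \<open>The record update shrinks the pieces and keeps the operations, so all identities are
  inherited and only closure is left to check. Applied to \<open>fibre\<close>, to
  \<open>pull\<close> and to \<open>H\<close> itself.\<close>

lemma sub_dg_lie:
  assumes sub: "\<And>n. Y n \<subseteq> gh G n" and "\<And>n. V.subspace (Y n)"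
    and "\<And>n x. x \<in> Y n \<Longrightarrow> gd G x \<in> Y (n + 1)"
    and "\<And>m n x y. \<lbrakk>x \<in> Y m; y \<in> Y n\<rbrakk> \<Longrightarrow> gb G m x y \<in> Y (m + n)"
  shows "dg_lie (G\<lparr>gh := Y\<rparr>)"
proof -
  have *: "x \<in> Y n \<Longrightarrow> x \<in> gh G n" for x n using sub by blast
  show ?thesis
    by (intro dg_lie.intro graded_lie.intro dg_lie_axioms.intro; simp add: vs assms(2-4);
        meson * br_add_right br_scale_right antisym jacobi d_add d_scale d_d leibniz)
qed

end

section \<open>Polynomials and odd extensions\<close>

text \<open>The index is the exponent of a variable \<open>t\<close>: \<open>polys (gh G n)\<close>
  is the degree \<open>n\<close> piece of \<open>G[t]\<close>, and \<open>conv\<close> below is the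
  Cauchy product for a bilinear operation.\<close>

definition polys :: "'a::zero set \<Rightarrow> (nat \<Rightarrow> 'a) set" where
  "polys S = {f. (\<forall>k. f k \<in> S) \<and> (\<exists>N. \<forall>k>N. f k = 0)}"

definition conv :: "('a \<Rightarrow> 'b \<Rightarrow> 'c::comm_monoid_add) \<Rightarrow> (nat \<Rightarrow> 'a) \<Rightarrow> (nat \<Rightarrow> 'b) \<Rightarrow> nat \<Rightarrow> 'c" where
  "conv b f g k = (\<Sum>i\<le>k. b (f i) (g (k - i)))"

definition poly_ga :: "('k, 'a::ab_group_add) graded_alg \<Rightarrow> ('k, nat \<Rightarrow> 'a) graded_alg" where
  "poly_ga G = \<lparr>gscal = (\<lambda>c f k. gscal G c (f k)), gh = (\<lambda>n. polys (gh G n)),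
     gd = (\<lambda>f k. gd G (f k)), gb = (\<lambda>m. conv (gb G m))\<rparr>"

lemma sg_sum: "sg m (sum f I) = (\<Sum>i\<in>I. sg m (f i))"
  by (simp add: sg_def sum_negf)

lemma sg_apply: "sg m f k = sg m (f k)"
  by (simp add: sg_def)

lemma sg_Pair: "sg m (x, y) = (sg m x, sg m y)"
  by (simp add: sg_def)

lemma polysI: "\<lbrakk>\<And>k. f k \<in> S; \<And>k. k > N \<Longrightarrow> f k = 0\<rbrakk> \<Longrightarrow> f \<in> polys S"
  by (auto simp: polys_def)

lemma polysD: "f \<in> polys S \<Longrightarrow> f k \<in> S"
  by (simp add: polys_def)

lemma polysE:
  assumes "f \<in> polys S" obtains N where "\<forall>k>N. f k = 0"
  using assms unfolding polys_def by blast

text \<open>Both sides run over the triples of exponents with sum \<open>k\<close>; the left one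
  groups them by \<open>i + j\<close>, as in the iterated product of \<open>f g\<close> with
  \<open>h\<close>.\<close>

lemma sum_triangle:
  fixes F :: "nat \<Rightarrow> nat \<Rightarrow> nat \<Rightarrow> 'a::comm_monoid_add"
  shows "(\<Sum>m\<le>k. \<Sum>i\<le>m. F i (m - i) (k - m)) = (\<Sum>i\<le>k. \<Sum>j\<le>k - i. F i j (k - i - j))"
  unfolding sum.Sigma[OF finite_atMost ballI[OF finite_atMost]]
  by (rule sum.reindex_bij_witness[where i = "\<lambda>(i, j). (i + j, i)" and j = "\<lambda>(m, i). (i, m - i)"])
     auto

text \<open>The same triples with the first two exponents exchanged, as required by the last term of
  the Jacobi identity.\<close>

lemma sum_swap_triangle:
  fixes F :: "nat \<Rightarrow> nat \<Rightarrow> nat \<Rightarrow> 'a::comm_monoid_add"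
  shows "(\<Sum>i\<le>k. \<Sum>j\<le>k - i. F i j (k - i - j)) = (\<Sum>j\<le>k. \<Sum>i\<le>k - j. F i j (k - j - i))"
  unfolding sum.Sigma[OF finite_atMost ballI[OF finite_atMost]]
  by (rule sum.reindex_bij_witness[where i = "\<lambda>(i, j). (j, i)" and j = "\<lambda>(m, i). (i, m)"])
     (auto simp: diff_right_commute add.commute)

lemma vector_space_fun: "vector_space s \<Longrightarrow> vector_space (\<lambda>c f k. s c (f k))"
  unfolding vector_space_def by (auto simp: fun_eq_iff)

lemma vector_space_prod:
  "\<lbrakk>vector_space s; vector_space t\<rbrakk> \<Longrightarrow> vector_space (\<lambda>c x. (s c (fst x), t c (snd x)))"
  unfolding vector_space_def by (auto simp: prod_eq_iff)

lemma subspaceI: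
  assumes "vector_space s" "0 \<in> S" "\<And>x y. \<lbrakk>x \<in> S; y \<in> S\<rbrakk> \<Longrightarrow> x + y \<in> S"
    "\<And>c x. x \<in> S \<Longrightarrow> s c x \<in> S"
  shows "module.subspace s S"
proof -
  interpret vector_space s by fact
  show ?thesis using assms by (auto simp: subspace_def)
qed

context graded_lie
begin

lemma conv_bilin:
  assumes "f \<in> polys (gh G m)" "g \<in> polys (gh G n)"
  shows "conv (gb G m) f g \<in> polys (gh G (m + n))"
proof -
  obtain N where N: "\<forall>k>N. f k = 0" using assms(1) by (rule polysE)
  obtain N' where N': "\<forall>k>N'. g k = 0" using assms(2) by (rule polysE)
  show ?thesis
  proof (rule polysI)
    show "conv (gb G m) f g k \<in> gh G (m + n)" for k
      unfolding conv_def using assms by (intro sum_in br_in) (auto simp: polys_def)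
    fix k assume k: "k > N + N'"
    show "conv (gb G m) f g k = 0" unfolding conv_def
    proof (intro sum.neutral ballI)
      fix i assume "i \<in> {..k}"
      consider "i > N" | "k - i > N'" using k by fastforce
      then show "gb G m (f i) (g (k - i)) = 0"
        by cases (use N N' br_zero_left[OF polysD[OF assms(2)]] br_zero_right[OF polysD[OF assms(1)]] in auto)
    qed
  qed
qed

text \<open>The variable \<open>t\<close> has degree 0 and creates no signs: each coefficient of an
  identity is a sum of instances of that identity in \<open>G\<close>.\<close>

lemma graded_lie_poly: "graded_lie (poly_ga G)"
proof (rule graded_lie.intro, simp_all add: poly_ga_def vector_space_fun vs conv_bilin)
  fix n
  show "module.subspace (\<lambda>c f k. gscal G c (f k)) (polys (gh G n))"
  proof (rule subspaceI[OF vector_space_fun[OF vs]])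
    show "0 \<in> polys (gh G n)" by (rule polysI) auto
    show "f + g \<in> polys (gh G n)" if f: "f \<in> polys (gh G n)" and g: "g \<in> polys (gh G n)" for f g
    proof -
      obtain N where N: "\<forall>k>N. f k = 0" using f by (rule polysE)
      obtain N' where N': "\<forall>k>N'. g k = 0" using g by (rule polysE)
      show ?thesis by (rule polysI[of _ _ "max N N'"]) (use N N' that in \<open>auto simp: add_in polysD\<close>)
    qed
    show "(\<lambda>k. gscal G c (f k)) \<in> polys (gh G n)" if "f \<in> polys (gh G n)" for c f
      using that by (auto simp: polys_def scale_in) 
  qed
next
  fix f g h m n
  assume "f \<in> polys (gh G m)" "g \<in> polys (gh G n)" "h \<in> polys (gh G n)"
  then show "conv (gb G m) f (g + h) = conv (gb G m) f g + conv (gb G m) f h"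
    by (simp add: fun_eq_iff conv_def br_add_right[OF polysD polysD polysD] sum.distrib)
next
  fix f g m n c
  assume "f \<in> polys (gh G m)" "g \<in> polys (gh G n)"
  then show "conv (gb G m) f (\<lambda>k. gscal G c (g k)) = (\<lambda>k. gscal G c (conv (gb G m) f g k))"
    by (simp add: fun_eq_iff conv_def br_scale_right[OF polysD polysD] V.scale_sum_right)
next
  fix f g m n
  assume f: "f \<in> polys (gh G m)" and g: "g \<in> polys (gh G n)"
  show "conv (gb G m) f g = - sg (m * n) (conv (gb G n) g f)"
  proof
    fix k
    have "conv (gb G m) f g k = (\<Sum>i\<le>k. - sg (m * n) (gb G n (g (k - i)) (f i)))"
      unfolding conv_def by (intro sum.cong refl antisym polysD[OF f] polysD[OF g])
    also have "\<dots> = - sg (m * n) (\<Sum>i\<le>k. gb G n (g (k - i)) (f i))"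
      by (simp add: sg_sum sum_negf)
    also have "(\<Sum>i\<le>k. gb G n (g (k - i)) (f i)) = conv (gb G n) g f k"
      unfolding conv_def by (rule sum.reindex_bij_witness[where i = "\<lambda>i. k - i" and j = "\<lambda>i. k - i"]) auto
    finally show "conv (gb G m) f g k = (- sg (m * n) (conv (gb G n) g f)) k"
      by (simp add: sg_apply)
  qed
next
  fix f g h m n p
  assume f: "f \<in> polys (gh G m)" and g: "g \<in> polys (gh G n)" and h: "h \<in> polys (gh G p)"
  note D = polysD[OF f] polysD[OF g] polysD[OF h]
  show "conv (gb G m) f (conv (gb G n) g h) =
    conv (gb G (m + n)) (conv (gb G m) f g) h + sg (m * n) (conv (gb G n) g (conv (gb G m) f h))"
  proof
    fix k
    have "conv (gb G m) f (conv (gb G n) g h) k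
        = (\<Sum>i\<le>k. \<Sum>j\<le>k - i. gb G m (f i) (gb G n (g j) (h (k - i - j))))"
      unfolding conv_def by (intro sum.cong refl br_sum_right[OF D(1)]) (rule br_in[OF D(2,3)])
    also have "\<dots> = (\<Sum>i\<le>k. \<Sum>j\<le>k - i. gb G (m + n) (gb G m (f i) (g j)) (h (k - i - j)))
        + (\<Sum>i\<le>k. \<Sum>j\<le>k - i. sg (m * n) (gb G n (g j) (gb G m (f i) (h (k - i - j)))))"
      by (simp add: jacobi[OF D] sum.distrib)
    also have "(\<Sum>i\<le>k. \<Sum>j\<le>k - i. gb G (m + n) (gb G m (f i) (g j)) (h (k - i - j)))
        = conv (gb G (m + n)) (conv (gb G m) f g) h k"
      unfolding conv_def sum_triangle[symmetric, of "\<lambda>i j l. gb G (m + n) (gb G m (f i) (g j)) (h l)"]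
      by (intro sum.cong refl br_sum_left[symmetric, OF D(3) br_in[OF D(1,2)]])
    also have "(\<Sum>i\<le>k. \<Sum>j\<le>k - i. sg (m * n) (gb G n (g j) (gb G m (f i) (h (k - i - j)))))
        = sg (m * n) (conv (gb G n) g (conv (gb G m) f h) k)"
      unfolding conv_def sum_swap_triangle[of "\<lambda>i j l. sg (m * n) (gb G n (g j) (gb G m (f i) (h l)))"] sg_sum
      by (intro sum.cong refl) (simp add: br_sum_right[OF D(2) br_in[OF D(1,3)]] sg_sum)
    finally show "conv (gb G m) f (conv (gb G n) g h) k =
      (conv (gb G (m + n)) (conv (gb G m) f g) h + sg (m * n) (conv (gb G n) g (conv (gb G m) f h))) k"
      by (simp add: sg_apply)
  qed
qed

end

text \<open>The pair \<open>(a, b)\<close> stands for \<open>a + \<theta> b\<close>, where \<open>\<theta>\<close> has odd degree \<open>\<delta>\<close> and \<open>\<theta>\<theta> = 0\<close>.\<close>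

definition odd_ext :: "int \<Rightarrow> ('a \<times> 'a \<Rightarrow> 'a \<times> 'a) \<Rightarrow> ('k, 'a::ab_group_add) graded_alg \<Rightarrow> ('k, 'a \<times> 'a) graded_alg" where
  "odd_ext \<delta> D G = \<lparr>gscal = (\<lambda>c x. (gscal G c (fst x), gscal G c (snd x))),
     gh = (\<lambda>n. gh G n \<times> gh G (n - \<delta>)), gd = D,
     gb = (\<lambda>m x y. (gb G m (fst x) (fst y),
        gb G (m - \<delta>) (snd x) (fst y) + sg m (gb G m (fst x) (snd y))))\<rparr>"

text \<open>Moving \<open>\<theta>\<close> to the left across an element of degree \<open>m\<close>
  costs the sign of \<open>m \<delta>\<close>, which is that of \<open>m\<close> as
  \<open>\<delta>\<close> is odd. Terms with two factors \<open>\<theta>\<close> vanish, so the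
  \<open>\<theta>\<close>-component of Jacobi is the sum of the three instances in which exactly one
  argument carries \<open>\<theta>\<close>.\<close>

lemma (in graded_lie) graded_lie_odd_ext:
  assumes "odd \<delta>"
  shows "graded_lie (odd_ext \<delta> D G)"
proof (rule graded_lie.intro)
  show "vector_space (gscal (odd_ext \<delta> D G))"
    using vector_space_prod[OF vs vs] by (simp add: odd_ext_def)
  then show "module.subspace (gscal (odd_ext \<delta> D G)) (gh (odd_ext \<delta> D G) n)" for n
    by (rule subspaceI) (auto simp: odd_ext_def add_in scale_in zero_prod_def)
next
  fix x y m n
  assume "x \<in> gh (odd_ext \<delta> D G) m" "y \<in> gh (odd_ext \<delta> D G) n"
  then obtain a b a' b' where *: "x = (a, b)" "y = (a', b')" "a \<in> gh G m" "b \<in> gh G (m - \<delta>)"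
    "a' \<in> gh G n" "b' \<in> gh G (n - \<delta>)"
    by (auto simp: odd_ext_def)
  show "gb (odd_ext \<delta> D G) m x y \<in> gh (odd_ext \<delta> D G) (m + n)"
    using br_in[OF *(3,5)] br_in[OF *(4,5)] br_in[OF *(3,6)] 
    by (auto simp: odd_ext_def *(1,2) algebra_simps intro!: add_in sg_in)
  show "gb (odd_ext \<delta> D G) m x (gscal (odd_ext \<delta> D G) c y)
      = gscal (odd_ext \<delta> D G) c (gb (odd_ext \<delta> D G) m x y)" for c
    using * by (simp add: odd_ext_def br_scale_right sg_def V.scale_right_distrib)
  show "gb (odd_ext \<delta> D G) m x y = - sg (m * n) (gb (odd_ext \<delta> D G) n y x)"
    using antisym[OF *(3,5)] antisym[OF *(4,5)] antisym[OF *(3,6)] assms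
    by (simp add: odd_ext_def *(1,2) sg_def)
next
  fix x y z m n
  assume "x \<in> gh (odd_ext \<delta> D G) m" "y \<in> gh (odd_ext \<delta> D G) n" "z \<in> gh (odd_ext \<delta> D G) n"
  then show "gb (odd_ext \<delta> D G) m x (y + z) = gb (odd_ext \<delta> D G) m x y + gb (odd_ext \<delta> D G) m x z"
    by (auto simp: odd_ext_def br_add_right sg_def)
next
  fix x y z m n p
  assume "x \<in> gh (odd_ext \<delta> D G) m" "y \<in> gh (odd_ext \<delta> D G) n" "z \<in> gh (odd_ext \<delta> D G) p"
  then obtain a b a' b' a'' b'' where eq: "x = (a, b)" "y = (a', b')" "z = (a'', b'')"
    and a: "a \<in> gh G m" and b: "b \<in> gh G (m - \<delta>)" and a': "a' \<in> gh G n" and b': "b' \<in> gh G (n - \<delta>)"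
    and a'': "a'' \<in> gh G p" and b'': "b'' \<in> gh G (p - \<delta>)"
    by (auto simp: odd_ext_def)
  have deg: "m - \<delta> + n = m + n - \<delta>" "m + (n - \<delta>) = m + n - \<delta>" by simp_all
  note I = br_in[OF a a''] br_in[OF b a'', unfolded deg] br_in[OF a b'']
    br_in[OF a' a''] br_in[OF b' a''] br_in[OF a' b'']
    br_in[OF b a', unfolded deg] br_in[OF a b', unfolded deg]
  have 1: "gb G m a (gb G (n - \<delta>) b' a'' + sg n (gb G n a' b''))
      = gb G m a (gb G (n - \<delta>) b' a'') + sg n (gb G m a (gb G n a' b''))"
    using br_add_right[OF a br_in[OF b' a''], of "sg n (gb G n a' b'')"] br_in[OF a' b'']
    by (simp add: sg_in br_sg_right[OF a br_in[OF a' b'']] algebra_simps)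
  have 2: "gb G n a' (gb G (m - \<delta>) b a'' + sg m (gb G m a b''))
      = gb G n a' (gb G (m - \<delta>) b a'') + sg m (gb G n a' (gb G m a b''))"
    using br_add_right[OF a' br_in[OF b a''], of "sg m (gb G m a b'')"] br_in[OF a b'']
    by (simp add: sg_in br_sg_right[OF a' br_in[OF a b'']] algebra_simps)
  have 3: "gb G (m + n - \<delta>) (gb G (m - \<delta>) b a' + sg m (gb G m a b')) a''
      = gb G (m + n - \<delta>) (gb G (m - \<delta>) b a') a'' + sg m (gb G (m + n - \<delta>) (gb G m a b') a'')"
    using br_add_left[OF I(7) sg_in[OF I(8)] a''] br_sg_left[OF I(8) a''] by simp
  show "gb (odd_ext \<delta> D G) m x (gb (odd_ext \<delta> D G) n y z)
      = gb (odd_ext \<delta> D G) (m + n) (gb (odd_ext \<delta> D G) m x y) z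
        + sg (m * n) (gb (odd_ext \<delta> D G) n y (gb (odd_ext \<delta> D G) m x z))"
    using jacobi[OF a a' a''] jacobi[OF b a' a''] jacobi[OF a b' a''] jacobi[OF a a' b''] assms
    by (simp add: odd_ext_def eq 1 2 3 deg) (simp add: sg_def)
qed

section \<open>Cones and polynomial paths\<close>

definition pderiv_ga :: "('k::field_char_0, 'a::ab_group_add) graded_alg \<Rightarrow> (nat \<Rightarrow> 'a) \<Rightarrow> nat \<Rightarrow> 'a" where
  "pderiv_ga G f k = gscal G (of_nat (Suc k)) (f (Suc k))"

text \<open>The primitive that vanishes at \<open>t = 0\<close>. Characteristic 0 makes the
  coefficients \<open>Suc j\<close> invertible.\<close>

definition pint_ga :: "('k::field_char_0, 'a::ab_group_add) graded_alg \<Rightarrow> (nat \<Rightarrow> 'a) \<Rightarrow> nat \<Rightarrow> 'a" where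
  "pint_ga G f k = (case k of 0 \<Rightarrow> 0 | Suc j \<Rightarrow> gscal G (inverse (of_nat (Suc j))) (f j))"

text \<open>The value at \<open>t = 1\<close>. Summing over the support avoids naming a bound for
  the exponents.\<close>

definition eval1 :: "(nat \<Rightarrow> 'a::comm_monoid_add) \<Rightarrow> 'a" where
  "eval1 f = sum f {k. f k \<noteq> 0}"

text \<open>In the cone \<open>\<theta> = \<epsilon>\<close> has degree \<open>-1\<close> and \<open>d \<epsilon> = 1\<close>; in the path algebra \<open>G[t, dt]\<close>, \<open>\<theta> = dt\<close>.\<close>

definition cone :: "('k, 'a::ab_group_add) graded_alg \<Rightarrow> ('k, 'a \<times> 'a) graded_alg" where
  "cone G = odd_ext (-1) (\<lambda>x. (gd G (fst x) + snd x, - gd G (snd x))) G"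

definition path_ga :: "('k::field_char_0, 'a::ab_group_add) graded_alg \<Rightarrow> ('k, (nat \<Rightarrow> 'a) \<times> (nat \<Rightarrow> 'a)) graded_alg" where
  "path_ga G = odd_ext 1
     (\<lambda>x. (\<lambda>k. gd G (fst x k), \<lambda>k. pderiv_ga G (fst x) k - gd G (snd x k))) (poly_ga G)"

lemma eval1_eq:
  assumes "\<And>k. k > N \<Longrightarrow> f k = 0"
  shows "eval1 f = (\<Sum>k\<le>N. f k)"
  unfolding eval1_def by (rule sum.mono_neutral_left) (use assms in \<open>auto simp: not_less[symmetric]\<close>)

lemma eval1_zero [simp]: "eval1 0 = 0"
  by (simp add: eval1_def)

lemma eval1_add:
  assumes "f \<in> polys S" "g \<in> polys T"
  shows "eval1 (\<lambda>k. f k + g k) = eval1 f + eval1 g"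
proof -
  obtain N where N: "\<forall>k>N. f k = 0" using assms(1) by (rule polysE)
  obtain N' where N': "\<forall>k>N'. g k = 0" using assms(2) by (rule polysE)
  show ?thesis using N N' by (simp add: eval1_eq[of "max N N'"] sum.distrib)
qed

text \<open>Differentials and morphisms are additive only within a homogeneous piece
  \<open>S\<close>, so the induction also has to keep the partial sums inside
  \<open>S\<close>.\<close>

lemma eval1_hom:
  assumes "f \<in> polys S" "F 0 = 0" "0 \<in> S" "\<And>x y. \<lbrakk>x \<in> S; y \<in> S\<rbrakk> \<Longrightarrow> x + y \<in> S"
    and "\<And>x y. \<lbrakk>x \<in> S; y \<in> S\<rbrakk> \<Longrightarrow> F (x + y) = F x + F y"
  shows "eval1 (\<lambda>k. F (f k)) = F (eval1 f)"
proof -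
  obtain N where N: "\<forall>k>N. f k = 0" using assms(1) by (rule polysE)
  have "(\<Sum>k\<le>N. f k) \<in> S \<and> F (\<Sum>k\<le>N. f k) = (\<Sum>k\<le>N. F (f k))" for N
    by (induction N) (auto simp: assms polysD[OF assms(1)])
  then show ?thesis using N assms(2) by (simp add: eval1_eq[of N])
qed

lemma polys_map:
  assumes "f \<in> polys S" "F 0 = 0" "\<And>x. x \<in> S \<Longrightarrow> F x \<in> T"
  shows "(\<lambda>k. F (f k)) \<in> polys T"
  using assms unfolding polys_def by auto metis

context graded_lie
begin

lemma pderiv_in: "f \<in> polys (gh G n) \<Longrightarrow> pderiv_ga G f \<in> polys (gh G n)"
  unfolding polys_def pderiv_ga_def by (auto simp: scale_in intro: less_SucI)

lemma pint_in:
  assumes "f \<in> polys (gh G n)" shows "pint_ga G f \<in> polys (gh G n)"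
proof -
  obtain N where N: "\<forall>k>N. f k = 0" using assms(1) by (rule polysE)
  show ?thesis
    by (rule polysI[of _ _ "Suc N"])
       (use N in \<open>auto simp: pint_ga_def scale_in polysD[OF assms] split: nat.split\<close>)
qed

lemma pderiv_pint: "pderiv_ga G (pint_ga G f) = f"
  by (simp add: fun_eq_iff pderiv_ga_def pint_ga_def del: of_nat_Suc)

lemma pint_pderiv: "f 0 = 0 \<Longrightarrow> pint_ga G (pderiv_ga G f) = f"
  by (auto simp: fun_eq_iff pderiv_ga_def pint_ga_def simp del: of_nat_Suc split: nat.split)

lemma eval1_in: "f \<in> polys (gh G n) \<Longrightarrow> eval1 f \<in> gh G n"
  unfolding eval1_def by (rule sum_in) (rule polysD)

lemma eval1_scale: "f \<in> polys (gh G n) \<Longrightarrow> eval1 (\<lambda>k. gscal G c (f k)) = gscal G c (eval1 f)"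
  by (rule eval1_hom) (auto simp: add_in V.scale_right_distrib)

text \<open>The Cauchy product summed up to \<open>N + N'\<close> runs over a triangle of exponents
  that contains the rectangle \<open>{..N} \<times> {..N'}\<close>; outside the rectangle one factor
  is zero.\<close>

lemma eval1_conv:
  assumes f: "f \<in> polys (gh G m)" and g: "g \<in> polys (gh G n)"
  shows "eval1 (conv (gb G m) f g) = gb G m (eval1 f) (eval1 g)"
proof -
  obtain N where N: "\<forall>k>N. f k = 0" using f by (rule polysE)
  obtain N' where N': "\<forall>k>N'. g k = 0" using g by (rule polysE)
  note D = polysD[OF f] polysD[OF g]
  have z: "gb G m (f i) (g j) = 0" if "i > N \<or> j > N'" for i j
    using that N N' br_zero_left[OF D(2)] br_zero_right[OF D(1)] by auto
  have "eval1 (conv (gb G m) f g) = (\<Sum>k\<le>N + N'. conv (gb G m) f g k)"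
  proof (rule eval1_eq)
    fix k assume k: "k > N + N'"
    then have "i > N \<or> k - i > N'" for i by auto
    then show "conv (gb G m) f g k = 0" unfolding conv_def by (intro sum.neutral ballI z)
  qed
  also have "\<dots> = (\<Sum>(i, j)\<in>{(i, j). i + j \<le> N + N'}. gb G m (f i) (g j))"
    unfolding conv_def sum.Sigma[OF finite_atMost ballI[OF finite_atMost]]
    by (rule sum.reindex_bij_witness[where i = "\<lambda>(i, j). (i + j, i)" and j = "\<lambda>(m, i). (i, m - i)"]) auto
  also have "\<dots> = (\<Sum>(i, j)\<in>{..N} \<times> {..N'}. gb G m (f i) (g j))"
  proof (rule sum.mono_neutral_right)
    show "finite {(i, j). i + j \<le> N + N'}"
      by (rule finite_subset[of _ "{..N + N'} \<times> {..N + N'}"]) auto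
  qed (auto intro!: z)
  also have "\<dots> = (\<Sum>i\<le>N. \<Sum>j\<le>N'. gb G m (f i) (g j))"
    by (simp add: sum.cartesian_product)
  also have "\<dots> = gb G m (\<Sum>i\<le>N. f i) (\<Sum>j\<le>N'. g j)"
    by (simp add: br_sum_right[OF D(1) D(2), symmetric] br_sum_left[OF sum_in[OF D(2)] D(1), symmetric])
  finally show ?thesis using N N' eval1_eq[of N f] eval1_eq[of N' g] by simp
qed

text \<open>The factor \<open>Suc k\<close> is split as \<open>i + (Suc k - i)\<close>, and each
  part differentiates one of the two arguments.\<close>

lemma pderiv_conv:
  assumes f: "f \<in> polys (gh G m)" and g: "g \<in> polys (gh G n)"
  shows "pderiv_ga G (conv (gb G m) f g) k
    = conv (gb G m) (pderiv_ga G f) g k + conv (gb G m) f (pderiv_ga G g) k"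
proof -
  note D = polysD[OF f] polysD[OF g]
  let ?t = "\<lambda>i. gb G m (f i) (g (Suc k - i))"
  have "pderiv_ga G (conv (gb G m) f g) k
      = (\<Sum>i\<le>Suc k. gscal G (of_nat i + of_nat (Suc k - i)) (?t i))"
    unfolding pderiv_ga_def conv_def V.scale_sum_right
    by (intro sum.cong refl) (simp del: of_nat_Suc add: of_nat_add[symmetric] of_nat_diff)
  also have "\<dots> = (\<Sum>i\<le>Suc k. gscal G (of_nat i) (?t i))
      + (\<Sum>i\<le>Suc k. gscal G (of_nat (Suc k - i)) (?t i))"
    by (simp only: V.scale_left_distrib sum.distrib)
  also have "(\<Sum>i\<le>Suc k. gscal G (of_nat i) (?t i)) = conv (gb G m) (pderiv_ga G f) g k"
    unfolding conv_def pderiv_ga_def by (subst sum.atMost_Suc_shift) (simp add: br_scale_left[OF D] del: of_nat_Suc)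
  also have "(\<Sum>i\<le>Suc k. gscal G (of_nat (Suc k - i)) (?t i)) = conv (gb G m) f (pderiv_ga G g) k"
    unfolding conv_def pderiv_ga_def
    by (auto intro!: sum.cong simp: br_scale_right[OF D] Suc_diff_le simp del: of_nat_Suc of_nat_diff)
  finally show ?thesis .
qed

end

context dg_lie
begin

lemma d_poly_in: "f \<in> polys (gh G n) \<Longrightarrow> (\<lambda>k. gd G (f k)) \<in> polys (gh G (n + 1))"
  by (rule polys_map) (auto simp: d_in)

lemma eval1_d: "f \<in> polys (gh G n) \<Longrightarrow> eval1 (\<lambda>k. gd G (f k)) = gd G (eval1 f)"
  by (rule eval1_hom) (auto simp: add_in d_add)

lemma d_conv:
  assumes f: "f \<in> polys (gh G m)" and g: "g \<in> polys (gh G n)"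
  shows "gd G (conv (gb G m) f g k)
    = conv (gb G (m + 1)) (\<lambda>k. gd G (f k)) g k + sg m (conv (gb G m) f (\<lambda>k. gd G (g k)) k)"
  unfolding conv_def 
  by (subst d_sum, rule br_in[OF polysD[OF f] polysD[OF g]])
     (simp add: leibniz[OF polysD[OF f] polysD[OF g]] sum.distrib sg_sum)

lemma dg_lie_poly: "dg_lie (poly_ga G)"
proof (rule dg_lie.intro[OF graded_lie_poly dg_lie_axioms.intro])
  fix f g m n
  assume "f \<in> gh (poly_ga G) m" "g \<in> gh (poly_ga G) n"
  then show "gd (poly_ga G) (gb (poly_ga G) m f g) = gb (poly_ga G) (m + 1) (gd (poly_ga G) f) g +
      sg m (gb (poly_ga G) m f (gd (poly_ga G) g))"
    by (simp add: poly_ga_def fun_eq_iff d_conv sg_apply)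
qed (auto simp: poly_ga_def d_poly_in fun_eq_iff d_add[OF polysD polysD] d_scale[OF polysD] d_d[OF polysD])

lemma pderiv_d: "f \<in> polys (gh G n) \<Longrightarrow> pderiv_ga G (\<lambda>k. gd G (f k)) = (\<lambda>k. gd G (pderiv_ga G f k))"
  by (simp add: pderiv_ga_def fun_eq_iff d_scale[OF polysD] del: of_nat_Suc)

lemma pint_d: "f \<in> polys (gh G n) \<Longrightarrow> pint_ga G (\<lambda>k. gd G (f k)) = (\<lambda>k. gd G (pint_ga G f k))"
  by (auto simp: pint_ga_def fun_eq_iff d_scale[OF polysD] simp del: of_nat_Suc split: nat.split)

text \<open>The differential of \<open>a + \<epsilon> b\<close> is
  \<open>da + b - \<epsilon> db\<close>; applying it once more produces \<open>db\<close> and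
  \<open>- db\<close>, which cancel.\<close>

lemma dg_lie_cone: "dg_lie (cone G)"
proof (rule dg_lie.intro)
  show "graded_lie (cone G)" unfolding cone_def by (rule graded_lie_odd_ext) simp
  show "dg_lie_axioms (cone G)"
  proof (rule dg_lie_axioms.intro)
    fix x y m n
    assume "x \<in> gh (cone G) m" "y \<in> gh (cone G) n"
    then obtain a b a' b' where eq: "x = (a, b)" "y = (a', b')" and a: "a \<in> gh G m" and b: "b \<in> gh G (m + 1)"
      and a': "a' \<in> gh G n" and b': "b' \<in> gh G (n + 1)"
      by (auto simp: cone_def odd_ext_def)
    note I = br_in[OF a a'] br_in[OF b a'] br_in[OF a b']
    have 1: "gd G (gb G (m + 1) b a' + sg m (gb G m a b'))
        = gd G (gb G (m + 1) b a') + sg m (gd G (gb G m a b'))"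
      using d_add[OF I(2), of "sg m (gb G m a b')"] I(3) d_sg[OF I(3)] by (simp add: sg_in algebra_simps)
    show "gd (cone G) (gb (cone G) m x y) = gb (cone G) (m + 1) (gd (cone G) x) y +
      sg m (gb (cone G) m x (gd (cone G) y))"
      using leibniz[OF a a'] leibniz[OF a b'] leibniz[OF b a']
        br_add_left[OF d_in[OF a] b a'] br_add_left[OF d_in[OF a] b b'] 
        br_add_right[OF a d_in[OF a'] b'] br_add_right[OF b d_in[OF a'] b']
        br_neg_right[OF a d_in[OF b']] br_neg_left[OF d_in[OF b] a']
      by (simp add: cone_def odd_ext_def eq 1) (simp add: sg_def)
  next
    fix x n assume "x \<in> gh (cone G) n"
    then obtain a b where eq: "x = (a, b)" and a: "a \<in> gh G n" and b: "b \<in> gh G (n + 1)"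
      by (auto simp: cone_def odd_ext_def)
    note d = d_in[OF a] d_in[OF b]
    show "gd (cone G) x \<in> gh (cone G) (n + 1)"
      using add_in[OF d(1) b] neg_in[OF d(2)] by (simp add: cone_def odd_ext_def eq)
    show "gd (cone G) (gscal (cone G) c x) = gscal (cone G) c (gd (cone G) x)" for c
      by (simp add: cone_def odd_ext_def eq d_scale[OF a] d_scale[OF b] V.scale_right_distrib)
    show "gd (cone G) (gd (cone G) x) = 0"
      by (simp add: cone_def odd_ext_def eq d_add[OF d(1) b] d_d[OF a] d_d[OF b] d_neg[OF d(2)] zero_prod_def)
  next
    fix x y n assume "x \<in> gh (cone G) n" "y \<in> gh (cone G) n"
    then show "gd (cone G) (x + y) = gd (cone G) x + gd (cone G) y"
      by (auto simp: cone_def odd_ext_def d_add)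
  qed
qed

text \<open>The \<open>dt\<close>-component of the differential of \<open>f + dt g\<close> is
  \<open>f' - dg\<close>. Its square vanishes because \<open>d\<close> commutes with the derivative
  in \<open>t\<close>, and the Leibniz rule combines \<open>pderiv_conv\<close> with
  \<open>d_conv\<close>.\<close>

lemma dg_lie_path: "dg_lie (path_ga G)"
proof (rule dg_lie.intro)
  interpret P: dg_lie "poly_ga G" by (rule dg_lie_poly)
  show "graded_lie (path_ga G)" unfolding path_ga_def by (rule P.graded_lie_odd_ext) simp
  show "dg_lie_axioms (path_ga G)"
  proof (rule dg_lie_axioms.intro)
    fix x n assume "x \<in> gh (path_ga G) n"
    then obtain f g where eq: "x = (f, g)" and f: "f \<in> polys (gh G n)" and g: "g \<in> polys (gh G (n - 1))"
      by (auto simp: path_ga_def odd_ext_def poly_ga_def)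
    have "(\<lambda>k. pderiv_ga G f k - gd G (g k)) \<in> polys (gh G n)"
      using P.diff_in[of "pderiv_ga G f" n "\<lambda>k. gd G (g k)"] pderiv_in[OF f] d_poly_in[OF g]
      by (simp add: poly_ga_def fun_diff_def)
    then show "gd (path_ga G) x \<in> gh (path_ga G) (n + 1)"
      using d_poly_in[OF f] by (simp add: path_ga_def odd_ext_def eq poly_ga_def)
    show "gd (path_ga G) (gscal (path_ga G) c x) = gscal (path_ga G) c (gd (path_ga G) x)" for c
      by (simp add: path_ga_def odd_ext_def eq poly_ga_def fun_eq_iff d_scale polysD[OF f]
          d_scale[OF polysD[OF g]] pderiv_ga_def V.scale_right_diff_distrib V.scale_left_commute 
          d_scale[OF polysD[OF f]] del: of_nat_Suc)
    show "gd (path_ga G) (gd (path_ga G) x) = 0"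
      using d_diff[OF polysD[OF pderiv_in[OF f]] polysD[OF d_poly_in[OF g, simplified]]]
      by (simp add: path_ga_def odd_ext_def eq zero_prod_def fun_eq_iff pderiv_d[OF f]
          d_d[OF polysD[OF f]] d_d[OF polysD[OF g]])
  next
    fix x y n assume "x \<in> gh (path_ga G) n" "y \<in> gh (path_ga G) n"
    then show "gd (path_ga G) (x + y) = gd (path_ga G) x + gd (path_ga G) y"
      by (auto simp: path_ga_def odd_ext_def poly_ga_def fun_eq_iff d_add[OF polysD polysD]
         pderiv_ga_def V.scale_right_distrib simp del: of_nat_Suc)
  next
    fix x y m n
    assume "x \<in> gh (path_ga G) m" "y \<in> gh (path_ga G) n"
    then obtain f g f' g' where eq: "x = (f, g)" "y = (f', g')" and f: "f \<in> polys (gh G m)"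
      and g: "g \<in> polys (gh G (m - 1))" and f': "f' \<in> polys (gh G n)" and g': "g' \<in> polys (gh G (n - 1))"
      by (auto simp: path_ga_def odd_ext_def poly_ga_def)
    let ?d = "\<lambda>f k. gd G (f k)"
    have 1: "gd G (conv (gb G (m - 1)) g f' k + sg m (conv (gb G m) f g' k))
       = gd G (conv (gb G (m - 1)) g f' k) + sg m (gd G (conv (gb G m) f g' k))" for k
      using d_add[OF polysD[OF conv_bilin[OF g f']], of "sg m (conv (gb G m) f g' k)" k]
        polysD[OF conv_bilin[OF f g'], of k] d_sg[of "conv (gb G m) f g' k" "m + (n - 1)"]
      by (simp add: sg_in algebra_simps)
    have 2: "conv (gb G m) (\<lambda>k. pderiv_ga G f k - gd G (g k)) f' k
      = conv (gb G m) (pderiv_ga G f) f' k - conv (gb G m) (?d g) f' k" for k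
      using fun_cong[OF P.br_add_left[of "pderiv_ga G f" m "- ?d g" f' n], of k]
        fun_cong[OF P.br_neg_left[of "?d g" m f' n], of k]
        pderiv_in[OF f] d_poly_in[OF g] P.neg_in[of "?d g" m] f'
      by (simp add: poly_ga_def fun_Compl_def plus_fun_def)
    have 3: "conv (gb G m) f (\<lambda>k. pderiv_ga G f' k - gd G (g' k)) k
      = conv (gb G m) f (pderiv_ga G f') k - conv (gb G m) f (?d g') k" for k
      using fun_cong[OF P.br_add_right[of f m "pderiv_ga G f'" n "- ?d g'"], of k]
        fun_cong[OF P.br_neg_right[of f m "?d g'" n], of k]
        pderiv_in[OF f'] d_poly_in[OF g'] P.neg_in[of "?d g'" n] f
      by (simp add: poly_ga_def fun_Compl_def plus_fun_def)
    have 4: "pderiv_ga G (\<lambda>k. conv (gb G m) f f' k) k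
       = conv (gb G m) (pderiv_ga G f) f' k + conv (gb G m) f (pderiv_ga G f') k" for k
      using pderiv_conv[OF f f'] .
    show "gd (path_ga G) (gb (path_ga G) m x y) = gb (path_ga G) (m + 1) (gd (path_ga G) x) y +
      sg m (gb (path_ga G) m x (gd (path_ga G) y))"
      using d_conv[OF f f'] d_conv[OF g f'] d_conv[OF f g']
      by (simp add: path_ga_def odd_ext_def eq poly_ga_def fun_eq_iff sg_apply sg_Pair 1 2 3 4)
         (simp add: sg_def)
  qed
qed

end

section \<open>Evaluation, primitives and functoriality\<close>

definition pev0 :: "(nat \<Rightarrow> 'a) \<times> (nat \<Rightarrow> 'a) \<Rightarrow> 'a" where
  "pev0 x = fst x 0"

definition pev1 :: "(nat \<Rightarrow> 'a::comm_monoid_add) \<times> (nat \<Rightarrow> 'a) \<Rightarrow> 'a" where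
  "pev1 x = eval1 (fst x)"

definition cst :: "'a \<Rightarrow> nat \<Rightarrow> 'a::zero" where
  "cst x k = (if k = 0 then x else 0)"

definition lin :: "'a \<Rightarrow> nat \<Rightarrow> 'a::zero" where
  "lin x k = (if k = 1 then x else 0)"

lemma eval1_cst [simp]: "eval1 (cst x) = (x::'a::comm_monoid_add)"
  by (subst eval1_eq[of 0]) (auto simp: cst_def)

lemma eval1_lin [simp]: "eval1 (lin x) = (x::'a::comm_monoid_add)"
  by (subst eval1_eq[of 1]) (auto simp: lin_def)

lemma cst_in: "\<lbrakk>x \<in> S; 0 \<in> S\<rbrakk> \<Longrightarrow> cst x \<in> polys S"
  by (rule polysI[of _ _ 0]) (auto simp: cst_def)

lemma lin_in: "\<lbrakk>x \<in> S; 0 \<in> S\<rbrakk> \<Longrightarrow> lin x \<in> polys S"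
  by (rule polysI[of _ _ 1]) (auto simp: lin_def)

lemma cst_zero [simp]: "cst 0 = 0" "lin 0 = 0"
  by (auto simp: cst_def lin_def)

lemma cst_0 [simp]: "cst x 0 = x" "lin x 0 = 0"
  by (auto simp: cst_def lin_def)

lemma cst_add: "cst (x + y) = cst x + cst (y::'a::monoid_add)"
  by (auto simp: cst_def)

lemma map_cst: "F 0 = 0 \<Longrightarrow> (\<lambda>k. F (cst x k)) = cst (F x)"
  by (auto simp: cst_def)

lemma map_lin: "F 0 = 0 \<Longrightarrow> (\<lambda>k. F (lin x k)) = lin (F x)"
  by (auto simp: lin_def)

lemma path_gh: "gh (path_ga G) n = polys (gh G n) \<times> polys (gh G (n - 1))"
  by (simp add: path_ga_def odd_ext_def poly_ga_def)

lemma path_gd: "gd (path_ga G) x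
    = (\<lambda>k. gd G (fst x k), \<lambda>k. pderiv_ga G (fst x) k - gd G (snd x k))"
  by (simp add: path_ga_def odd_ext_def)

lemma path_gscal: "gscal (path_ga G) c x
    = (\<lambda>k. gscal G c (fst x k), \<lambda>k. gscal G c (snd x k))"
  by (simp add: path_ga_def odd_ext_def poly_ga_def)

lemma path_gb: "gb (path_ga G) m x y = (conv (gb G m) (fst x) (fst y),
    conv (gb G (m - 1)) (snd x) (fst y) + sg m (conv (gb G m) (fst x) (snd y)))"
  by (simp add: path_ga_def odd_ext_def poly_ga_def)

context dg_lie
begin

interpretation path: dg_lie "path_ga G" by (rule dg_lie_path)

lemma pev1_in: "y \<in> gh (path_ga G) n \<Longrightarrow> pev1 y \<in> gh G n"
  by (auto simp: path_gh pev1_def eval1_in)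

lemma pev0_d: "pev0 (gd (path_ga G) y) = gd G (pev0 y)"
  by (simp add: path_gd pev0_def)

lemma pev1_d: "y \<in> gh (path_ga G) n \<Longrightarrow> pev1 (gd (path_ga G) y) = gd G (pev1 y)"
  by (auto simp: path_gd pev1_def path_gh eval1_d)

lemma pev0_add: "pev0 (x + y) = pev0 x + pev0 y"
  by (simp add: pev0_def)

lemma pev1_add:
  assumes "x \<in> gh (path_ga G) n" "y \<in> gh (path_ga G) n"
  shows "pev1 (x + y) = pev1 x + pev1 y"
  using assms eval1_add[of "fst x" _ "fst y"] by (auto simp: pev1_def path_gh plus_fun_def)

lemma pev0_scale: "pev0 (gscal (path_ga G) c x) = gscal G c (pev0 x)"
  by (simp add: pev0_def path_gscal)

lemma pev1_scale: "x \<in> gh (path_ga G) n \<Longrightarrow> pev1 (gscal (path_ga G) c x) = gscal G c (pev1 x)"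
  by (auto simp: pev1_def path_gscal path_gh eval1_scale)

lemma pev0_diff: "pev0 (x - y) = pev0 x - pev0 y"
  by (simp add: pev0_def)

lemma pev1_diff:
  assumes "x \<in> gh (path_ga G) n" "y \<in> gh (path_ga G) n"
  shows "pev1 (x - y) = pev1 x - pev1 y"
  using pev1_add[OF path.diff_in[OF assms] assms(2)] by (simp add: eq_diff_eq)

lemma pev0_br: "pev0 (gb (path_ga G) m x y) = gb G m (pev0 x) (pev0 y)"
  by (simp add: pev0_def path_gb conv_def)

lemma pev1_br:
  "\<lbrakk>x \<in> gh (path_ga G) m; y \<in> gh (path_ga G) n\<rbrakk> \<Longrightarrow>
    pev1 (gb (path_ga G) m x y) = gb G m (pev1 x) (pev1 y)"
  by (auto simp: pev1_def path_gb path_gh eval1_conv)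

lemma path_cst:
  assumes "x \<in> gh G n"
  shows "(cst x, 0) \<in> gh (path_ga G) n" "gd (path_ga G) (cst x, 0) = (cst (gd G x), 0)"
    "pev0 (cst x, 0) = x" "pev1 (cst x, 0) = x"
proof -
  have "pderiv_ga G (cst x) k = 0" for k by (simp add: pderiv_ga_def cst_def)
  then show "gd (path_ga G) (cst x, 0) = (cst (gd G x), 0)"
    by (auto simp: path_gd map_cst[of "gd G"])
  show "(cst x, 0) \<in> gh (path_ga G) n"
    using assms cst_in[of 0 "gh G (n - 1)"] by (simp add: path_gh cst_in)
qed (auto simp: pev0_def pev1_def)

text \<open>The straight path \<open>t x\<close> from \<open>0\<close> to \<open>x\<close>, with
  differential \<open>t dx + dt x\<close>. Together with constant paths and the forms
  \<open>dt x\<close>, it is the material of all explicit paths below.\<close>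

lemma path_lin:
  assumes "x \<in> gh G n"
  shows "(lin x, 0) \<in> gh (path_ga G) n" "gd (path_ga G) (lin x, 0) = (lin (gd G x), cst x)"
    "pev0 (lin x, 0) = 0" "pev1 (lin x, 0) = x"
proof -
  have "pderiv_ga G (lin x) = cst x" by (auto simp: pderiv_ga_def cst_def lin_def)
  then show "gd (path_ga G) (lin x, 0) = (lin (gd G x), cst x)"
    by (auto simp: path_gd map_lin[of "gd G"])
  show "(lin x, 0) \<in> gh (path_ga G) n"
    using assms cst_in[of 0 "gh G (n - 1)"] by (simp add: path_gh lin_in)
qed (auto simp: pev0_def pev1_def)

lemma path_dt:
  assumes "x \<in> gh G (n - 1)"
  shows "(0, cst x) \<in> gh (path_ga G) n" "gd (path_ga G) (0, cst x) = (0, cst (- gd G x))"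
    "pev0 (0, cst x) = 0" "pev1 (0, cst x) = 0"
proof -
  have "pderiv_ga G 0 = 0" by (auto simp: pderiv_ga_def)
  moreover have "(\<lambda>k. - gd G (cst x k)) = cst (- gd G x)"
    using map_cst[of "\<lambda>x. - gd G x"] by simp
  ultimately show "gd (path_ga G) (0, cst x) = (0, cst (- gd G x))"
    by (auto simp: path_gd)
  show "(0, cst x) \<in> gh (path_ga G) n"
    using assms cst_in[of 0 "gh G n"] by (simp add: path_gh cst_in)
qed (auto simp: pev0_def pev1_def)

text \<open>The primitive is the integral of the \<open>dt\<close>-component of \<open>y\<close> from \<open>0\<close> to \<open>t\<close>, whose end point \<open>c\<close> can be moved by exact elements.\<close>

lemma path_primitive:
  assumes y: "y \<in> gh (path_ga G) n" "gd (path_ga G) y = 0" "pev0 y = 0"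
  obtains c where "c \<in> gh G (n - 1)" "gd G c = pev1 y"
    "\<And>u. u \<in> gh G (n - 2) \<Longrightarrow>
      \<exists>z \<in> gh (path_ga G) (n - 1). gd (path_ga G) z = y \<and> pev0 z = 0 \<and> pev1 z = c - gd G u"
proof -
  obtain f g where eq: "y = (f, g)" and f: "f \<in> polys (gh G n)" and g: "g \<in> polys (gh G (n - 1))"
    using y(1) by (auto simp: path_gh)
  have d: "pderiv_ga G f = (\<lambda>k. gd G (g k))" and f0: "f 0 = 0"
    using y(2,3) by (auto simp: eq path_gd zero_prod_def fun_eq_iff pev0_def)
  define z where "z = (pint_ga G g, 0 :: nat \<Rightarrow> 'b)"
  have z: "z \<in> gh (path_ga G) (n - 1)"
    using pint_in[OF g] cst_in[of 0 "gh G (n - 1 - 1)"] by (simp add: z_def path_gh)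
  \<comment> \<open>Closedness of \<open>y\<close> gives \<open>f' = dg\<close>; since
    \<open>f\<close> vanishes at \<open>0\<close>, it is the integral of \<open>dg\<close>, and
    integration commutes with \<open>d\<close>.\<close>
  have "(\<lambda>k. gd G (pint_ga G g k)) = f"
    using pint_pderiv[of f, OF f0] pint_d[OF g] d by simp
  then have dz: "gd (path_ga G) z = y"
    by (simp add: z_def path_gd eq pderiv_pint)
  have z0: "pev0 z = 0" by (simp add: z_def pev0_def pint_ga_def)
  show thesis
  proof (rule that[of "pev1 z"])
    show "pev1 z \<in> gh G (n - 1)" using pev1_in[OF z] .
    show "gd G (pev1 z) = pev1 y" using pev1_d[OF z] dz by simp
    fix u assume u: "u \<in> gh G (n - 2)"
    then have du: "gd G u \<in> gh G (n - 1)" using d_in[OF u] by simp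
    have u': "u \<in> gh G (n - 1 - 1)" using u by simp
    note L = path_lin[OF du] and D = path_dt[OF u']
    \<comment> \<open>The subtracted terms form the differential of \<open>t u\<close>: this is
      closed, vanishes at \<open>0\<close> and ends at \<open>du\<close>.\<close>
    define z' where "z' = z - (lin (gd G u), 0) - (0, cst u)"
    have "z' \<in> gh (path_ga G) (n - 1)"
      unfolding z'_def by (intro path.diff_in z L D)
    moreover have "gd (path_ga G) z' = y"
      unfolding z'_def path.d_diff[OF path.diff_in[OF z L(1)] D(1)] path.d_diff[OF z L(1)] L D dz d_d[OF u]
      by (simp add: prod_eq_iff fun_eq_iff cst_def)
    moreover have "pev0 z' = 0" "pev1 z' = pev1 z - gd G u"
      unfolding z'_def pev0_diff pev1_diff[OF path.diff_in[OF z L(1)] D(1)] pev1_diff[OF z L(1)] L D z0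
      by simp_all
    ultimately show "\<exists>z' \<in> gh (path_ga G) (n - 1). gd (path_ga G) z' = y \<and> pev0 z' = 0 \<and>
        pev1 z' = pev1 z - gd G u" by blast
  qed
qed

end

definition path_map :: "('a \<Rightarrow> 'b) \<Rightarrow> (nat \<Rightarrow> 'a) \<times> (nat \<Rightarrow> 'a) \<Rightarrow> (nat \<Rightarrow> 'b) \<times> (nat \<Rightarrow> 'b)" where
  "path_map \<phi> x = (\<lambda>k. \<phi> (fst x k), \<lambda>k. \<phi> (snd x k))"

locale dg_hom = A: dg_lie A + B: dg_lie B
  for A :: "('k::field_char_0, 'a::ab_group_add) graded_alg" and B :: "('k, 'b::ab_group_add) graded_alg" +
  fixes \<phi> :: "'a \<Rightarrow> 'b"
  assumes hom_in: "x \<in> gh A n \<Longrightarrow> \<phi> x \<in> gh B n"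
    and hom_add: "\<lbrakk>x \<in> gh A n; y \<in> gh A n\<rbrakk> \<Longrightarrow> \<phi> (x + y) = \<phi> x + \<phi> y"
    and hom_scale: "x \<in> gh A n \<Longrightarrow> \<phi> (gscal A c x) = gscal B c (\<phi> x)"
    and hom_d: "x \<in> gh A n \<Longrightarrow> \<phi> (gd A x) = gd B (\<phi> x)"
    and hom_br: "\<lbrakk>x \<in> gh A m; y \<in> gh A n\<rbrakk> \<Longrightarrow> \<phi> (gb A m x y) = gb B m (\<phi> x) (\<phi> y)"
begin

lemma hom_zero [simp]: "\<phi> 0 = 0"
  using hom_add[of 0 0 0] by simp

lemma hom_diff: "\<lbrakk>x \<in> gh A n; y \<in> gh A n\<rbrakk> \<Longrightarrow> \<phi> (x - y) = \<phi> x - \<phi> y"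
  using hom_add[of "x - y" n y] by (simp add: A.diff_in eq_diff_eq)

lemma hom_neg: "x \<in> gh A n \<Longrightarrow> \<phi> (- x) = - \<phi> x"
  using hom_diff[of 0 n x] by simp

lemma hom_sum: "(\<And>i. i \<in> I \<Longrightarrow> f i \<in> gh A n) \<Longrightarrow> \<phi> (sum f I) = (\<Sum>i\<in>I. \<phi> (f i))"
proof (induction I rule: infinite_finite_induct)
  case (insert i I)
  then show ?case using hom_add[of "f i" n "sum f I"] by (simp add: A.sum_in)
qed auto

lemma hom_conv:
  "\<lbrakk>f \<in> polys (gh A m); g \<in> polys (gh A n)\<rbrakk> \<Longrightarrow>
    \<phi> (conv (gb A m) f g k) = conv (gb B m) (\<lambda>k. \<phi> (f k)) (\<lambda>k. \<phi> (g k)) k"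
  unfolding conv_def
  by (subst hom_sum, rule A.br_in[OF polysD polysD]) (auto simp: hom_br[OF polysD polysD])

lemma pev0_path_map: "pev0 (path_map \<phi> x) = \<phi> (pev0 x)"
  by (simp add: pev0_def path_map_def)

lemma pev1_path_map: "x \<in> gh (path_ga A) n \<Longrightarrow> pev1 (path_map \<phi> x) = \<phi> (pev1 x)"
  unfolding pev1_def path_map_def fst_conv
  by (rule eval1_hom) (auto simp: path_gh hom_add A.add_in)

lemma dg_hom_path: "dg_hom (path_ga A) (path_ga B) (path_map \<phi>)"
proof (rule dg_hom.intro[OF A.dg_lie_path B.dg_lie_path dg_hom_axioms.intro])
  fix x n assume "x \<in> gh (path_ga A) n"
  then obtain f g where eq: "x = (f, g)" and f: "f \<in> polys (gh A n)" and g: "g \<in> polys (gh A (n - 1))"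
    by (auto simp: path_gh)
  show "path_map \<phi> x \<in> gh (path_ga B) n"
    using polys_map[of f _ \<phi>, OF f hom_zero hom_in] polys_map[of g _ \<phi>, OF g hom_zero hom_in]
    by (simp add: eq path_gh path_map_def)
  show "path_map \<phi> (gscal (path_ga A) c x) = gscal (path_ga B) c (path_map \<phi> x)" for c
    by (auto simp: eq path_gscal path_map_def hom_scale[OF polysD[OF f]] hom_scale[OF polysD[OF g]])
  have "\<phi> (pderiv_ga A f k - gd A (g k)) = pderiv_ga B (\<lambda>k. \<phi> (f k)) k - gd B (\<phi> (g k))" for k
    using hom_diff[OF polysD[OF A.pderiv_in[OF f], of k] polysD[OF A.d_poly_in[OF g, simplified], of k]]
    by (simp add: pderiv_ga_def hom_scale[OF polysD[OF f]] hom_d[OF polysD[OF g]] del: of_nat_Suc)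
  then show "path_map \<phi> (gd (path_ga A) x) = gd (path_ga B) (path_map \<phi> x)"
    by (auto simp: eq path_gd path_map_def hom_d[OF polysD[OF f]])
next
  fix x y m n assume "x \<in> gh (path_ga A) m" "y \<in> gh (path_ga A) n"
  then obtain f g f' g' where eq: "x = (f, g)" "y = (f', g')" and f: "f \<in> polys (gh A m)"
    and g: "g \<in> polys (gh A (m - 1))" and f': "f' \<in> polys (gh A n)" and g': "g' \<in> polys (gh A (n - 1))"
    by (auto simp: path_gh)
  have "\<phi> (conv (gb A (m - 1)) g f' k + sg m (conv (gb A m) f g' k))
      = \<phi> (conv (gb A (m - 1)) g f' k) + sg m (\<phi> (conv (gb A m) f g' k))" for k
    using hom_add[OF polysD[OF A.conv_bilin[OF g f']], of "sg m (conv (gb A m) f g' k)" k]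
      polysD[OF A.conv_bilin[OF f g'], of k] hom_neg[of "conv (gb A m) f g' k" "m + (n - 1)"]
    by (simp add: algebra_simps A.sg_in) (simp add: sg_def)
  then show "path_map \<phi> (gb (path_ga A) m x y) = gb (path_ga B) m (path_map \<phi> x) (path_map \<phi> y)"
    by (auto simp: eq path_gb path_map_def hom_conv[OF f f'] hom_conv[OF f g'] hom_conv[OF g f'] sg_apply)
next
  fix x y n assume "x \<in> gh (path_ga A) n" "y \<in> gh (path_ga A) n"
  then obtain f g f' g' where eq: "x = (f, g)" "y = (f', g')" and f: "f \<in> polys (gh A n)"
    and g: "g \<in> polys (gh A (n - 1))" and f': "f' \<in> polys (gh A n)" and g': "g' \<in> polys (gh A (n - 1))"
    by (auto simp: path_gh)
  show "path_map \<phi> (x + y) = path_map \<phi> x + path_map \<phi> y"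
    by (auto simp: eq path_map_def hom_add[OF polysD[OF f] polysD[OF f']] hom_add[OF polysD[OF g] polysD[OF g']])
qed

end

definition prod_ga :: "('k, 'a::ab_group_add) graded_alg \<Rightarrow> ('k, 'b::ab_group_add) graded_alg \<Rightarrow> ('k, 'a \<times> 'b) graded_alg" where
  "prod_ga A B = \<lparr>gscal = (\<lambda>c x. (gscal A c (fst x), gscal B c (snd x))),
     gh = (\<lambda>n. gh A n \<times> gh B n), gd = (\<lambda>x. (gd A (fst x), gd B (snd x))),
     gb = (\<lambda>m x y. (gb A m (fst x) (fst y), gb B m (snd x) (snd y)))\<rparr>"

lemma dg_lie_prod:
  assumes "dg_lie A" "dg_lie B" shows "dg_lie (prod_ga A B)"
proof -
  interpret A: dg_lie A by fact
  interpret B: dg_lie B by fact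
  show ?thesis
  proof (intro dg_lie.intro graded_lie.intro dg_lie_axioms.intro)
    show vs: "vector_space (gscal (prod_ga A B))"
      using vector_space_prod[OF A.vs B.vs] by (simp add: prod_ga_def)
    show "module.subspace (gscal (prod_ga A B)) (gh (prod_ga A B) n)" for n
      by (rule subspaceI[OF vs]) (auto simp: prod_ga_def zero_prod_def A.add_in B.add_in A.scale_in B.scale_in)
  next
    fix x y m n
    assume "x \<in> gh (prod_ga A B) m" "y \<in> gh (prod_ga A B) n"
    then show "gb (prod_ga A B) m x y = - sg (m * n) (gb (prod_ga A B) n y x)"
      using A.antisym[of "fst x" m "fst y" n] B.antisym[of "snd x" m "snd y" n]
      by (auto simp: prod_ga_def sg_Pair)
  next
    fix x y z m n p
    assume "x \<in> gh (prod_ga A B) m" "y \<in> gh (prod_ga A B) n" "z \<in> gh (prod_ga A B) p"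
    then show "gb (prod_ga A B) m x (gb (prod_ga A B) n y z)
      = gb (prod_ga A B) (m + n) (gb (prod_ga A B) m x y) z
        + sg (m * n) (gb (prod_ga A B) n y (gb (prod_ga A B) m x z))"
      using A.jacobi[of "fst x" m "fst y" n "fst z" p] B.jacobi[of "snd x" m "snd y" n "snd z" p]
      by (auto simp: prod_ga_def sg_Pair)
  next
    fix x y m n
    assume "x \<in> gh (prod_ga A B) m" "y \<in> gh (prod_ga A B) n"
    then show "gb (prod_ga A B) m x y \<in> gh (prod_ga A B) (m + n)"
      "gb (prod_ga A B) m x (gscal (prod_ga A B) c y) = gscal (prod_ga A B) c (gb (prod_ga A B) m x y)"
      "gd (prod_ga A B) (gb (prod_ga A B) m x y) = gb (prod_ga A B) (m + 1) (gd (prod_ga A B) x) y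
        + sg m (gb (prod_ga A B) m x (gd (prod_ga A B) y))" for c
      by (auto simp: prod_ga_def sg_Pair A.br_in B.br_in A.br_scale_right B.br_scale_right A.leibniz B.leibniz)
  next
    fix x y z m n
    assume "x \<in> gh (prod_ga A B) m" "y \<in> gh (prod_ga A B) n" "z \<in> gh (prod_ga A B) n"
    then show "gb (prod_ga A B) m x (y + z) = gb (prod_ga A B) m x y + gb (prod_ga A B) m x z"
      by (auto simp: prod_ga_def A.br_add_right B.br_add_right)
  next
    fix x n
    assume "x \<in> gh (prod_ga A B) n"
    then show "gd (prod_ga A B) x \<in> gh (prod_ga A B) (n + 1)" "gd (prod_ga A B) (gd (prod_ga A B) x) = 0"
      "gd (prod_ga A B) (gscal (prod_ga A B) c x) = gscal (prod_ga A B) c (gd (prod_ga A B) x)" for c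
      by (auto simp: prod_ga_def A.d_in B.d_in A.d_scale B.d_scale A.d_d B.d_d zero_prod_def)
  next
    fix x y n
    assume "x \<in> gh (prod_ga A B) n" "y \<in> gh (prod_ga A B) n"
    then show "gd (prod_ga A B) (x + y) = gd (prod_ga A B) x + gd (prod_ga A B) y"
      by (auto simp: prod_ga_def A.d_add B.d_add)
  qed
qed

section \<open>The homotopy pullback\<close>

text \<open>Integration of the \<open>dt\<close>-component over the unit interval; it lowers the
  degree by one.\<close>

definition pintegral :: "('k::field_char_0, 'a::ab_group_add) graded_alg \<Rightarrow> (nat \<Rightarrow> 'a) \<times> (nat \<Rightarrow> 'a) \<Rightarrow> 'a" where
  "pintegral G y = eval1 (pint_ga G (snd y))"

lemma pint_add:
  assumes "vector_space (gscal G)"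
  shows "pint_ga G (f + g) = pint_ga G f + pint_ga G g"
proof -
  interpret vector_space "gscal G" by fact
  show ?thesis by (auto simp: pint_ga_def fun_eq_iff scale_right_distrib split: nat.split)
qed

context dg_lie
begin

lemma pintegral_in: "y \<in> gh (path_ga G) n \<Longrightarrow> pintegral G y \<in> gh G (n - 1)"
  by (auto simp: pintegral_def path_gh intro!: eval1_in pint_in)

lemma pintegral_add:
  assumes "x \<in> gh (path_ga G) n" "y \<in> gh (path_ga G) n"
  shows "pintegral G (x + y) = pintegral G x + pintegral G y"
  using assms eval1_add[OF pint_in pint_in, of "snd x" "n - 1" "snd y" "n - 1"]
  by (auto simp: pintegral_def path_gh pint_add[OF vs, unfolded plus_fun_def] plus_fun_def)

lemma pintegral_zero [simp]: "pintegral G 0 = 0"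
proof -
  have "pint_ga G 0 = 0" by (auto simp: pint_ga_def fun_eq_iff split: nat.split)
  then show ?thesis by (simp add: pintegral_def)
qed

lemma pintegral_dt: "pintegral G (0, cst v) = v"
proof -
  have "pint_ga G (cst v) = lin v"
    by (auto simp: pint_ga_def cst_def lin_def split: nat.split)
  then show ?thesis by (simp add: pintegral_def)
qed

text \<open>The \<open>dt\<close>-component of the differential is \<open>f' - dg\<close>: the first
  term integrates to the difference of the end points, and \<open>d\<close> passes through the
  integral in the second.\<close>

lemma stokes:
  assumes "y \<in> gh (path_ga G) n"
  shows "pintegral G (gd (path_ga G) y) = pev1 y - pev0 y - gd G (pintegral G y)"
proof -
  obtain f g where eq: "y = (f, g)" and f: "f \<in> polys (gh G n)" and g: "g \<in> polys (gh G (n - 1))"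
    using assms by (auto simp: path_gh)
  have c: "cst (- f 0) \<in> polys (gh G n)" using polysD[OF f, of 0] by (simp add: cst_in neg_in)
  \<comment> \<open>The primitive of \<open>f'\<close> that vanishes at \<open>0\<close> is
    \<open>f\<close> minus its constant term.\<close>
  have "pint_ga G (\<lambda>k. pderiv_ga G f k - gd G (g k)) k
      = (f k + cst (- f 0) k) + - gd G (pint_ga G g k)" for k
    by (auto simp: pint_ga_def pderiv_ga_def cst_def V.scale_right_diff_distrib d_scale[OF polysD[OF g]]
        simp del: of_nat_Suc split: nat.split)
  then have "pint_ga G (\<lambda>k. pderiv_ga G f k - gd G (g k))
      = (\<lambda>k. (f k + cst (- f 0) k) + - gd G (pint_ga G g k))" by (rule ext)
  then have "pintegral G (gd (path_ga G) y)
      = eval1 (\<lambda>k. (f k + cst (- f 0) k) + - gd G (pint_ga G g k))"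
    by (simp add: pintegral_def path_gd eq)
  also have "\<dots> = eval1 (\<lambda>k. f k + cst (- f 0) k) + eval1 (\<lambda>k. - gd G (pint_ga G g k))"
  proof (rule eval1_add)
    show "(\<lambda>k. f k + cst (- f 0) k) \<in> polys (gh G n)"
      using graded_lie.add_in[OF graded_lie_poly, of f n "cst (- f 0)"] f c by (simp add: poly_ga_def plus_fun_def)
    show "(\<lambda>k. - gd G (pint_ga G g k)) \<in> polys (gh G n)"
      using polys_map[OF pint_in[OF g], of "\<lambda>x. - gd G x" "gh G n"] d_in[of _ "n - 1"] by (simp add: neg_in)
  qed
  also have "\<dots> = (eval1 f - f 0) - gd G (eval1 (pint_ga G g))"
    using eval1_hom[OF pint_in[OF g], of "\<lambda>x. - gd G x"] eval1_add[OF f c]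
    by (simp add: add_in d_add[of _ "n - 1"])
  finally show ?thesis by (simp add: pintegral_def eq pev0_def pev1_def)
qed

end

lemma (in dg_hom) pintegral_path_map:
  assumes "x \<in> gh (path_ga A) n"
  shows "pintegral B (path_map \<phi> x) = \<phi> (pintegral A x)"
proof -
  obtain f g where eq: "x = (f, g)" and g: "g \<in> polys (gh A (n - 1))"
    using assms by (auto simp: path_gh)
  have "pint_ga B (\<lambda>k. \<phi> (g k)) = (\<lambda>k. \<phi> (pint_ga A g k))"
    by (auto simp: fun_eq_iff pint_ga_def hom_scale[OF polysD[OF g]] split: nat.split)
  moreover have "eval1 (\<lambda>k. \<phi> (pint_ga A g k)) = \<phi> (eval1 (pint_ga A g))"
    by (rule eval1_hom[OF A.pint_in[OF g]]) (auto simp: A.add_in hom_add)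
  ultimately show ?thesis by (simp add: pintegral_def path_map_def eq)
qed

text \<open>If \<open>w\<close> is closed and \<open>w = d s\<close>, the path
  \<open>t w + dt s\<close> is closed: \<open>d(t w)\<close> contributes \<open>dt w\<close> and
  \<open>d(dt s)\<close> contributes \<open>- dt w\<close>. The next lemma is the variant with a
  closed constant path added and both signs reversed.\<close>

lemma lin_dt_cancel: "(lin 0, cst w) + (0, cst (- w)) = (0 :: (nat \<Rightarrow> 'a) \<times> (nat \<Rightarrow> 'a::ab_group_add))"
  by (simp add: zero_prod_def cst_add[symmetric])

lemma cst_lin_dt_cancel:
  "(cst 0, 0) - (lin 0, cst w) - (0, cst (- w)) = (0 :: (nat \<Rightarrow> 'a) \<times> (nat \<Rightarrow> 'a::ab_group_add))"
proof -
  have "- cst w - cst (- w) = 0" by (auto simp: cst_def)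
  then show ?thesis by (simp add: zero_prod_def)
qed

lemma cone_simps:
  "gscal (cone G) c x = (gscal G c (fst x), gscal G c (snd x))"
  "gh (cone G) n = gh G n \<times> gh G (n + 1)"
  "gd (cone G) x = (gd G (fst x) + snd x, - gd G (snd x))"
  "gb (cone G) m x y = (gb G m (fst x) (fst y),
        gb G (m + 1) (snd x) (fst y) + sg m (gb G m (fst x) (snd y)))"
  by (simp_all add: cone_def odd_ext_def)

lemma prod_simps:
  "gscal (prod_ga A B) c x = (gscal A c (fst x), gscal B c (snd x))"
  "gh (prod_ga A B) n = gh A n \<times> gh B n"
  "gd (prod_ga A B) x = (gd A (fst x), gd B (snd x))"
  "gb (prod_ga A B) m x y = (gb A m (fst x) (fst y), gb B m (snd x) (snd y))"
  by (simp_all add: prod_ga_def)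

text \<open>Multiplication by \<open>\<epsilon>\<close> contracts the cone: \<open>(a, b)\<close> is
  closed only if \<open>b = - da\<close>, and then it is the differential of
  \<open>\<epsilon> a\<close>.\<close>

lemma (in dg_lie) cone_acyclic:
  assumes "c \<in> gh (cone G) n" "gd (cone G) c = 0"
  shows "(0, fst c) \<in> gh (cone G) (n - 1)" "gd (cone G) (0, fst c) = c"
  using assms by (auto simp: cone_simps zero_prod_def neg_eq_iff_add_eq_0 prod_eq_iff)

text \<open>One choice that fixes both a projection onto \<open>S\<close> and, as its kernel, a
  complement of \<open>S\<close>.\<close>

definition subspace_proj :: "('k::field \<Rightarrow> 'a::ab_group_add \<Rightarrow> 'a) \<Rightarrow> 'a set \<Rightarrow> 'a \<Rightarrow> 'a" where
  "subspace_proj s S = (SOME q. range q \<subseteq> S \<and> module_hom s s q \<and> (\<forall>x\<in>S. q x = x))"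

text \<open>A projection is a left inverse on the whole space of the identity restricted to
  \<open>S\<close>; it exists because bases extend.\<close>

lemma subspace_proj:
  assumes "vector_space s" "module.subspace s S"
  shows "range (subspace_proj s S) \<subseteq> S \<and> module_hom s s (subspace_proj s S) \<and>
    (\<forall>x\<in>S. subspace_proj s S x = x)"
proof -
  interpret vector_space s by fact
  interpret vector_space_pair s s ..
  have "Vector_Spaces.linear s s id" by (rule linear_id)
  from linear_exists_left_inverse_on[OF this assms(2)]
  show ?thesis unfolding subspace_proj_def module_hom_iff_linear
    by (intro someI_ex[where P = "\<lambda>q. range q \<subseteq> S \<and> Vector_Spaces.linear s s q \<and> (\<forall>x\<in>S. q x = x)"]) auto
qed

text \<open>In the notation of the introduction, \<open>lpath\<close> is \<open>L'\<close>, \<open>fibre\<close> is \<open>T\<close>, \<open>compl_cocycles\<close> is \<open>V\<close>,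
  \<open>dt_forms\<close> is \<open>dt V\<close>, and \<open>pull\<close> is \<open>P\<close>; \<open>compl_cocycles_L\<close> is the image of the cohomology of \<open>P\<close> in \<open>V\<close>.\<close>

locale cartan = L: dg_lie L + M: dg_lie M
  for L :: "('k::field_char_0, 'a::ab_group_add) graded_alg" and M :: "('k, 'b::ab_group_add) graded_alg" +
  fixes H :: "int \<Rightarrow> 'b set" and \<iota> :: "'a \<Rightarrow> 'b"
  assumes H_sub: "H n \<subseteq> gh M n"
    and H_subsp: "M.V.subspace (H n)"
    and H_d: "h \<in> H n \<Longrightarrow> gd M h \<in> H (n + 1)"
    and H_br: "\<lbrakk>h \<in> H m; h' \<in> H n\<rbrakk> \<Longrightarrow> gb M m h h' \<in> H (m + n)"
    and i_in: "x \<in> gh L n \<Longrightarrow> \<iota> x \<in> gh M (n - 1)"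
    and i_add: "\<lbrakk>x \<in> gh L n; y \<in> gh L n\<rbrakk> \<Longrightarrow> \<iota> (x + y) = \<iota> x + \<iota> y"
    and i_scale: "x \<in> gh L n \<Longrightarrow> \<iota> (gscal L c x) = gscal M c (\<iota> x)"
    and i_i: "\<lbrakk>x \<in> gh L m; y \<in> gh L n\<rbrakk> \<Longrightarrow> gb M (m - 1) (\<iota> x) (\<iota> y) = 0"
    and i_br: "\<lbrakk>x \<in> gh L m; y \<in> gh L n\<rbrakk> \<Longrightarrow> \<iota> (gb L m x y) = gb M (m - 1) (\<iota> x) (gd M (\<iota> y))"
    and i_H: "x \<in> gh L n \<Longrightarrow> gd M (\<iota> x) + \<iota> (gd L x) \<in> H n"
    and H_inj: "\<lbrakk>h \<in> H n; u \<in> gh M (n - 1); h = gd M u\<rbrakk> \<Longrightarrow> \<exists>k\<in>H (n - 1). h = gd M k"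
    and i_inj: "\<lbrakk>x \<in> gh L n; gd L x = 0; h \<in> H (n - 1); u \<in> gh M (n - 2); \<iota> x = h + gd M u\<rbrakk>
        \<Longrightarrow> \<exists>x'\<in>gh L (n - 1). x = gd L x'"
begin

section \<open>Cartan calculus and the morphism from the cone\<close>

lemma H_in: "h \<in> H n \<Longrightarrow> h \<in> gh M n" using H_sub by blast
lemma H_zero [simp]: "0 \<in> H n" by (rule M.V.subspace_0[OF H_subsp])
lemma H_add: "\<lbrakk>x \<in> H n; y \<in> H n\<rbrakk> \<Longrightarrow> x + y \<in> H n" by (rule M.V.subspace_add[OF H_subsp])
lemma H_scale: "x \<in> H n \<Longrightarrow> gscal M c x \<in> H n" by (rule M.V.subspace_scale[OF H_subsp])

lemma i_zero [simp]: "\<iota> 0 = 0" using i_add[of 0 0 0] by simp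

lemma i_neg: "x \<in> gh L n \<Longrightarrow> \<iota> (- x) = - \<iota> x"
  using i_add[of x n "- x"] by (simp add: L.neg_in eq_neg_iff_add_eq_0 add.commute)

definition lie_der :: "'a \<Rightarrow> 'b" where
  "lie_der x = gd M (\<iota> x) + \<iota> (gd L x)"

lemma di_in: "x \<in> gh L n \<Longrightarrow> gd M (\<iota> x) \<in> gh M n"
  using M.d_in[OF i_in] by fastforce

lemma id_in: "x \<in> gh L n \<Longrightarrow> \<iota> (gd L x) \<in> gh M n"
  using i_in[OF L.d_in] by fastforce

lemma lie_der_H: "x \<in> gh L n \<Longrightarrow> lie_der x \<in> H n" by (simp add: lie_der_def i_H)
lemma lie_der_in: "x \<in> gh L n \<Longrightarrow> lie_der x \<in> gh M n" by (rule H_in[OF lie_der_H])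

lemma lie_der_zero [simp]: "lie_der 0 = 0" by (simp add: lie_der_def)

lemma lie_der_add: "\<lbrakk>x \<in> gh L n; y \<in> gh L n\<rbrakk> \<Longrightarrow> lie_der (x + y) = lie_der x + lie_der y"
  unfolding lie_der_def
  by (simp add: i_add L.d_add M.d_add[OF i_in i_in] i_add[OF L.d_in L.d_in])

lemma lie_der_scale: "x \<in> gh L n \<Longrightarrow> lie_der (gscal L c x) = gscal M c (lie_der x)"
  unfolding lie_der_def
  by (simp add: i_scale L.d_scale M.d_scale[OF i_in] i_scale[OF L.d_in] M.V.scale_right_distrib)

lemma d_lie_der: assumes "x \<in> gh L n" shows "gd M (lie_der x) = gd M (\<iota> (gd L x))"
  using M.d_add[OF di_in id_in, OF assms assms] M.d_d[OF i_in[OF assms]] by (simp add: lie_der_def)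

text \<open>The two terms of \<open>lie_der y\<close> give the bracket with \<open>d i\<close>,
  which is the second identity of (1), and the bracket with \<open>i\<close> of \<open>dy\<close>,
  which vanishes by the first.\<close>

lemma i_lie_der:
  assumes x: "x \<in> gh L m" and y: "y \<in> gh L n"
  shows "gb M (m - 1) (\<iota> x) (lie_der y) = \<iota> (gb L m x y)"
  using M.br_add_right[OF i_in[OF x] di_in[OF y] id_in[OF y]] i_i[OF x L.d_in[OF y]] i_br[OF x y]
  by (simp add: lie_der_def)

text \<open>Antisymmetry is used in \<open>M\<close> and in \<open>L\<close>; the exponents
  \<open>m n\<close> and \<open>(n + 1) m\<close> add up to \<open>m\<close> modulo 2. The degree
  \<open>n + 1\<close> of \<open>y\<close> makes \<open>\<iota> y\<close> of degree
  \<open>n\<close>.\<close>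

lemma lie_der_i:
  assumes x: "x \<in> gh L m" and y: "y \<in> gh L (n + 1)"
  shows "gb M m (lie_der x) (\<iota> y) = sg m (\<iota> (gb L m x y))"
proof -
  have "gb M m (lie_der x) (\<iota> y) = - sg (m * n) (\<iota> (gb L (n + 1) y x))"
    using M.antisym[OF lie_der_in[OF x] i_in[OF y]] i_lie_der[OF y x] by simp
  also have "gb L (n + 1) y x = - sg ((n + 1) * m) (gb L m x y)"
    by (rule L.antisym[OF y x])
  finally show ?thesis using L.br_in[OF x y]
    by (auto simp: sg_def i_neg)
qed

text \<open>Apply \<open>d\<close> to \<open>i_lie_der\<close> and add \<open>\<iota>\<close> of the
  Leibniz rule in \<open>L\<close>: the two terms \<open>\<iota> [x, dy]\<close> carry the signs of
  \<open>m - 1\<close> and \<open>m\<close> and cancel.\<close>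

lemma lie_der_br:
  assumes x: "x \<in> gh L m" and y: "y \<in> gh L n"
  shows "lie_der (gb L m x y) = gb M m (lie_der x) (lie_der y)"
proof -
  note xy = L.d_in[OF x] L.d_in[OF y]
  have "gd M (\<iota> (gb L m x y)) = gd M (gb M (m - 1) (\<iota> x) (lie_der y))"
    by (simp add: i_lie_der[OF x y])
  also have "\<dots> = gb M m (gd M (\<iota> x)) (lie_der y) + sg (m - 1) (gb M (m - 1) (\<iota> x) (gd M (\<iota> (gd L y))))"
    using M.leibniz[OF i_in[OF x] lie_der_in[OF y]] by (simp add: d_lie_der[OF y])
  also have "gb M (m - 1) (\<iota> x) (gd M (\<iota> (gd L y))) = \<iota> (gb L m x (gd L y))"
    using i_br[OF x xy(2)] by simp
  finally have 1: "gd M (\<iota> (gb L m x y))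
    = gb M m (gd M (\<iota> x)) (lie_der y) + sg (m - 1) (\<iota> (gb L m x (gd L y)))" .
  have "\<iota> (gd L (gb L m x y)) = \<iota> (gb L (m + 1) (gd L x) y) + sg m (\<iota> (gb L m x (gd L y)))"
    using i_add[of "gb L (m + 1) (gd L x) y" "m + n + 1" "sg m (gb L m x (gd L y))"]
      L.br_in[OF xy(1) y] L.br_in[OF x xy(2)] i_neg[OF L.br_in[OF x xy(2)]]
    by (simp add: L.leibniz[OF x y] L.sg_in algebra_simps) (simp add: sg_def)
  also have "\<iota> (gb L (m + 1) (gd L x) y) = gb M m (\<iota> (gd L x)) (lie_der y)"
    using i_lie_der[OF xy(1) y] by simp
  finally have 2: "\<iota> (gd L (gb L m x y))
    = gb M m (\<iota> (gd L x)) (lie_der y) + sg m (\<iota> (gb L m x (gd L y)))" .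
  have 3: "gb M m (lie_der x) (lie_der y) = gb M m (gd M (\<iota> x)) (lie_der y) + gb M m (\<iota> (gd L x)) (lie_der y)"
    unfolding lie_der_def[of x] by (rule M.br_add_left[OF di_in[OF x] id_in[OF x] lie_der_in[OF y]])
  show ?thesis unfolding lie_der_def[of "gb L m x y"] 1 2 3 by (simp add: sg_def)
qed

definition cmap :: "'a \<times> 'a \<Rightarrow> 'b" where
  "cmap x = lie_der (fst x) + \<iota> (snd x)"

text \<open>For the differential, the extra summand \<open>b\<close> of the first component
  contributes \<open>lie_der b\<close>, and \<open>lie_der b - \<iota> (db)\<close> is
  \<open>d (\<iota> b)\<close>. The bracket expands into four terms, settled by
  \<open>lie_der_br\<close>, \<open>i_lie_der\<close>, \<open>lie_der_i\<close> and
  \<open>i_i\<close>.\<close>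

lemma cmap_hom: "dg_hom (cone L) M cmap"
proof (rule dg_hom.intro[OF L.dg_lie_cone M.dg_lie_axioms dg_hom_axioms.intro])
  fix x n assume "x \<in> gh (cone L) n"
  then obtain a b where eq: "x = (a, b)" and a: "a \<in> gh L n" and b: "b \<in> gh L (n + 1)"
    by (auto simp: cone_simps)
  have ib: "\<iota> b \<in> gh M n" using i_in[OF b] by simp
  show "cmap x \<in> gh M n"
    by (simp add: cmap_def eq lie_der_in[OF a] ib M.add_in)
  show "cmap (gscal (cone L) c x) = gscal M c (cmap x)" for c
    by (simp add: cmap_def cone_simps eq lie_der_scale[OF a] i_scale[OF b] M.V.scale_right_distrib)
  have "lie_der (gd L a) = gd M (lie_der a)"
    using d_lie_der[OF a] L.d_d[OF a] by (simp add: lie_der_def)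
  then show "cmap (gd (cone L) x) = gd M (cmap x)"
    using lie_der_add[OF L.d_in[OF a] b] i_neg[OF L.d_in[OF b]] M.d_add[OF lie_der_in[OF a] ib]
    by (simp add: cmap_def cone_simps eq lie_der_def[of b])
next
  fix x y n assume "x \<in> gh (cone L) n" "y \<in> gh (cone L) n"
  then show "cmap (x + y) = cmap x + cmap y"
    by (auto simp: cmap_def cone_simps lie_der_add i_add)
next
  fix x y m n assume "x \<in> gh (cone L) m" "y \<in> gh (cone L) n"
  then obtain a b a' b' where eq: "x = (a, b)" "y = (a', b')" and a: "a \<in> gh L m" and b: "b \<in> gh L (m + 1)"
    and a': "a' \<in> gh L n" and b': "b' \<in> gh L (n + 1)"
    by (auto simp: cone_simps)
  have ib: "\<iota> b \<in> gh M m" using i_in[OF b] by simp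
  have ib': "\<iota> b' \<in> gh M n" using i_in[OF b'] by simp
  have "cmap (gb (cone L) m x y) = gb M m (lie_der a) (lie_der a') + \<iota> (gb L (m + 1) b a') + sg m (\<iota> (gb L m a b'))"
    using i_add[of "gb L (m + 1) b a'" "m + n + 1" "sg m (gb L m a b')"] L.br_in[OF b a'] L.br_in[OF a b']
      i_neg[OF L.br_in[OF a b']]
    by (simp add: cmap_def cone_simps eq lie_der_br[OF a a'] L.sg_in algebra_simps) (simp add: sg_def)
  also have "\<iota> (gb L (m + 1) b a') = gb M m (\<iota> b) (lie_der a')"
    using i_lie_der[OF b a'] by simp
  also have "sg m (\<iota> (gb L m a b')) = gb M m (lie_der a) (\<iota> b')"
    using lie_der_i[OF a b'] by simp
  also have "gb M m (lie_der a) (lie_der a') + gb M m (\<iota> b) (lie_der a') + gb M m (lie_der a) (\<iota> b')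
      = gb M m (cmap x) (cmap y)"
    using M.br_add_right[OF M.add_in[OF lie_der_in[OF a] ib] lie_der_in[OF a'] ib']
      M.br_add_left[OF lie_der_in[OF a] ib lie_der_in[OF a']] M.br_add_left[OF lie_der_in[OF a] ib ib'] i_i[OF b b']
    by (simp add: cmap_def eq)
  finally show "cmap (gb (cone L) m x y) = gb M m (cmap x) (cmap y)" .
qed

interpretation C: dg_lie "cone L" by (rule L.dg_lie_cone)
interpretation PC: dg_lie "path_ga (cone L)" by (rule C.dg_lie_path)
interpretation PM: dg_lie "path_ga M" by (rule M.dg_lie_path)
interpretation phi: dg_hom "cone L" M cmap by (rule cmap_hom)
interpretation Pphi: dg_hom "path_ga (cone L)" "path_ga M" "path_map cmap" by (rule phi.dg_hom_path)

section \<open>The homotopy fibre and its cohomology\<close>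

definition fibre :: "('k, (nat \<Rightarrow> 'b) \<times> (nat \<Rightarrow> 'b)) graded_alg" where
  "fibre = (path_ga M)\<lparr>gh := \<lambda>n. {y \<in> gh (path_ga M) n. pev0 y = 0 \<and> pev1 y \<in> H n}\<rparr>"

lemma fibre_simps [simp]:
  "gscal fibre = gscal (path_ga M)" "gd fibre = gd (path_ga M)" "gb fibre = gb (path_ga M)"
  by (simp_all add: fibre_def)

lemma fibre_in: "y \<in> gh fibre n \<longleftrightarrow> y \<in> gh (path_ga M) n \<and> pev0 y = 0 \<and> pev1 y \<in> H n"
  by (simp add: fibre_def)

lemma dg_lie_fibre: "dg_lie fibre"
  unfolding fibre_def
proof (rule PM.sub_dg_lie)
  show "PM.V.subspace {y \<in> gh (path_ga M) n. pev0 y = 0 \<and> pev1 y \<in> H n}" for n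
    by (rule subspaceI[OF PM.vs])
       (use M.pev1_add[of _ n] M.pev1_scale[of _ n] in \<open>simp_all add: PM.add_in PM.scale_in M.pev0_add
         M.pev0_scale H_add H_scale, simp_all add: pev0_def pev1_def\<close>)
qed (auto simp: PM.d_in M.pev0_d M.pev1_d H_d PM.br_in M.pev0_br M.pev1_br H_br)

interpretation T: dg_lie fibre by (rule dg_lie_fibre)
interpretation PT: dg_lie "path_ga fibre" by (rule T.dg_lie_path)

definition lpath :: "int \<Rightarrow> ((nat \<Rightarrow> 'a \<times> 'a) \<times> (nat \<Rightarrow> 'a \<times> 'a)) set" where
  "lpath n = {p \<in> gh (path_ga (cone L)) n. pev0 p = 0 \<and> snd (pev1 p) = 0}"

text \<open>The end point of \<open>p\<close> has no \<open>\<epsilon>\<close>-part, so its image is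
  some \<open>lie_der a\<close>, which lies in \<open>H\<close> by (2).\<close>

lemma path_map_lpath: "p \<in> lpath n \<Longrightarrow> path_map cmap p \<in> gh fibre n"
  using C.pev1_in[of p n]
  by (auto simp: lpath_def fibre_in Pphi.hom_in phi.pev0_path_map phi.pev1_path_map cmap_def
      lie_der_H cone_simps)

definition H_plus_exact :: "int \<Rightarrow> 'b set" where
  "H_plus_exact n = {h + gd M m | h m. h \<in> H n \<and> m \<in> gh M (n - 1)}"

lemma H_plus_exactI: "\<lbrakk>h \<in> H n; m \<in> gh M (n - 1)\<rbrakk> \<Longrightarrow> h + gd M m \<in> H_plus_exact n"
  by (auto simp: H_plus_exact_def)

lemma H_plus_exact_subspace: "M.V.subspace (H_plus_exact n)"
proof (rule subspaceI[OF M.vs])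
  show "0 \<in> H_plus_exact n" using H_plus_exactI[of 0 n 0] by simp
  fix x y assume "x \<in> H_plus_exact n" "y \<in> H_plus_exact n"
  then obtain h m h' m' where "x = h + gd M m" "y = h' + gd M m'" "h \<in> H n" "h' \<in> H n"
    and m: "m \<in> gh M (n - 1)" "m' \<in> gh M (n - 1)"
    by (auto simp: H_plus_exact_def)
  then show "x + y \<in> H_plus_exact n"
    using H_plus_exactI[of "h + h'" n "m + m'"] by (simp add: M.d_add[OF m] M.d_add[OF m(2,1)] H_add M.add_in algebra_simps)
next
  fix c x assume "x \<in> H_plus_exact n"
  then obtain h m where "x = h + gd M m" "h \<in> H n" "m \<in> gh M (n - 1)"
    by (auto simp: H_plus_exact_def)
  then show "gscal M c x \<in> H_plus_exact n"
    using H_plus_exactI[of "gscal M c h" n "gscal M c m"]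
    by (simp add: M.d_scale H_scale M.scale_in M.V.scale_right_distrib)
qed

text \<open>If \<open>h + dm\<close> is closed, so is \<open>h\<close>: these are the cocycles whose
  class comes from the cohomology of \<open>H\<close>.\<close>

definition cocycles_in_H :: "int \<Rightarrow> 'b set" where
  "cocycles_in_H n = {z \<in> gh M n. gd M z = 0 \<and> z \<in> H_plus_exact n}"

text \<open>Represents the cohomology of \<open>M\<close> modulo that of \<open>H\<close>. By (3)
  and the long exact sequence, this quotient is the cohomology of \<open>M/H\<close>.\<close>

definition compl_cocycles :: "int \<Rightarrow> 'b set" where
  "compl_cocycles n = {z \<in> gh M n. gd M z = 0 \<and> subspace_proj (gscal M) (cocycles_in_H n) z = 0}"

lemma cocycles_in_H_subspace: "M.V.subspace (cocycles_in_H n)"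
  by (rule subspaceI[OF M.vs])
     (auto simp: cocycles_in_H_def M.add_in M.d_add M.d_scale M.scale_in M.V.subspace_0[OF H_plus_exact_subspace]
       M.V.subspace_add[OF H_plus_exact_subspace] M.V.subspace_scale[OF H_plus_exact_subspace])

lemma cocycles_in_H_proj:
  shows "subspace_proj (gscal M) (cocycles_in_H n) z \<in> cocycles_in_H n"
    and "module_hom (gscal M) (gscal M) (subspace_proj (gscal M) (cocycles_in_H n))"
    and "z \<in> cocycles_in_H n \<Longrightarrow> subspace_proj (gscal M) (cocycles_in_H n) z = z"
  using subspace_proj[OF M.vs cocycles_in_H_subspace[of n]] by auto

lemma compl_cocycles_subspace: "M.V.subspace (compl_cocycles n)"
proof -
  interpret q: module_hom "gscal M" "gscal M" "subspace_proj (gscal M) (cocycles_in_H n)" by (rule cocycles_in_H_proj)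
  show ?thesis
    by (rule subspaceI[OF M.vs])
       (auto simp: compl_cocycles_def M.add_in M.d_add M.d_scale M.scale_in q.add q.scale)
qed

lemma compl_cocycles_trivial: "\<lbrakk>v \<in> compl_cocycles n; v \<in> H_plus_exact n\<rbrakk> \<Longrightarrow> v = 0"
  using cocycles_in_H_proj(3)[of v n] by (auto simp: compl_cocycles_def cocycles_in_H_def)

lemma cocycle_split:
  assumes "z \<in> gh M n" "gd M z = 0"
  obtains v h m where "v \<in> compl_cocycles n" "h \<in> H n" "m \<in> gh M (n - 1)" "z = v + h + gd M m"
proof -
  interpret q: module_hom "gscal M" "gscal M" "subspace_proj (gscal M) (cocycles_in_H n)" by (rule cocycles_in_H_proj)
  define s where "s = subspace_proj (gscal M) (cocycles_in_H n) z"
  have s: "s \<in> cocycles_in_H n" by (simp add: s_def cocycles_in_H_proj)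
  have "subspace_proj (gscal M) (cocycles_in_H n) (z - s) = 0"
    using cocycles_in_H_proj(3)[OF s] by (simp add: q.diff s_def[symmetric])
  then have "z - s \<in> compl_cocycles n"
    using s assms M.diff_in[of z n s] M.d_diff[of z n s] by (simp add: compl_cocycles_def cocycles_in_H_def)
  moreover obtain h m where "h \<in> H n" "m \<in> gh M (n - 1)" "s = h + gd M m"
    using s by (auto simp: cocycles_in_H_def H_plus_exact_def)
  ultimately show thesis using that[of "z - s" h m] by (simp add: algebra_simps)
qed

lemma dt_compl_cocycles: 
  assumes "v \<in> compl_cocycles (n - 1)"
  shows "(0, cst v) \<in> gh fibre n" "gd (path_ga M) (0, cst v) = 0"
  using assms M.path_dt[of v n] by (auto simp: compl_cocycles_def fibre_in zero_prod_def)

text \<open>Stokes applied to the primitive \<open>u\<close> writes \<open>v\<close> as the end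
  point of \<open>u\<close>, which is in \<open>H\<close>, minus an exact element; the complement
  meets \<open>H + d M\<close> only in \<open>0\<close>.\<close>

lemma fibre_injective:
  assumes v: "v \<in> compl_cocycles (n - 1)" and u: "u \<in> gh fibre (n - 1)" and eq: "(0, cst v) = gd (path_ga M) u"
  shows "v = 0"
proof (rule compl_cocycles_trivial[OF v])
  have u': "u \<in> gh (path_ga M) (n - 1)" "pev0 u = 0" "pev1 u \<in> H (n - 1)"
    using u by (auto simp: fibre_in)
  have "v = pev1 u + gd M (- pintegral M u)"
    using M.stokes[OF u'(1)] eq M.pintegral_dt[of v] u'(2) M.d_neg[OF M.pintegral_in[OF u'(1)]] by simp
  then show "v \<in> H_plus_exact (n - 1)"
    using u'(3) M.neg_in[OF M.pintegral_in[OF u'(1)]] by (auto simp: H_plus_exact_def)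
qed

text \<open>Every cocycle of the fibre is cohomologous to some \<open>dt v\<close>. Its primitives
  as paths in \<open>M\<close> start at \<open>0\<close> but may end outside \<open>H\<close>; the
  component of the end point in the complement \<open>V\<close> is the obstruction, and it is the
  \<open>v\<close> sought.\<close>

lemma fibre_surjective:
  assumes c: "c \<in> gh fibre n" "gd (path_ga M) c = 0"
  obtains v u where "v \<in> compl_cocycles (n - 1)" "u \<in> gh fibre (n - 1)" "c = (0, cst v) + gd (path_ga M) u"
proof -
  have c': "c \<in> gh (path_ga M) n" "pev0 c = 0" "pev1 c \<in> H n" using c by (auto simp: fibre_in)
  from M.path_primitive[OF c'(1) c(2) c'(2)] obtain b where b: "b \<in> gh M (n - 1)" "gd M b = pev1 c"
    and ex: "\<And>u. u \<in> gh M (n - 2) \<Longrightarrow>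
      \<exists>z \<in> gh (path_ga M) (n - 1). gd (path_ga M) z = c \<and> pev0 z = 0 \<and> pev1 z = b - gd M u"
    by blast
  \<comment> \<open>Here (3) enters: the end point of \<open>c\<close> lies in \<open>H\<close> and
    bounds in \<open>M\<close>, hence bounds in \<open>H\<close>.\<close>
  obtain k where k: "k \<in> H (n - 1)" "pev1 c = gd M k"
    using H_inj[OF c'(3) b(1)] b(2) by auto
  have "b - k \<in> gh M (n - 1)" "gd M (b - k) = 0"
    using b k M.d_diff[OF b(1) H_in[OF k(1)]] M.diff_in[OF b(1) H_in[OF k(1)]] by auto
  then obtain v h m where v: "v \<in> compl_cocycles (n - 1)" and h: "h \<in> H (n - 1)" and m: "m \<in> gh M (n - 1 - 1)"
    and bk: "b - k = v + h + gd M m"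
    by (rule cocycle_split)
  obtain z where z: "z \<in> gh (path_ga M) (n - 1)" "gd (path_ga M) z = c" "pev0 z = 0" "pev1 z = b - gd M m"
    using ex[of m] m by auto
  have vM: "v \<in> gh M (n - 1)" "gd M v = 0" using v by (auto simp: compl_cocycles_def)
  note l = M.path_lin[OF vM(1)]
  \<comment> \<open>Removing the straight path \<open>t v\<close> leaves the end point
    \<open>k + h\<close>, in \<open>H\<close>; as \<open>v\<close> is closed, this costs exactly
    \<open>dt v\<close> in the differential.\<close>
  define u where "u = z - (lin v, 0)"
  have "pev1 u = k + h"
    using M.pev1_diff[OF z(1) l(1)] z(4) bk l(4) by (simp add: u_def algebra_simps)
  then have "u \<in> gh fibre (n - 1)"
    using PM.diff_in[OF z(1) l(1)] M.pev0_diff[of z "(lin v, 0)"] z(3) l(3) H_add[OF k(1) h]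
    by (simp add: fibre_in u_def)
  moreover have "c = (0, cst v) + gd (path_ga M) u"
    using PM.d_diff[OF z(1) l(1)] l(2) z(2) by (simp add: u_def vM(2))
  ultimately show thesis using that v by blast
qed

section \<open>Construction of the homotopy pullback\<close>

definition dt_forms :: "int \<Rightarrow> ((nat \<Rightarrow> 'b) \<times> (nat \<Rightarrow> 'b)) set" where
  "dt_forms n = (\<lambda>v. (0, cst v)) ` compl_cocycles (n - 1)"

definition pull where
  "pull = (prod_ga (path_ga (cone L)) (path_ga fibre))\<lparr>gh := \<lambda>n. {x. fst x \<in> lpath n \<and>
     snd x \<in> gh (path_ga fibre) n \<and> pev0 (snd x) = path_map cmap (fst x) \<and> pev1 (snd x) \<in> dt_forms n}\<rparr>"

lemma pull_simps [simp]: "gscal pull = gscal (prod_ga (path_ga (cone L)) (path_ga fibre))"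
  "gd pull = gd (prod_ga (path_ga (cone L)) (path_ga fibre))"
  "gb pull = gb (prod_ga (path_ga (cone L)) (path_ga fibre))"
  by (simp_all add: pull_def)

lemma pull_in: "x \<in> gh pull n \<longleftrightarrow> fst x \<in> lpath n \<and>
     snd x \<in> gh (path_ga fibre) n \<and> pev0 (snd x) = path_map cmap (fst x) \<and> pev1 (snd x) \<in> dt_forms n"
  by (simp add: pull_def)

lemma lpath_in: "p \<in> lpath n \<Longrightarrow> p \<in> gh (path_ga (cone L)) n"
  by (simp add: lpath_def)

lemma dt_forms_d: "e \<in> dt_forms n \<Longrightarrow> gd (path_ga M) e = 0"
  by (auto simp: dt_forms_def dt_compl_cocycles)

lemma dt_forms_br:
  assumes "e \<in> dt_forms m" "e' \<in> dt_forms n" shows "gb (path_ga M) m e e' = 0"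
proof -
  obtain v v' where eq: "e = (0, cst v)" "e' = (0, cst v')" and v: "v \<in> compl_cocycles (m - 1)" "v' \<in> compl_cocycles (n - 1)"
    using assms by (auto simp: dt_forms_def)
  have "conv (gb M m) 0 0 = 0" for m by (simp add: conv_def fun_eq_iff M.br_zero_left[of 0 0])
  moreover have "conv (gb M (m - 1)) (cst v) 0 = 0"
    using v by (auto simp: conv_def fun_eq_iff compl_cocycles_def cst_def M.br_zero_left[of 0 0] intro!: sum.neutral)
  moreover have "conv (gb M m) 0 (cst v') = 0"
    using v M.br_zero_left[of v' "n - 1"]
    by (auto simp: conv_def fun_eq_iff compl_cocycles_def cst_def M.br_zero_left[of 0 0] intro!: sum.neutral)
  ultimately show ?thesis by (simp add: eq path_gb zero_prod_def sg_def)
qed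

lemma dt_forms_zero: "0 \<in> dt_forms n"
  using M.V.subspace_0[OF compl_cocycles_subspace] by (auto simp: dt_forms_def zero_prod_def image_iff intro!: bexI[of _ 0])

lemma dt_forms_add: "\<lbrakk>e \<in> dt_forms n; e' \<in> dt_forms n\<rbrakk> \<Longrightarrow> e + e' \<in> dt_forms n"
  using M.V.subspace_add[OF compl_cocycles_subspace] by (fastforce simp: dt_forms_def cst_add[symmetric])

lemma dt_forms_scale: "e \<in> dt_forms n \<Longrightarrow> gscal (path_ga M) c e \<in> dt_forms n"
  using M.V.subspace_scale[OF compl_cocycles_subspace, of _ "n - 1" c] map_cst[of "gscal M c"]
  by (auto simp: dt_forms_def path_gscal zero_fun_def)

text \<open>Evaluations and \<open>path_map cmap\<close> are compatible with all operations, and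
  \<open>L\<close> is a DG-Lie subalgebra of its cone. At the end point in \<open>dt_forms\<close>,
  differential and brackets give \<open>0\<close>, which is again in
  \<open>dt_forms\<close>.\<close>

lemma dg_lie_pull: "dg_lie pull"
proof -
  interpret Q: dg_lie "prod_ga (path_ga (cone L)) (path_ga fibre)"
    by (rule dg_lie_prod[OF C.dg_lie_path T.dg_lie_path])
  show ?thesis unfolding pull_def
  proof (rule Q.sub_dg_lie, unfold pull_in[symmetric])
    show "Collect (\<lambda>x. x \<in> gh pull n) \<subseteq> gh (prod_ga (path_ga (cone L)) (path_ga fibre)) n" for n
      by (auto simp: pull_in prod_simps lpath_in)
  next
    fix n
    show "Q.V.subspace (Collect (\<lambda>x. x \<in> gh pull n))"
    proof (rule subspaceI[OF Q.vs]; unfold mem_Collect_eq)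
      show "0 \<in> gh pull n"
        using dt_forms_zero[of n]
        by (simp add: pull_in lpath_def pev0_def pev1_def path_map_def zero_prod_def[symmetric] zero_fun_def[symmetric])
    next
      fix x y assume x: "x \<in> gh pull n" and y: "y \<in> gh pull n"
      show "x + y \<in> gh pull n"
        using x y dt_forms_add T.pev1_add[of "snd x" n "snd y"] 
        by (auto simp: pull_in lpath_def PC.add_in PT.add_in C.pev0_add C.pev1_add T.pev0_add Pphi.hom_add)
    next
      fix c x assume x: "x \<in> gh pull n"
      show "gscal (prod_ga (path_ga (cone L)) (path_ga fibre)) c x \<in> gh pull n"
        using x dt_forms_scale T.pev1_scale[of "snd x" n c] T.pev0_scale[of c "snd x"]
        by (auto simp: prod_simps pull_in lpath_def PC.scale_in PT.scale_in C.pev0_scale C.pev1_scale Pphi.hom_scale 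
             cone_simps zero_prod_def)
    qed
  next
    fix x n assume "x \<in> Collect (\<lambda>x. x \<in> gh pull n)"
    then have x: "x \<in> gh pull n" by simp
    have "snd (gd (cone L) (pev1 (fst x))) = 0"
      using x by (simp add: pull_in lpath_def cone_simps)
    then have "fst (gd pull x) \<in> lpath (n + 1)"
      using x by (auto simp: prod_simps pull_in lpath_def PC.d_in C.pev0_d C.pev1_d)
    then show "gd (prod_ga (path_ga (cone L)) (path_ga fibre)) x \<in> Collect (\<lambda>x. x \<in> gh pull (n + 1))"
      using x dt_forms_d[of "pev1 (snd x)" n] dt_forms_zero T.pev1_d[of "snd x" n] T.pev0_d[of "snd x"]
        Pphi.hom_d[of "fst x" n]
      by (auto simp: prod_simps pull_in PT.d_in lpath_in)
  next
    fix x y m n assume "x \<in> Collect (\<lambda>x. x \<in> gh pull m)" "y \<in> Collect (\<lambda>x. x \<in> gh pull n)"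
    then have x: "x \<in> gh pull m" and y: "y \<in> gh pull n" by simp_all
    have "snd (gb (cone L) m (pev1 (fst x)) (pev1 (fst y))) = 0"
      using x y C.pev1_in[of "fst x" m] C.pev1_in[of "fst y" n] L.br_zero_right[of "fst (pev1 (fst x))" m]
         L.br_zero_left[of "fst (pev1 (fst y))" n]
      by (auto simp: pull_in lpath_def cone_simps sg_def)
    then have "fst (gb pull m x y) \<in> lpath (m + n)"
      using x y by (auto simp: prod_simps pull_in lpath_def PC.br_in C.pev0_br C.pev1_br)
    then show "gb (prod_ga (path_ga (cone L)) (path_ga fibre)) m x y \<in> Collect (\<lambda>x. x \<in> gh pull (m + n))"
      using x y dt_forms_br[of "pev1 (snd x)" m "pev1 (snd y)" n] dt_forms_zero T.pev1_br[of "snd x" m "snd y" n]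
        T.pev0_br[of m "snd x" "snd y"] Pphi.hom_br[of "fst x" m "fst y" n]
      by (auto simp: prod_simps pull_in PT.br_in lpath_in)
  qed
qed

interpretation P: dg_lie pull by (rule dg_lie_pull)

section \<open>The projection to L is a quasi-isomorphism\<close>

definition evL where "evL x = fst (pev1 (fst x))"

lemma evL_hom: "dg_hom pull L evL"
proof (rule dg_hom.intro[OF dg_lie_pull L.dg_lie_axioms dg_hom_axioms.intro])
  fix x n assume "x \<in> gh pull n"
  then have x: "fst x \<in> gh (path_ga (cone L)) n" "snd (pev1 (fst x)) = 0"
    by (simp_all add: pull_in lpath_def)
  show "evL x \<in> gh L n" using C.pev1_in[OF x(1)] by (auto simp: evL_def cone_simps)
  show "evL (gscal pull c x) = gscal L c (evL x)" for c
    by (simp add: evL_def prod_simps C.pev1_scale[OF x(1)] cone_simps)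
  show "evL (gd pull x) = gd L (evL x)"
    by (simp add: evL_def prod_simps C.pev1_d[OF x(1)] cone_simps x(2))
next
  fix x y n assume "x \<in> gh pull n" "y \<in> gh pull n"
  then show "evL (x + y) = evL x + evL y"
    using C.pev1_add[of "fst x" n "fst y"] by (simp add: pull_in lpath_def evL_def)
next
  fix x y m n assume "x \<in> gh pull m" "y \<in> gh pull n"
  then show "evL (gb pull m x y) = gb L m (evL x) (evL y)"
    using C.pev1_br[of "fst x" m "fst y" n] by (simp add: pull_in lpath_def evL_def prod_simps cone_simps)
qed

text \<open>The second component ends at some \<open>dt v\<close> with \<open>v\<close> constant in
  \<open>t\<close>; coefficient 0 reads off \<open>v\<close>.\<close>

definition evV where "evV x = snd (pev1 (snd x)) 0"

lemma evV:
  assumes "x \<in> gh pull n"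
  shows "evV x \<in> compl_cocycles (n - 1)" "pev1 (snd x) = (0, cst (evV x))"
  using assms by (auto simp: pull_in dt_forms_def evV_def)

text \<open>The bridge to (4). Stokes along \<open>y\<close> in the fibre gives
  \<open>dt v = path_map cmap p + du\<close> with \<open>v = evV x\<close>. Integrating once more in
  \<open>M\<close> turns \<open>du\<close> into an element of \<open>H + d M\<close>, and Stokes in
  the cone evaluates the integral of \<open>p\<close>.\<close>

lemma pull_cocycle_class:
  assumes x: "x \<in> gh pull n" and dx: "gd pull x = 0"
  shows "evV x - \<iota> (evL x) \<in> H_plus_exact (n - 1)"
proof -
  obtain p y where eq: "x = (p, y)" by (cases x)
  have p: "p \<in> gh (path_ga (cone L)) n" "pev0 p = 0" "snd (pev1 p) = 0" and y: "y \<in> gh (path_ga fibre) n"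
    and y0: "pev0 y = path_map cmap p"
    using x by (auto simp: eq pull_in lpath_def)
  have y1: "pev1 y = (0, cst (evV x))" using evV[OF x] by (simp add: eq)
  have vM: "evV x \<in> gh M (n - 1)" using evV(1)[OF x] by (simp add: compl_cocycles_def)
  have d: "gd (path_ga (cone L)) p = 0" "gd (path_ga fibre) y = 0"
    using dx by (auto simp: eq prod_simps zero_prod_def)
  define u where "u = pintegral fibre y"
  have u: "u \<in> gh fibre (n - 1)" unfolding u_def by (rule T.pintegral_in[OF y])
  have du: "(0, cst (evV x)) = path_map cmap p + gd (path_ga M) u"
    using T.stokes[OF y] by (simp add: d y0 y1 u_def[symmetric] algebra_simps)
  have u': "u \<in> gh (path_ga M) (n - 1)" "pev0 u = 0" "pev1 u \<in> H (n - 1)"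
    using u by (auto simp: fibre_in)
  obtain a b where ab: "pintegral (cone L) p = (a, b)" by (cases "pintegral (cone L) p")
  have a: "a \<in> gh L (n - 1)" and b: "b \<in> gh L n"
    using C.pintegral_in[OF p(1)] by (auto simp: ab cone_simps)
  have "pev1 p = gd (cone L) (a, b)"
    using C.stokes[OF p(1)] by (simp add: d p(2) ab)
  then have "evL x = gd L a + b" by (simp add: evL_def eq cone_simps)
  \<comment> \<open>The term \<open>lie_der a\<close> supplies \<open>\<iota> (da)\<close>, which
    combines with \<open>\<iota> b\<close> to \<open>\<iota>\<close> of the end point.\<close>
  then have i: "cmap (a, b) = gd M (\<iota> a) + \<iota> (evL x)"
    using i_add[of "gd L a" n b] L.d_in[OF a] b by (simp add: cmap_def lie_der_def)
  have "evV x = pintegral M (path_map cmap p + gd (path_ga M) u)"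
    using M.pintegral_dt[of "evV x"] du by simp
  also have "\<dots> = cmap (a, b) + (pev1 u - gd M (pintegral M u))"
    using M.pintegral_add[OF Pphi.hom_in[OF p(1)], of "gd (path_ga M) u"] PM.d_in[OF u'(1)]
      phi.pintegral_path_map[OF p(1)] M.stokes[OF u'(1)] by (simp add: ab u'(2))
  finally have "evV x - \<iota> (evL x) = pev1 u + gd M (\<iota> a - pintegral M u)"
    using M.d_diff[of "\<iota> a" "n - 2" "pintegral M u"] i_in[OF a] M.pintegral_in[OF u'(1)]
    by (simp add: i)
  moreover have "\<iota> a - pintegral M u \<in> gh M (n - 1 - 1)"
    using i_in[OF a] M.pintegral_in[OF u'(1)] by (rule M.diff_in)
  ultimately show ?thesis using H_plus_exactI[OF u'(3)] by simp
qed

lemma evL_surjective: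
  assumes x: "x \<in> gh L n" and dx: "gd L x = 0"
  obtains q where "q \<in> gh pull n" "gd pull q = 0" "evL q = x"
proof -
  have x0: "(x, 0) \<in> gh (cone L) n" and ex: "(0, x) \<in> gh (cone L) (n - 1)"
    using x by (auto simp: cone_simps)
  have dcone: "gd (cone L) (x, 0) = 0" "gd (cone L) (0, x) = (x, 0)"
    by (simp_all add: cone_simps dx zero_prod_def)
  note l = C.path_lin[OF x0] and t = C.path_dt[OF ex]
  \<comment> \<open>The path \<open>t x + dt \<epsilon> x\<close> runs from \<open>0\<close> to
    \<open>x\<close>; it is closed because \<open>d \<epsilon> x = x\<close> for a cocycle
    \<open>x\<close>.\<close>
  define p :: "(nat \<Rightarrow> 'a \<times> 'a) \<times> (nat \<Rightarrow> 'a \<times> 'a)" where "p = (lin (x, 0), 0) + (0, cst (0, x))"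
  have p: "p \<in> gh (path_ga (cone L)) n"
    unfolding p_def by (rule PC.add_in[OF l(1) t(1)])
  have dp: "gd (path_ga (cone L)) p = 0"
    unfolding p_def PC.d_add[OF l(1) t(1)] l(2) t(2) dcone by (rule lin_dt_cancel)
  have p1: "pev0 p = 0" "pev1 p = (x, 0)"
    unfolding p_def C.pev0_add C.pev1_add[OF l(1) t(1)] l t by simp_all
  then have pl: "p \<in> lpath n" using p by (simp add: lpath_def)
  define c where "c = path_map cmap p"
  have c: "c \<in> gh fibre n" "gd (path_ga M) c = 0"
    using path_map_lpath[OF pl] Pphi.hom_d[OF p] by (simp_all add: c_def dp)
  obtain v u where v: "v \<in> compl_cocycles (n - 1)" and u: "u \<in> gh fibre (n - 1)"
    and cu: "c = (0, cst v) + gd (path_ga M) u"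
    using fibre_surjective[OF c] .
  have du: "gd (path_ga M) u \<in> gh fibre n" "gd (path_ga M) (gd (path_ga M) u) = 0"
    using T.d_in[OF u] T.d_d[OF u] by simp_all
  note k = T.path_cst[OF c(1)] and l = T.path_lin[OF du(1)] and t = T.path_dt[OF u]
  \<comment> \<open>This is \<open>c - d(t u)\<close>: a closed path in the fibre from
    \<open>c\<close> to \<open>c - du = dt v\<close>.\<close>
  define y where "y = (cst c, 0) - (lin (gd (path_ga M) u), 0) - (0, cst u)"
  note kl = PT.diff_in[OF k(1) l(1)]
  have y: "y \<in> gh (path_ga fibre) n"
    unfolding y_def by (rule PT.diff_in[OF kl t(1)])
  have dy: "gd (path_ga fibre) y = 0"
    unfolding y_def PT.d_diff[OF kl t(1)] PT.d_diff[OF k(1) l(1)] k(2) l(2) t(2) fibre_simps du(2) c(2)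
    by (rule cst_lin_dt_cancel)
  have "pev0 y = c" "pev1 y = (0, cst v)"
    unfolding y_def T.pev0_diff T.pev1_diff[OF kl t(1)] T.pev1_diff[OF k(1) l(1)] k l t
    by (simp_all add: cu)
  then have "(p, y) \<in> gh pull n"
    using pl y v by (auto simp: pull_in c_def dt_forms_def)
  moreover have "gd pull (p, y) = 0" using dp dy by (simp add: prod_simps zero_prod_def)
  ultimately show thesis using that[of "(p, y)"] p1 by (simp add: evL_def)
qed

text \<open>Both components need primitives whose end points match. In the cone, acyclicity allows
  the end point \<open>x\<close>; in the fibre, the end point can be corrected only up to
  \<open>dt V\<close>, which is just what membership in \<open>pull\<close> permits.\<close>

lemma evL_injective:
  assumes q: "q \<in> gh pull n" and dq: "gd pull q = 0" and x: "x \<in> gh L (n - 1)" and qx: "evL q = gd L x"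
  obtains r where "r \<in> gh pull (n - 1)" "gd pull r = q"
proof -
  obtain p y where eq: "q = (p, y)" by (cases q)
  have pl: "p \<in> lpath n" and p: "p \<in> gh (path_ga (cone L)) n" "pev0 p = 0" "snd (pev1 p) = 0"
    and y: "y \<in> gh (path_ga fibre) n" and y0: "pev0 y = path_map cmap p"
    using q by (auto simp: eq pull_in lpath_def)
  have y1: "pev1 y = (0, cst (evV q))" and v: "evV q \<in> compl_cocycles (n - 1)" using evV[OF q] by (simp_all add: eq)
  have d: "gd (path_ga (cone L)) p = 0" "gd (path_ga fibre) y = 0"
    using dq by (auto simp: eq prod_simps zero_prod_def)
  have p1: "pev1 p = gd (cone L) (x, 0)"
    using p(3) qx by (simp add: eq evL_def cone_simps prod_eq_iff)
  have x0: "(x, 0) \<in> gh (cone L) (n - 1)" using x by (simp add: cone_simps)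
  obtain z where z: "z \<in> gh (path_ga (cone L)) (n - 1)" "gd (path_ga (cone L)) z = p"
    and z0: "pev0 z = 0" and z1: "pev1 z = (x, 0)"
  proof -
    from C.path_primitive[OF p(1) d(1) p(2)] obtain c where c: "c \<in> gh (cone L) (n - 1)"
      "gd (cone L) c = pev1 p" and ex: "\<And>u. u \<in> gh (cone L) (n - 2) \<Longrightarrow>
      \<exists>z \<in> gh (path_ga (cone L)) (n - 1). gd (path_ga (cone L)) z = p \<and> pev0 z = 0 \<and> pev1 z = c - gd (cone L) u"
      by blast
    have "c - (x, 0) \<in> gh (cone L) (n - 1)" "gd (cone L) (c - (x, 0)) = 0"
      using C.diff_in[OF c(1) x0] C.d_diff[OF c(1) x0] c(2) p1 by simp_all
    \<comment> \<open>The end point \<open>c\<close> differs from \<open>(x, 0)\<close> by a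
      cocycle, hence by a coboundary of the cone, and exact corrections are available.\<close>
    from L.cone_acyclic[OF this] ex[of "(0, fst (c - (x, 0)))"] show thesis
      using that by auto
  qed
  have zl: "z \<in> lpath (n - 1)" using z z0 z1 by (simp add: lpath_def)
  define f where "f = path_map cmap z"
  have f: "f \<in> gh fibre (n - 1)" unfolding f_def by (rule path_map_lpath[OF zl])
  have df: "gd (path_ga M) f = path_map cmap p"
    using Pphi.hom_d[OF z(1)] z(2) by (simp add: f_def)
  note k = T.path_cst[OF f] and k' = T.path_cst[OF T.d_in[OF f], simplified]
  \<comment> \<open>Subtracting the constant path at \<open>df\<close>, the starting point of
    \<open>y\<close>, makes the path start at \<open>0\<close>, as taking primitives
    requires.\<close>
  define y' where "y' = y - (cst (gd (path_ga M) f), 0)"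
  have y': "y' \<in> gh (path_ga fibre) n" "gd (path_ga fibre) y' = 0" "pev0 y' = 0"
    "pev1 y' = (0, cst (evV q)) - gd (path_ga M) f"
    unfolding y'_def using PT.diff_in[OF y k'(1)] PT.d_diff[OF y k'(1)] d(2) k'(2) T.d_d[OF f]
      T.pev0_diff[of y "(cst (gd (path_ga M) f), 0)"] T.pev1_diff[OF y k'(1)] k'(3,4) y0 y1 df
    by (simp_all add: zero_prod_def[symmetric])
  from T.path_primitive[OF y'(1,2,3)] obtain c where c: "c \<in> gh fibre (n - 1)"
      "gd (path_ga M) c = pev1 y'" and ex: "\<And>u. u \<in> gh fibre (n - 2) \<Longrightarrow>
      \<exists>z \<in> gh (path_ga fibre) (n - 1). gd (path_ga fibre) z = y' \<and> pev0 z = 0 \<and> pev1 z = c - gd (path_ga M) u"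
    by auto
  have cf: "c + f \<in> gh fibre (n - 1)" and dcf: "gd (path_ga M) (c + f) = (0, cst (evV q))"
    using T.add_in[OF c(1) f] T.d_add[OF c(1) f] c(2) y'(4) by simp_all
  \<comment> \<open>The element \<open>c + f\<close> of the fibre has differential
    \<open>dt (evV q)\<close>, so this class vanishes and \<open>c + f\<close> becomes a
    cocycle.\<close>
  have v0: "evV q = 0" using fibre_injective[OF v cf] dcf by simp
  have "gd (path_ga M) (c + f) = 0" using dcf by (simp add: v0 zero_prod_def)
  \<comment> \<open>The required path ends at \<open>c + f\<close> up to coboundaries; removing
    \<open>du\<close> from the end point leaves \<open>dt v'\<close>, and adding back the constant
    path \<open>f\<close> gives the right starting point.\<close>
  from fibre_surjective[OF cf this] obtain v' u where v': "v' \<in> compl_cocycles (n - 1 - 1)"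
    and u: "u \<in> gh fibre (n - 1 - 1)" and cfu: "c + f = (0, cst v') + gd (path_ga M) u" .
  obtain z' where z': "z' \<in> gh (path_ga fibre) (n - 1)" "gd (path_ga fibre) z' = y'"
    "pev0 z' = 0" "pev1 z' = c - gd (path_ga M) u"
    using ex[of u] u by auto
  define y'' where "y'' = z' + (cst f, 0)"
  have y'': "y'' \<in> gh (path_ga fibre) (n - 1)" "gd (path_ga fibre) y'' = y"
    "pev0 y'' = f" "pev1 y'' = (0, cst v')"
    unfolding y''_def PT.d_add[OF z'(1) k(1)] T.pev0_add T.pev1_add[OF z'(1) k(1)] z' k
    using PT.add_in[OF z'(1) k(1)] cfu by (simp_all add: y'_def algebra_simps)
  have "(z, y'') \<in> gh pull (n - 1)"
    using zl y'' v' by (auto simp: pull_in f_def dt_forms_def)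
  moreover have "gd pull (z, y'') = q" by (simp add: prod_simps z y'' eq)
  ultimately show thesis using that by blast
qed

section \<open>The abelian target\<close>

definition compl_cocycles_L :: "int \<Rightarrow> 'b set" where
  "compl_cocycles_L n = {v \<in> compl_cocycles n. \<exists>x\<in>gh L (n + 1). gd L x = 0 \<and> v - \<iota> x \<in> H_plus_exact n}"

lemma compl_cocycles_L_subspace: "M.V.subspace (compl_cocycles_L n)"
proof (rule subspaceI[OF M.vs])
  show "0 \<in> compl_cocycles_L n"
    using M.V.subspace_0[OF compl_cocycles_subspace] M.V.subspace_0[OF H_plus_exact_subspace] by (auto simp: compl_cocycles_L_def intro!: bexI[of _ 0])
next
  fix v w assume "v \<in> compl_cocycles_L n" "w \<in> compl_cocycles_L n"
  then obtain x y where *: "v \<in> compl_cocycles n" "w \<in> compl_cocycles n" "x \<in> gh L (n + 1)" "y \<in> gh L (n + 1)" "gd L x = 0" "gd L y = 0"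
    "v - \<iota> x \<in> H_plus_exact n" "w - \<iota> y \<in> H_plus_exact n" by (auto simp: compl_cocycles_L_def)
  have "v + w - \<iota> (x + y) \<in> H_plus_exact n"
    using M.V.subspace_add[OF H_plus_exact_subspace *(7,8)] i_add[OF *(3,4)] by (simp add: algebra_simps)
  then show "v + w \<in> compl_cocycles_L n"
    using * M.V.subspace_add[OF compl_cocycles_subspace *(1,2)] L.add_in[OF *(3,4)] L.d_add[OF *(3,4)]
    by (auto simp: compl_cocycles_L_def intro!: bexI[of _ "x + y"])
next
  fix c v assume "v \<in> compl_cocycles_L n"
  then obtain x where *: "v \<in> compl_cocycles n" "x \<in> gh L (n + 1)" "gd L x = 0" "v - \<iota> x \<in> H_plus_exact n"
    by (auto simp: compl_cocycles_L_def)
  have "gscal M c v - \<iota> (gscal L c x) \<in> H_plus_exact n"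
    using M.V.subspace_scale[OF H_plus_exact_subspace *(4), of c] i_scale[OF *(2)]
    by (simp add: M.V.scale_right_diff_distrib)
  then show "gscal M c v \<in> compl_cocycles_L n"
    using * M.V.subspace_scale[OF compl_cocycles_subspace *(1)] L.scale_in[OF *(2)] L.d_scale[OF *(2)]
    by (auto simp: compl_cocycles_L_def intro!: bexI[of _ "gscal L c x"])
qed

text \<open>An element stands for the coefficient of \<open>dt\<close>, whence the shift of the
  degree by one.\<close>

definition target :: "('k, 'b) graded_alg" where
  "target = \<lparr>gscal = gscal M, gh = \<lambda>n. compl_cocycles_L (n - 1), gd = \<lambda>_. 0, gb = \<lambda>_ _ _. 0\<rparr>"

lemma dg_lie_target: "dg_lie target"
  by (intro dg_lie.intro graded_lie.intro dg_lie_axioms.intro)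
     (auto simp: target_def M.vs compl_cocycles_L_subspace M.V.subspace_0[OF compl_cocycles_L_subspace] sg_def)

text \<open>On elements that are not closed, \<open>evV\<close> may leave
  \<open>compl_cocycles_L\<close>; the projection brings it back. A linear map suffices for a
  morphism here, since \<open>evV\<close> kills differentials and brackets and the operations of
  \<open>target\<close> vanish.\<close>

definition evW :: "int \<Rightarrow> _ \<Rightarrow> 'b" where
  "evW n x = subspace_proj (gscal M) (compl_cocycles_L (n - 1)) (evV x)"

lemma compl_cocycles_L_proj:
  shows "subspace_proj (gscal M) (compl_cocycles_L n) z \<in> compl_cocycles_L n"
    and "module_hom (gscal M) (gscal M) (subspace_proj (gscal M) (compl_cocycles_L n))"
    and "z \<in> compl_cocycles_L n \<Longrightarrow> subspace_proj (gscal M) (compl_cocycles_L n) z = z"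
  using subspace_proj[OF M.vs compl_cocycles_L_subspace[of n]] by auto

lemma evW_in: "evW n x \<in> gh target n"
  by (simp add: evW_def target_def compl_cocycles_L_proj)

lemma evW_add:
  assumes "x \<in> gh pull n" "y \<in> gh pull n"
  shows "evW n (x + y) = evW n x + evW n y"
proof -
  interpret q: module_hom "gscal M" "gscal M" "subspace_proj (gscal M) (compl_cocycles_L (n - 1))" by (rule compl_cocycles_L_proj)
  have "evV (x + y) = evV x + evV y"
    using T.pev1_add[of "snd x" n "snd y"] assms by (simp add: evV_def pull_in)
  then show ?thesis by (simp add: evW_def q.add)
qed

lemma evW_scale:
  assumes "x \<in> gh pull n"
  shows "evW n (gscal pull c x) = gscal target c (evW n x)"
proof -
  interpret q: module_hom "gscal M" "gscal M" "subspace_proj (gscal M) (compl_cocycles_L (n - 1))" by (rule compl_cocycles_L_proj)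
  have "evV (gscal pull c x) = gscal M c (evV x)"
    using T.pev1_scale[of "snd x" n c] assms by (simp add: evV_def pull_in prod_simps path_gscal)
  then show ?thesis by (simp add: evW_def q.scale target_def)
qed

lemma evV_d:
  assumes "x \<in> gh pull n" shows "evV (gd pull x) = 0"
  using T.pev1_d[of "snd x" n] dt_forms_d[of "pev1 (snd x)" n] assms
  by (simp add: evV_def pull_in prod_simps)

lemma evV_br:
  assumes "x \<in> gh pull m" "y \<in> gh pull n" shows "evV (gb pull m x y) = 0"
  using T.pev1_br[of "snd x" m "snd y" n] dt_forms_br[of "pev1 (snd x)" m "pev1 (snd y)" n] assms
  by (simp add: evV_def pull_in prod_simps)

lemma evW_zero: "evV x = 0 \<Longrightarrow> evW n x = 0"
  using compl_cocycles_L_proj(3)[OF M.V.subspace_0[OF compl_cocycles_L_subspace]] by (simp add: evW_def)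

text \<open>With \<open>evL x\<close> as the cocycle of \<open>L\<close>, this is
  \<open>pull_cocycle_class\<close>; hence the projection in \<open>evW\<close> changes nothing on
  cocycles.\<close>

lemma evV_compl_cocycles_L:
  assumes "x \<in> gh pull n" "gd pull x = 0"
  shows "evV x \<in> compl_cocycles_L (n - 1)"
proof -
  interpret E: dg_hom pull L evL by (rule evL_hom)
  show ?thesis
    using pull_cocycle_class[OF assms] evV(1)[OF assms(1)] E.hom_in[OF assms(1)] E.hom_d[OF assms(1)] assms(2)
    by (auto simp: compl_cocycles_L_def intro!: bexI[of _ "evL x"])
qed

text \<open>If \<open>w\<close> agrees with \<open>\<iota> x\<close> modulo \<open>H + d M\<close>,
  so does \<open>evV q\<close> for any cocycle \<open>q\<close> over \<open>x\<close>; both lie in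
  the complement, so they are equal.\<close>

lemma evW_surjective:
  assumes "w \<in> gh target n"
  obtains q where "q \<in> gh pull n" "gd pull q = 0" "evW n q = w"
proof -
  have w: "w \<in> compl_cocycles_L (n - 1)" using assms by (simp add: target_def)
  then obtain x where x: "x \<in> gh L n" "gd L x = 0" "w - \<iota> x \<in> H_plus_exact (n - 1)" and wV: "w \<in> compl_cocycles (n - 1)"
    by (auto simp: compl_cocycles_L_def)
  obtain q where q: "q \<in> gh pull n" "gd pull q = 0" "evL q = x"
    using evL_surjective[OF x(1,2)] .
  have "(evV q - \<iota> x) - (w - \<iota> x) \<in> H_plus_exact (n - 1)"
    using pull_cocycle_class[OF q(1,2)] by (intro M.V.subspace_diff[OF H_plus_exact_subspace _ x(3)]) (simp add: q(3))
  then have "evV q - w = 0"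
    using M.V.subspace_diff[OF compl_cocycles_subspace evV(1)[OF q(1)] wV] by (intro compl_cocycles_trivial) simp_all
  then show thesis using that[OF q(1,2)] w by (simp add: evW_def compl_cocycles_L_proj)
qed

text \<open>Here (4) enters: \<open>evV q = 0\<close> puts \<open>\<iota> (evL q)\<close> into
  \<open>H + d M\<close>, so \<open>evL q\<close> is exact, and \<open>evL_injective\<close> lifts
  the primitive.\<close>

lemma evW_injective:
  assumes q: "q \<in> gh pull n" and dq: "gd pull q = 0" and w: "evW n q = 0"
  obtains r where "r \<in> gh pull (n - 1)" "gd pull r = q"
proof -
  interpret E: dg_hom pull L evL by (rule evL_hom)
  have "evV q = 0" using w compl_cocycles_L_proj(3)[OF evV_compl_cocycles_L[OF q dq]] by (simp add: evW_def)
  then have "\<iota> (evL q) \<in> H_plus_exact (n - 1)"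
    using M.V.subspace_neg[OF H_plus_exact_subspace pull_cocycle_class[OF q dq]] by simp
  then obtain h m where "\<iota> (evL q) = h + gd M m" "h \<in> H (n - 1)" "m \<in> gh M (n - 2)"
    by (auto simp: H_plus_exact_def)
  then obtain x where "x \<in> gh L (n - 1)" "evL q = gd L x"
    using i_inj[OF E.hom_in[OF q]] E.hom_d[OF q] dq by auto
  then show thesis using evL_injective[OF q dq] that by blast
qed

end

section \<open>From indexed operations to DG-Lie algebras\<close>

definition graded_of :: "('k::field, 'a::ab_group_add) dgla \<Rightarrow> ('k, 'a) graded_alg" where
  "graded_of L = \<lparr>gscal = scal L, gh = homog L, gd = dif L, gb = (\<lambda>m. brack L)\<rparr>"

lemma graded_of_simps [simp]:
  "gscal (graded_of L) = scal L" "gh (graded_of L) = homog L" "gd (graded_of L) = dif L" "gb (graded_of L) m = brack L"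
  by (simp_all add: graded_of_def)

lemma scale_minus_one_powi:
  assumes "vector_space s"
  shows "s ((-1) powi m) x = sg m x"
proof -
  interpret vector_space s by fact
  show ?thesis by (cases "even m") (auto simp: sg_def power_int_minus_left)
qed

lemma homog_space: "\<lbrakk>vector_space (scal L); x \<in> homog L i\<rbrakk> \<Longrightarrow> x \<in> space_of L"
  unfolding space_of_def by (intro module.span_base) (auto simp: vector_space_def module_def)

lemma space_subspace: "vector_space (scal L) \<Longrightarrow> module.subspace (scal L) (space_of L)"
  unfolding space_of_def by (intro module.subspace_span) (auto simp: vector_space_def module_def)

text \<open>Since the pieces are subspaces, they absorb the scalars of a linear combination, and
  sums are the only closure condition left.\<close>

lemma space_induct [consumes 3, case_names homog add]:
  assumes vs: "vector_space (scal L)" and sub: "\<And>i. module.subspace (scal L) (homog L i)"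
    and x: "x \<in> space_of L" and "\<And>i x. x \<in> homog L i \<Longrightarrow> P x"
    and "\<And>x y. \<lbrakk>x \<in> space_of L; y \<in> space_of L; P x; P y\<rbrakk> \<Longrightarrow> P (x + y)"
  shows "P x"
proof -
  interpret vector_space "scal L" by fact
  note S = space_subspace[OF vs]
  have "x \<in> space_of L \<and> P x"
    using x unfolding space_of_def
  proof (induction rule: span_induct_alt)
    case base
    then show ?case using assms(4)[OF subspace_0[OF sub]] subspace_0[OF S] by (simp add: space_of_def)
  next
    case (step c x y)
    then obtain i where "x \<in> homog L i" by blast
    then have "scal L c x \<in> homog L i" by (rule subspace_scale[OF sub])
    with step assms(4,5) homog_space[OF vs] subspace_add[OF S] show ?case
      unfolding space_of_def by blast
  qed
  then show ?thesis by blast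
qed

lemma dg_lie_graded_of:
  fixes L :: "('k::field_char_0, 'a::ab_group_add) dgla"
  assumes "dg_lie_algebra L"
  shows "dg_lie (graded_of L)"
proof -
  interpret dg_lie_algebra L by fact
  note hs = homog_space[OF ambient] and sgn = scale_minus_one_powi[OF ambient]
  have sub: "module.subspace (scal L) (homog L n)" for n by (rule homog_subspace)
  show ?thesis
  proof (intro dg_lie.intro graded_lie.intro dg_lie_axioms.intro, unfold graded_of_simps)
    show "vector_space (scal L)" by (rule ambient)
    show "module.subspace (scal L) (homog L n)" for n by (rule sub)
    fix x m assume x: "x \<in> homog L m"
    note xs = hs[OF x]
    show "dif L x \<in> homog L (m + 1)" by (rule dif_degree[OF x])
    show "dif L (scal L c x) = scal L c (dif L x)" for c
      using dif_linear xs by (simp add: linear_on_def)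
    show "dif L (dif L x) = 0" by (rule dif_dif[OF xs])
    fix y n assume y: "y \<in> homog L n"
    note ys = hs[OF y]
    show "brack L x y \<in> homog L (m + n)" by (rule brack_degree[OF x y])
    show "brack L x (scal L c y) = scal L c (brack L x y)" for c
      using brack_linear_right[OF xs] ys by (simp add: linear_on_def)
    show "brack L x y = - sg (m * n) (brack L y x)"
      using brack_antisym[OF x y] by (simp add: sgn)
    show "dif L (brack L x y) = brack L (dif L x) y + sg m (brack L x (dif L y))"
      using brack_leibniz[OF x ys] by (simp add: sgn)
    fix z p assume z: "z \<in> homog L p"
    show "brack L x (brack L y z) = brack L (brack L x y) z + sg (m * n) (brack L y (brack L x z))"
      using brack_jacobi[OF x y hs[OF z]] by (simp only: sgn)
  next
    fix x y m assume "x \<in> homog L m" "y \<in> homog L m"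
    then show "dif L (x + y) = dif L x + dif L y"
      using dif_linear hs by (simp add: linear_on_def)
  next
    fix x y z m n assume "x \<in> homog L m" "y \<in> homog L n" "z \<in> homog L n"
    then show "brack L x (y + z) = brack L x y + brack L x z"
      using brack_linear_right[OF hs] hs by (simp add: linear_on_def)
  qed
qed

text \<open>Extends maps given on homogeneous components additively; on \<open>space_of\<close> only
  finitely many components are nonzero.\<close>

definition gsum :: "(int \<Rightarrow> 'u \<Rightarrow> 'a::zero) \<Rightarrow> (int \<Rightarrow> 'a \<Rightarrow> 'c::comm_monoid_add) \<Rightarrow> 'u \<Rightarrow> 'c" where
  "gsum r F u = (\<Sum>n\<in>{n. r n u \<noteq> 0}. F n (r n u))"

definition realize :: "('k, 'a::ab_group_add) graded_alg \<Rightarrow> ('k \<Rightarrow> 'u \<Rightarrow> 'u) \<Rightarrow> (int \<Rightarrow> 'a \<Rightarrow> 'u) \<Rightarrow> (int \<Rightarrow> 'u \<Rightarrow> 'a)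
    \<Rightarrow> ('k, 'u::ab_group_add) dgla" where
  "realize G S e r = \<lparr>scal = S, homog = (\<lambda>n. e n ` gh G n), dif = gsum r (\<lambda>n x. e (n + 1) (gd G x)),
     brack = (\<lambda>u v. gsum r (\<lambda>m x. gsum r (\<lambda>n y. e (m + n) (gb G m x y)) v) u)\<rparr>"

text \<open>\<open>e n\<close> embeds the piece of degree \<open>n\<close> into \<open>'u\<close> and \<open>r n\<close> reads off the component of degree \<open>n\<close>.\<close>

locale realization = dg_lie G for G :: "('k::field_char_0, 'a::ab_group_add) graded_alg" +
  fixes S :: "'k \<Rightarrow> 'u::ab_group_add \<Rightarrow> 'u" and e :: "int \<Rightarrow> 'a \<Rightarrow> 'u" and r :: "int \<Rightarrow> 'u \<Rightarrow> 'a"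
  assumes vsS: "vector_space S"
    and e_add: "e n (x + y) = e n x + e n y" and e_scale: "e n (gscal G c x) = S c (e n x)"
    and r_add: "r n (u + v) = r n u + r n v" and r_scale: "r n (S c u) = gscal G c (r n u)"
    and r_e: "r m (e n x) = (if m = n then x else 0)"
begin

sublocale U: vector_space S by (rule vsS)

abbreviation "R \<equiv> realize G S e r"

lemma e_zero [simp]: "e n 0 = 0" using e_add[of n 0 0] by simp
lemma r_zero [simp]: "r n 0 = 0" using r_add[of n 0 0] by simp
lemma e_neg: "e n (- x) = - e n x" using e_add[of n x "- x"] by (simp add: eq_neg_iff_add_eq_0 add.commute)
lemma e_sg: "e n (sg k x) = sg k (e n x)" by (simp add: sg_def e_neg)

lemma R_simps [simp]: "scal R = S" "homog R n = e n ` gh G n" by (simp_all add: realize_def)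

lemma homog_sub: "U.subspace (homog R n)"
proof (rule subspaceI[OF vsS]; simp)
  show "0 \<in> e n ` gh G n" by (rule image_eqI[of _ _ 0]) simp_all
  fix x y assume "x \<in> e n ` gh G n" "y \<in> e n ` gh G n"
  then show "x + y \<in> e n ` gh G n" by (auto simp: e_add[symmetric] add_in)
next
  fix c x assume "x \<in> e n ` gh G n"
  then show "S c x \<in> e n ` gh G n" by (auto simp: e_scale[symmetric] scale_in)
qed

lemma R_induct [consumes 1, case_names homog add]:
  assumes "u \<in> space_of R" "\<And>n x. x \<in> gh G n \<Longrightarrow> P (e n x)"
    "\<And>u v. \<lbrakk>u \<in> space_of R; v \<in> space_of R; P u; P v\<rbrakk> \<Longrightarrow> P (u + v)"
  shows "P u"
  by (rule space_induct[of R, OF _ _ assms(1)]) (use assms homog_sub vsS in auto)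

lemma space_e: "x \<in> gh G n \<Longrightarrow> e n x \<in> space_of R"
  by (rule homog_space[of R]) (auto simp: vsS)

lemma space_add: "\<lbrakk>u \<in> space_of R; v \<in> space_of R\<rbrakk> \<Longrightarrow> u + v \<in> space_of R"
  using U.subspace_add[of "space_of R"] space_subspace[of R] vsS by simp

lemma r_in: "u \<in> space_of R \<Longrightarrow> r n u \<in> gh G n"
  by (induction rule: R_induct) (auto simp: r_e r_add add_in)

lemma r_finite: "u \<in> space_of R \<Longrightarrow> finite {n. r n u \<noteq> 0}"
proof (induction rule: R_induct)
  case (homog n x)
  then show ?case by (rule_tac finite_subset[of _ "{n}"]) (auto simp: r_e)
next
  case (add u v)
  then show ?case
    by (rule_tac finite_subset[of _ "{n. r n u \<noteq> 0} \<union> {n. r n v \<noteq> 0}"]) (auto simp: r_add)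
qed

lemma gsum_superset:
  assumes "finite I" "{n. r n u \<noteq> 0} \<subseteq> I" "\<And>n. F n 0 = 0"
  shows "gsum r F u = (\<Sum>n\<in>I. F n (r n u))"
  unfolding gsum_def using assms by (intro sum.mono_neutral_left) auto

lemma gsum_add:
  fixes F :: "int \<Rightarrow> 'a \<Rightarrow> 'c::ab_group_add"
  assumes u: "u \<in> space_of R" and v: "v \<in> space_of R"
    and F: "\<And>n x y. \<lbrakk>x \<in> gh G n; y \<in> gh G n\<rbrakk> \<Longrightarrow> F n (x + y) = F n x + F n y"
  shows "gsum r F (u + v) = gsum r F u + gsum r F v"
proof -
  let ?I = "{n. r n u \<noteq> 0} \<union> {n. r n v \<noteq> 0}"
  have I: "finite ?I" using r_finite u v by blast
  have F0: "F n 0 = 0" for n using F[of 0 n 0] by simp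
  have "gsum r F (u + v) = (\<Sum>n\<in>?I. F n (r n (u + v)))"
    using I F0 by (intro gsum_superset) (auto simp: r_add)
  also have "\<dots> = (\<Sum>n\<in>?I. F n (r n u)) + (\<Sum>n\<in>?I. F n (r n v))"
    by (simp add: r_add F r_in u v sum.distrib)
  finally show ?thesis
    using gsum_superset[of ?I u F] gsum_superset[of ?I v F] I F0 by simp
qed

lemma gsum_scale:
  fixes F :: "int \<Rightarrow> 'a \<Rightarrow> 'c::ab_group_add"
  assumes u: "u \<in> space_of R" and t: "vector_space t"
    and F: "\<And>n x c. x \<in> gh G n \<Longrightarrow> F n (gscal G c x) = t c (F n x)"
  shows "gsum r F (S c u) = t c (gsum r F u)"
proof -
  interpret t: vector_space t by fact
  have F0: "F n 0 = 0" for n using F[of 0 n 0] by simp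
  have "gsum r F (S c u) = (\<Sum>n\<in>{n. r n u \<noteq> 0}. F n (r n (S c u)))"
    using r_finite[OF u] F0 by (intro gsum_superset) (auto simp: r_scale)
  also have "\<dots> = t c (gsum r F u)"
    by (simp add: r_scale F r_in[OF u] t.scale_sum_right gsum_def)
  finally show ?thesis .
qed

lemma gsum_e: "F n 0 = 0 \<Longrightarrow> gsum r F (e n x) = F n x"
  by (cases "x = 0") (auto simp: gsum_def r_e)

lemma dif_e: "dif R (e n x) = e (n + 1) (gd G x)"
  by (simp add: realize_def gsum_e[where F = "\<lambda>n x. e (n + 1) (gd G x)"])

lemma br_R_e:
  assumes x: "x \<in> gh G m" and y: "y \<in> gh G n"
  shows "brack R (e m x) (e n y) = e (m + n) (gb G m x y)"
proof (cases "x = 0 \<or> y = 0")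
  case True
  then show ?thesis using x y by (auto simp: realize_def gsum_def)
next
  case False
  then have "{k. r k (e m x) \<noteq> 0} = {m}" "{k. r k (e n y) \<noteq> 0} = {n}" by (auto simp: r_e)
  then show ?thesis by (simp add: realize_def gsum_def r_e)
qed

lemma dif_linear_R: "linear_on (space_of R) S S (dif R)"
  unfolding linear_on_def realize_def
  by (simp add: gsum_add[unfolded realize_def] gsum_scale[unfolded realize_def, OF _ vsS] 
     e_add e_scale d_add d_scale)

lemma brack_linear_right_R:
  assumes "u \<in> space_of R"
  shows "linear_on (space_of R) S S (brack R u)"
proof -
  define F where "F v = (\<lambda>m x. gsum r (\<lambda>n y. e (m + n) (gb G m x y)) v)" for v
  have F: "brack R u v = gsum r (F v) u" for v by (simp add: realize_def F_def)
  have 1: "F (v + w) m x = F v m x + F w m x" if "v \<in> space_of R" "w \<in> space_of R" "x \<in> gh G m" for v w m x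
    unfolding F_def by (rule gsum_add[OF that(1,2)]) (simp add: br_add_right[OF that(3)] e_add)
  have 2: "F (S c v) m x = S c (F v m x)" if "v \<in> space_of R" "x \<in> gh G m" for v c m x
    unfolding F_def by (rule gsum_scale[OF that(1) vsS]) (simp add: br_scale_right[OF that(2)] e_scale)
  show ?thesis unfolding linear_on_def F
    by (auto simp: gsum_def 1 2 r_in[OF assms] sum.distrib U.scale_sum_right)
qed

lemma brack_linear_left_R:
  assumes "v \<in> space_of R"
  shows "linear_on (space_of R) S S (\<lambda>u. brack R u v)"
proof -
  define F where "F = (\<lambda>m x. gsum r (\<lambda>n y. e (m + n) (gb G m x y)) v)"
  have F: "brack R u v = gsum r F u" for u by (simp add: realize_def F_def)
  have 1: "F m (x + y) = F m x + F m y" if "x \<in> gh G m" "y \<in> gh G m" for m x y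
    by (simp add: F_def gsum_def sum.distrib br_add_left[OF that r_in[OF assms]] e_add)
  have 2: "F m (gscal G c x) = S c (F m x)" if "x \<in> gh G m" for m c x
    by (simp add: F_def gsum_def br_scale_left[OF that r_in[OF assms]] e_scale U.scale_sum_right)
  show ?thesis unfolding linear_on_def F
    by (auto intro: gsum_add gsum_scale[OF _ vsS] 1 2)
qed

lemma dif_R_add: "\<lbrakk>u \<in> space_of R; v \<in> space_of R\<rbrakk> \<Longrightarrow> dif R (u + v) = dif R u + dif R v"
  using dif_linear_R by (simp add: linear_on_def)

lemma brack_R_add_right:
  "\<lbrakk>u \<in> space_of R; v \<in> space_of R; w \<in> space_of R\<rbrakk> \<Longrightarrow> brack R u (v + w) = brack R u v + brack R u w"
  using brack_linear_right_R[of u] by (simp add: linear_on_def)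

lemma brack_R_add_left:
  "\<lbrakk>u \<in> space_of R; v \<in> space_of R; w \<in> space_of R\<rbrakk> \<Longrightarrow> brack R (u + v) w = brack R u w + brack R v w"
  using brack_linear_left_R[of w] by (simp add: linear_on_def)

lemma dif_R_in: "u \<in> space_of R \<Longrightarrow> dif R u \<in> space_of R"
  by (induction rule: R_induct) (auto simp: dif_e dif_R_add space_add d_in space_e)

lemma brack_R_in: "\<lbrakk>u \<in> space_of R; v \<in> space_of R\<rbrakk> \<Longrightarrow> brack R u v \<in> space_of R"
proof (induction u rule: R_induct)
  case (homog m x)
  show ?case using homog(2,1)
    by (induction v rule: R_induct) (auto simp: br_R_e br_in space_e brack_R_add_right space_add)
qed (auto simp: brack_R_add_left space_add)

text \<open>Independence follows by applying \<open>r j\<close> to a relation. The remaining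
  identities hold on images of \<open>e\<close>, and \<open>R_induct\<close> extends them to sums in
  the arguments not fixed to be homogeneous.\<close>

lemma dg_lie_algebra_R: "dg_lie_algebra R"
proof (rule dg_lie_algebra.intro)
  show "vector_space (scal R)" by (simp add: vsS)
  show "module.subspace (scal R) (homog R i)" for i using homog_sub by simp
  show "linear_on (space_of R) (scal R) (scal R) (dif R)" using dif_linear_R by simp
  show "linear_on (space_of R) (scal R) (scal R) (brack R x)" if "x \<in> space_of R" for x
    using brack_linear_right_R[OF that] by simp
  show "linear_on (space_of R) (scal R) (scal R) (\<lambda>x. brack R x y)" if "y \<in> space_of R" for y
    using brack_linear_left_R[OF that] by simp
  show "dif R (dif R x) = 0" if "x \<in> space_of R" for x
    using that by (induction rule: R_induct) (auto simp: dif_e d_d dif_R_add dif_R_in)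
next
  fix I v and j :: int
  assume I: "finite I" and v: "\<And>i. i \<in> I \<Longrightarrow> v i \<in> homog R i" and 0: "(\<Sum>i\<in>I. v i) = 0" and j: "j \<in> I"
  obtain x where x: "v j = e j x" using v[OF j] by auto
  have r_sum: "r j (sum v J) = (\<Sum>i\<in>J. r j (v i))" for J
    by (induction J rule: infinite_finite_induct) (auto simp: r_add)
  have "(\<Sum>i\<in>I. r j (v i)) = 0" using r_sum[of I] 0 by simp
  moreover have "r j (v i) = (if i = j then x else 0)" if "i \<in> I" for i
    using v[OF that] x by (auto simp: r_e)
  ultimately have "x = 0" using I j by (simp add: sum.delta)
  then show "v j = 0" using x by simp
next
  fix x i assume "x \<in> homog R i"
  then show "dif R x \<in> homog R (i + 1)" by (auto simp: dif_e d_in)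
next
  fix x y i j assume "x \<in> homog R i" "y \<in> homog R j"
  then obtain a b where ab: "x = e i a" "y = e j b" "a \<in> gh G i" "b \<in> gh G j" by auto
  then show "brack R x y \<in> homog R (i + j)" by (auto simp: br_R_e br_in)
  have "gb G i a b = - sg (i * j) (gb G j b a)" using ab by (intro antisym)
  then show "brack R x y = - scal R ((-1) powi (i * j)) (brack R y x)"
    by (simp add: ab br_R_e scale_minus_one_powi[OF vsS] e_sg e_neg add.commute)
next
  fix x y z i j assume "x \<in> homog R i" "y \<in> homog R j" and z: "z \<in> space_of R"
  then obtain a b where ab: "x = e i a" "y = e j b" "a \<in> gh G i" "b \<in> gh G j" by auto
  have xy: "x \<in> space_of R" "y \<in> space_of R" using ab by (auto simp: space_e)
  show "brack R x (brack R y z) = brack R (brack R x y) z + scal R ((-1) powi (i * j)) (brack R y (brack R x z))"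
    using z
  proof (induction rule: R_induct)
    case (homog k c)
    then show ?case using jacobi[OF ab(3,4) homog]
      by (simp add: ab br_R_e br_in scale_minus_one_powi[OF vsS] e_sg e_add algebra_simps)
  next
    case (add u v)
    then show ?case
      by (simp add: brack_R_add_right xy brack_R_in U.scale_right_distrib)
  qed
next
  fix x y i assume "x \<in> homog R i" and y: "y \<in> space_of R"
  then obtain a where a: "x = e i a" "a \<in> gh G i" by auto
  have x: "x \<in> space_of R" using a by (auto simp: space_e)
  show "dif R (brack R x y) = brack R (dif R x) y + scal R ((-1) powi i) (brack R x (dif R y))"
    using y
  proof (induction rule: R_induct)
    case (homog k c)
    then show ?case
      using leibniz[OF a(2) homog] br_R_e[OF d_in[OF a(2)] homog] br_R_e[OF a(2) d_in[OF homog]]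
      by (simp add: a(1) br_R_e[OF a(2) homog] dif_e scale_minus_one_powi[OF vsS] e_sg e_add algebra_simps)
  next
    case (add u v)
    then show ?case
      by (simp add: brack_R_add_right x brack_R_in dif_R_in dif_R_add U.scale_right_distrib)
  qed
qed

text \<open>The map \<open>\<phi> n\<close> may depend on the degree, as \<open>evW n\<close> does;
  a single map on \<open>'u\<close> is obtained by summing over components.\<close>

lemma realize_morphism:
  assumes "dg_lie_algebra L"
    and \<phi>_in: "\<And>n x. x \<in> gh G n \<Longrightarrow> \<phi> n x \<in> homog L n"
    and \<phi>_add: "\<And>n x y. \<lbrakk>x \<in> gh G n; y \<in> gh G n\<rbrakk> \<Longrightarrow> \<phi> n (x + y) = \<phi> n x + \<phi> n y"
    and \<phi>_scale: "\<And>n x c. x \<in> gh G n \<Longrightarrow> \<phi> n (gscal G c x) = scal L c (\<phi> n x)"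
    and \<phi>_d: "\<And>n x. x \<in> gh G n \<Longrightarrow> \<phi> (n + 1) (gd G x) = dif L (\<phi> n x)"
    and \<phi>_br: "\<And>m n x y. \<lbrakk>x \<in> gh G m; y \<in> gh G n\<rbrakk> \<Longrightarrow> \<phi> (m + n) (gb G m x y) = brack L (\<phi> m x) (\<phi> n y)"
  shows "dgla_morphism R L (gsum r \<phi>)"
proof -
  interpret L: dg_lie_algebra L by fact
  let ?f = "gsum r \<phi>"
  have f_e: "?f (e n x) = \<phi> n x" for n x using \<phi>_add[of 0 n 0] by (intro gsum_e) simp
  have f_add: "?f (u + v) = ?f u + ?f v" if "u \<in> space_of R" "v \<in> space_of R" for u v
    by (rule gsum_add[OF that \<phi>_add])
  have f_in: "?f u \<in> space_of L" if "u \<in> space_of R" for u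
    using that
  proof (induction rule: R_induct)
    case (homog n x)
    then show ?case using homog_space[OF L.ambient \<phi>_in] by (simp add: f_e)
  next
    case (add u v)
    then show ?case using module.subspace_add[OF _ space_subspace[OF L.ambient]] L.ambient
      by (auto simp: f_add vector_space_def module_def)
  qed
  have "?f (dif R u) = dif L (?f u)" if "u \<in> space_of R" for u
    using that
  proof (induction rule: R_induct)
    case (homog n x)
    then show ?case by (simp add: dif_e f_e \<phi>_d)
  next
    case (add u v)
    then show ?case using L.dif_linear by (simp add: dif_R_add f_add dif_R_in f_in linear_on_def)
  qed
  moreover have "?f (brack R u v) = brack L (?f u) (?f v)" if "u \<in> space_of R" "v \<in> space_of R" for u v
    using that
  proof (induction u rule: R_induct)
    case (homog m x)
    show ?case using homog(2,1)
    proof (induction v rule: R_induct)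
      case (homog n y)
      then show ?case by (simp add: br_R_e f_e \<phi>_br)
    next
      case (add v w)
      then show ?case using L.brack_linear_right[OF f_in[OF space_e[OF add(5)]]]
        by (simp add: brack_R_add_right space_e brack_R_in f_add f_in linear_on_def)
    qed
  next
    case (add u w)
    then show ?case using L.brack_linear_left[OF f_in[OF add(5)]]
      by (simp add: brack_R_add_left brack_R_in f_add f_in linear_on_def)
  qed
  moreover have "?f (S c u) = scal L c (?f u)" if "u \<in> space_of R" for c u
    by (rule gsum_scale[OF that L.ambient \<phi>_scale])
  ultimately show ?thesis
    using f_add \<phi>_in by (auto simp: dgla_morphism_def degree_map_def linear_on_def f_e)
qed

end

section \<open>Cohomology through cosets\<close>

text \<open>Right cosets in \<open>homog_group L n\<close> and in its restriction to cocycles are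
  all translates of this form.\<close>

definition coset_of :: "'a::ab_group_add set \<Rightarrow> 'a \<Rightarrow> 'a set" where
  "coset_of B x = (\<lambda>b. b + x) ` B"

definition add_subgroup :: "'a::ab_group_add set \<Rightarrow> bool" where
  "add_subgroup B \<longleftrightarrow> 0 \<in> B \<and> (\<forall>x\<in>B. \<forall>y\<in>B. x - y \<in> B)"

lemma add_subgroupD:
  assumes "add_subgroup B"
  shows "0 \<in> B" "\<lbrakk>x \<in> B; y \<in> B\<rbrakk> \<Longrightarrow> x - y \<in> B" "x \<in> B \<Longrightarrow> - x \<in> B" "\<lbrakk>x \<in> B; y \<in> B\<rbrakk> \<Longrightarrow> x + y \<in> B"
proof -
  show 0: "0 \<in> B" and d: "\<And>x y. \<lbrakk>x \<in> B; y \<in> B\<rbrakk> \<Longrightarrow> x - y \<in> B"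
    using assms by (auto simp: add_subgroup_def)
  show n: "\<And>x. x \<in> B \<Longrightarrow> - x \<in> B" using d[OF 0] by simp
  show "\<lbrakk>x \<in> B; y \<in> B\<rbrakk> \<Longrightarrow> x + y \<in> B" using d[OF _ n, of x y] by simp
qed

lemma add_subgroup_subspace:
  assumes "vector_space s" "module.subspace s B" shows "add_subgroup B"
proof -
  interpret vector_space s by fact
  show ?thesis using subspace_0[OF assms(2)] subspace_diff[OF assms(2)] by (simp add: add_subgroup_def)
qed

lemma coset_of_eq_iff:
  assumes B: "add_subgroup B"
  shows "coset_of B x = coset_of B y \<longleftrightarrow> x - y \<in> B"
proof
  assume "coset_of B x = coset_of B y"
  moreover have "x \<in> coset_of B x" using add_subgroupD(1)[OF B] by (auto simp: coset_of_def image_iff intro!: bexI[of _ 0])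
  ultimately obtain b where "b \<in> B" "x = b + y" by (auto simp: coset_of_def)
  then show "x - y \<in> B" by simp
next
  assume xy: "x - y \<in> B"
  have sub: "coset_of B x \<subseteq> coset_of B y" if "x - y \<in> B" for x y
  proof
    fix z assume "z \<in> coset_of B x"
    then obtain b where "b \<in> B" "z = b + x" by (auto simp: coset_of_def)
    then have "z = (b + (x - y)) + y" "b + (x - y) \<in> B" using add_subgroupD(4)[OF B _ that] by auto
    then show "z \<in> coset_of B y" unfolding coset_of_def by blast
  qed
  from sub[OF xy] sub[of y x] show "coset_of B x = coset_of B y"
    using add_subgroupD(3)[OF B xy] by auto
qed

lemma coset_of_add:
  assumes B: "add_subgroup B"
  shows "{h + k |h k. h \<in> coset_of B x \<and> k \<in> coset_of B y} = coset_of B (x + y)"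
proof (intro equalityI subsetI)
  fix z assume "z \<in> {h + k |h k. h \<in> coset_of B x \<and> k \<in> coset_of B y}"
  then obtain b c where "b \<in> B" "c \<in> B" "z = (b + c) + (x + y)" by (auto simp: coset_of_def algebra_simps)
  then show "z \<in> coset_of B (x + y)" using add_subgroupD(4)[OF B] by (auto simp: coset_of_def)
next
  fix z assume "z \<in> coset_of B (x + y)"
  then obtain b where "b \<in> B" "z = (b + x) + (0 + y)" by (auto simp: coset_of_def algebra_simps)
  then show "z \<in> {h + k |h k. h \<in> coset_of B x \<and> k \<in> coset_of B y}"
    using add_subgroupD(1)[OF B] unfolding coset_of_def by blast
qed

lemma set_mult_homog: "A <#>\<^bsub>homog_group L n\<^esub> B = {h + k |h k. h \<in> A \<and> k \<in> B}"
  by (auto simp: set_mult_def homog_group_def)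

lemma r_coset_homog: "A #>\<^bsub>homog_group L n\<^esub> x = coset_of A x"
  by (auto simp: r_coset_def homog_group_def coset_of_def)

lemma carrier_homog [simp]: "carrier (homog_group L n) = homog L n"
  by (simp add: homog_group_def)

definition closed_part :: "('k, 'a::ab_group_add) dgla \<Rightarrow> int \<Rightarrow> 'a set" where
  "closed_part L n = {x \<in> homog L n. dif L x = 0}"

definition exact_part :: "('k, 'a::ab_group_add) dgla \<Rightarrow> int \<Rightarrow> 'a set" where
  "exact_part L n = dif L ` homog L (n - 1)"

lemma coboundaries_complex_of: "coboundaries (complex_of L) n = exact_part L n"
  by (simp add: coboundaries_def complex_of_def exact_part_def)

lemma cocycles_complex_of: "cocycles (complex_of L) n = closed_part L n"
  by (simp add: cocycles_def kernel_def closed_part_def complex_of_def homog_group_def)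

lemma cohomology_complex_of:
  "cohomology (complex_of L) n = (homog_group L n)\<lparr>carrier := closed_part L n\<rparr> Mod exact_part L n"
  by (simp add: cohomology_def cocycles_complex_of coboundaries_complex_of) (simp add: complex_of_def)

lemma carrier_cohomology: "carrier (cohomology (complex_of L) n) = coset_of (exact_part L n) ` closed_part L n"
proof -
  have "exact_part L n #>\<^bsub>(homog_group L n)\<lparr>carrier := closed_part L n\<rparr>\<^esub> x = coset_of (exact_part L n) x" for x
    by (auto simp: r_coset_def homog_group_def coset_of_def)
  then show ?thesis by (auto simp: cohomology_complex_of FactGroup_def RCOSETS_def)
qed

lemma mult_cohomology:
  "A \<otimes>\<^bsub>cohomology (complex_of L) n\<^esub> B = {h + k |h k. h \<in> A \<and> k \<in> B}"
  by (auto simp: cohomology_complex_of FactGroup_def set_mult_def homog_group_def)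

lemma add_subgroup_exact_part:
  assumes "dg_lie (graded_of L)" shows "add_subgroup (exact_part L n)"
proof -
  interpret dg_lie "graded_of L" by fact
  have "0 \<in> exact_part L n" using zero_in[of "n - 1"] d_zero unfolding exact_part_def by (intro image_eqI[of _ _ 0]) simp_all
  moreover have "x - y \<in> exact_part L n" if xy: "x \<in> exact_part L n" "y \<in> exact_part L n" for x y
  proof -
    obtain a b where "x = dif L a" "y = dif L b" "a \<in> homog L (n - 1)" "b \<in> homog L (n - 1)"
      using xy unfolding exact_part_def by blast
    then show ?thesis using d_diff[of a "n - 1" b] diff_in[of a "n - 1" b]
      unfolding exact_part_def by (intro image_eqI[of _ _ "a - b"]) simp_all
  qed
  ultimately show ?thesis by (simp add: add_subgroup_def)
qed

text \<open>The image of a whole coset spreads over \<open>f b + f x\<close>; as each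
  \<open>f b\<close> is a coboundary, the product with the coboundaries absorbs it.\<close>

lemma cohomology_map_coset:
  assumes E: "add_subgroup (exact_part E n)" and "0 \<in> exact_part D n" and "\<And>b. b \<in> exact_part D n \<Longrightarrow> f b \<in> exact_part E n"
    and "\<And>b. b \<in> exact_part D n \<Longrightarrow> f (b + x) = f b + f x"
  shows "cohomology_map (complex_of D) (complex_of E) (\<lambda>n. f) n (coset_of (exact_part D n) x) = coset_of (exact_part E n) (f x)"
proof -
  have grp: "grp (complex_of E) n = homog_group E n" by (simp add: complex_of_def)
  have im: "f ` coset_of (exact_part D n) x = (\<lambda>b. f b + f x) ` exact_part D n"
    unfolding coset_of_def image_image by (intro image_cong refl assms(4))
  have "cohomology_map (complex_of D) (complex_of E) (\<lambda>n. f) n (coset_of (exact_part D n) x)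
    = {h + (f b + f x) |h b. h \<in> exact_part E n \<and> b \<in> exact_part D n}"
    unfolding cohomology_map_def coboundaries_complex_of grp set_mult_homog im by blast
  also have "\<dots> = coset_of (exact_part E n) (f x)"
  proof (intro equalityI subsetI)
    fix z assume "z \<in> {h + (f b + f x) |h b. h \<in> exact_part E n \<and> b \<in> exact_part D n}"
    then obtain h b where "h \<in> exact_part E n" "b \<in> exact_part D n" "z = (h + f b) + f x" by (auto simp: algebra_simps)
    then show "z \<in> coset_of (exact_part E n) (f x)"
      using add_subgroupD(4)[OF E _ assms(3)] by (auto simp: coset_of_def)
  next
    fix z assume "z \<in> coset_of (exact_part E n) (f x)"
    then obtain h where h: "h \<in> exact_part E n" "z = h + f x" by (auto simp: coset_of_def)
    have "z = (h - f 0) + (f 0 + f x)" "h - f 0 \<in> exact_part E n"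
      using h add_subgroupD(2)[OF E h(1) assms(3)[OF assms(2)]] by auto
    then show "z \<in> {h + (f b + f x) |h b. h \<in> exact_part E n \<and> b \<in> exact_part D n}" using assms(2) by blast
  qed
  finally show ?thesis .
qed

text \<open>Serves to state (3) for elements: the classes of \<open>x\<close> and of
  \<open>0\<close> have the same image.\<close>

lemma injective_in_cohomologyD:
  assumes inj: "injective_in_cohomology (complex_of D) (complex_of E) (\<lambda>n. f)"
    and E: "add_subgroup (exact_part E n)" and D: "add_subgroup (exact_part D n)"
    and B: "\<And>b. b \<in> exact_part D n \<Longrightarrow> f b \<in> exact_part E n"
    and f: "\<And>b x. \<lbrakk>b \<in> exact_part D n; x \<in> closed_part D n\<rbrakk> \<Longrightarrow> f (b + x) = f b + f x"
    and x: "x \<in> closed_part D n" "f x \<in> exact_part E n" and 0: "0 \<in> closed_part D n"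
  shows "x \<in> exact_part D n"
proof -
  have map: "cohomology_map (complex_of D) (complex_of E) (\<lambda>n. f) n (coset_of (exact_part D n) y) = coset_of (exact_part E n) (f y)"
    if "y \<in> closed_part D n" for y
    by (rule cohomology_map_coset[OF E add_subgroupD(1)[OF D]]) (use B f that in blast)+
  have "f 0 \<in> exact_part E n" using B add_subgroupD(1)[OF D] by blast
  then have "f x - f 0 \<in> exact_part E n" by (rule add_subgroupD(2)[OF E x(2)])
  then have "cohomology_map (complex_of D) (complex_of E) (\<lambda>n. f) n (coset_of (exact_part D n) x)
     = cohomology_map (complex_of D) (complex_of E) (\<lambda>n. f) n (coset_of (exact_part D n) 0)"
    using map[OF x(1)] map[OF 0] coset_of_eq_iff[OF E] by simp
  moreover have "coset_of (exact_part D n) x \<in> carrier (cohomology (complex_of D) n)"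
    "coset_of (exact_part D n) 0 \<in> carrier (cohomology (complex_of D) n)"
    using x 0 by (auto simp: carrier_cohomology)
  ultimately have "coset_of (exact_part D n) x = coset_of (exact_part D n) 0"
    using inj unfolding injective_in_cohomology_def by (meson inj_onD)
  then show ?thesis using coset_of_eq_iff[OF D] by simp
qed

text \<open>Surjectivity is asked for cocycles themselves, which is stronger than for classes;
  \<open>evL\<close> and \<open>evW\<close> both provide it.\<close>

lemma iso_in_cohomologyI:
  assumes D: "dg_lie (graded_of D)" and E: "dg_lie (graded_of E)"
    and f_in: "\<And>n x. x \<in> homog D n \<Longrightarrow> f x \<in> homog E n"
    and f_add: "\<And>n x y. \<lbrakk>x \<in> homog D n; y \<in> homog D n\<rbrakk> \<Longrightarrow> f (x + y) = f x + f y"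
    and f_d: "\<And>n x. x \<in> homog D n \<Longrightarrow> f (dif D x) = dif E (f x)"
    and surj: "\<And>n z. z \<in> closed_part E n \<Longrightarrow> \<exists>x\<in>closed_part D n. f x = z"
    and inj: "\<And>n x. \<lbrakk>x \<in> closed_part D n; f x \<in> exact_part E n\<rbrakk> \<Longrightarrow> x \<in> exact_part D n"
  shows "iso_in_cohomology (complex_of D) (complex_of E) (\<lambda>n. f)"
  unfolding iso_in_cohomology_def
proof
  fix n
  interpret D: dg_lie "graded_of D" by fact
  interpret E: dg_lie "graded_of E" by fact
  note BD = add_subgroup_exact_part[OF D, of n] and BE = add_subgroup_exact_part[OF E, of n]
  let ?F = "cohomology_map (complex_of D) (complex_of E) (\<lambda>n. f) n"
  have B_in: "b \<in> homog D n" if "b \<in> exact_part D n" for b using that D.d_in[of _ "n - 1"] by (auto simp: exact_part_def)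
  have fB: "f b \<in> exact_part E n" if "b \<in> exact_part D n" for b using that f_d f_in by (auto simp: exact_part_def)
  have F: "?F (coset_of (exact_part D n) x) = coset_of (exact_part E n) (f x)" if "x \<in> closed_part D n" for x
  proof (rule cohomology_map_coset[OF BE add_subgroupD(1)[OF BD] fB])
    fix b assume "b \<in> exact_part D n"
    then show "f (b + x) = f b + f x" using f_add[OF B_in] that by (simp add: closed_part_def)
  qed
  have fZ: "f x \<in> closed_part E n" if "x \<in> closed_part D n" for x
    using that f_d[of x n] f_add[of 0 n 0] D.zero_in[of n] by (auto simp: closed_part_def f_in)
  have Z_add: "x + y \<in> closed_part D n" if "x \<in> closed_part D n" "y \<in> closed_part D n" for x y
    using that D.add_in[of x n y] D.d_add[of x n y] by (auto simp: closed_part_def)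
  have Z_diff: "x - y \<in> closed_part D n" if "x \<in> closed_part D n" "y \<in> closed_part D n" for x y
    using that D.diff_in[of x n y] D.d_diff[of x n y] by (auto simp: closed_part_def)
  show "?F \<in> iso (cohomology (complex_of D) n) (cohomology (complex_of E) n)"
    unfolding iso_def hom_def bij_betw_def
  proof (intro CollectI conjI ballI)
    show "?F \<in> carrier (cohomology (complex_of D) n) \<rightarrow> carrier (cohomology (complex_of E) n)"
      using F fZ by (auto simp: carrier_cohomology)
    fix X Y assume "X \<in> carrier (cohomology (complex_of D) n)" "Y \<in> carrier (cohomology (complex_of D) n)"
    then obtain x y where xy: "X = coset_of (exact_part D n) x" "Y = coset_of (exact_part D n) y" "x \<in> closed_part D n" "y \<in> closed_part D n"
      by (auto simp: carrier_cohomology)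
    then have "f (x + y) = f x + f y" by (intro f_add[of _ n]) (auto simp: closed_part_def)
    then show "?F (X \<otimes>\<^bsub>cohomology (complex_of D) n\<^esub> Y) = ?F X \<otimes>\<^bsub>cohomology (complex_of E) n\<^esub> ?F Y"
      using xy Z_add by (simp add: mult_cohomology coset_of_add[OF BD] coset_of_add[OF BE] F)
  next
    show "inj_on ?F (carrier (cohomology (complex_of D) n))"
    proof (rule inj_onI)
      fix X Y assume "X \<in> carrier (cohomology (complex_of D) n)" "Y \<in> carrier (cohomology (complex_of D) n)"
      then obtain x y where xy: "X = coset_of (exact_part D n) x" "Y = coset_of (exact_part D n) y" "x \<in> closed_part D n" "y \<in> closed_part D n"
        by (auto simp: carrier_cohomology)
      assume "?F X = ?F Y"
      then have "f x - f y \<in> exact_part E n" using xy by (simp add: F coset_of_eq_iff[OF BE])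
      moreover have "f x = f (x - y) + f y"
        using f_add[of "x - y" n y] xy Z_diff[OF xy(3,4)] by (auto simp: closed_part_def)
      ultimately have "x - y \<in> exact_part D n" using inj[OF Z_diff[OF xy(3,4)]] by simp
      then show "X = Y" using xy coset_of_eq_iff[OF BD] by simp
    qed
    show "?F ` carrier (cohomology (complex_of D) n) = carrier (cohomology (complex_of E) n)"
      unfolding carrier_cohomology image_image
    proof (intro equalityI subsetI)
      fix X assume "X \<in> coset_of (exact_part E n) ` closed_part E n"
      then obtain z where z: "X = coset_of (exact_part E n) z" "z \<in> closed_part E n" by blast
      then obtain x where "x \<in> closed_part D n" "f x = z" using surj by blast
      then show "X \<in> (\<lambda>x. ?F (coset_of (exact_part D n) x)) ` closed_part D n" using F z by (auto intro!: image_eqI[of _ _ x])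
    qed (auto simp: F fZ)
  qed
qed

section \<open>Injectivity into the shifted quotient complex\<close>

lemma coset_mult_quotient:
  assumes "add_subgroup B"
  shows "coset_of B x \<otimes>\<^bsub>homog_group M n Mod B\<^esub> coset_of B y = coset_of B (x + y)"
  by (simp add: FactGroup_def set_mult_homog coset_of_add[OF assms])

lemma group_homog:
  assumes "add_subgroup (homog M n)" shows "comm_group (homog_group M n)"
  by (rule comm_groupI)
     (use add_subgroupD[OF assms] in \<open>auto simp: homog_group_def algebra_simps intro!: bexI[of _ "- _"]\<close>)

text \<open>The sign in the differential of a shift is a group inverse in the quotient; this makes
  it an honest minus sign on representatives.\<close>

lemma inv_coset_quotient:
  assumes B: "add_subgroup B" "B \<subseteq> homog M n" and M: "add_subgroup (homog M n)" and x: "x \<in> homog M n"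
  shows "inv\<^bsub>homog_group M n Mod B\<^esub> coset_of B x = coset_of B (- x)"
proof -
  interpret comm_group "homog_group M n" by (rule group_homog[OF M])
  have inv: "inv\<^bsub>homog_group M n\<^esub> y = - y" if "y \<in> homog M n" for y
    by (rule inv_equality) (use that add_subgroupD(3)[OF M] in \<open>auto simp: homog_group_def\<close>)
  have "subgroup B (homog_group M n)"
  proof (rule subgroupI)
    show "B \<noteq> {}" using add_subgroupD(1)[OF B(1)] by blast
    show "inv\<^bsub>homog_group M n\<^esub> y \<in> B" if "y \<in> B" for y
      using that inv[of y] B(2) add_subgroupD(3)[OF B(1)] by auto
    show "y \<otimes>\<^bsub>homog_group M n\<^esub> z \<in> B" if "y \<in> B" "z \<in> B" for y z
      using that add_subgroupD(4)[OF B(1)] by (simp add: homog_group_def)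
  qed (use B in simp)
  then interpret N: normal B "homog_group M n" by (rule subgroup_imp_normal)
  interpret Q: group "homog_group M n Mod B" by (rule N.factorgroup_is_group)
  have carrier: "coset_of B y \<in> carrier (homog_group M n Mod B)" if "y \<in> homog M n" for y
    using that by (auto simp: FactGroup_def RCOSETS_def r_coset_homog)
  have "coset_of B (- x) \<otimes>\<^bsub>homog_group M n Mod B\<^esub> coset_of B x = \<one>\<^bsub>homog_group M n Mod B\<^esub>"
    unfolding coset_mult_quotient[OF B(1)] by (simp add: FactGroup_def coset_of_def)
  then show ?thesis
    using carrier x add_subgroupD(3)[OF M] by (intro Q.inv_equality) auto
qed

text \<open>Serves to state (4) for elements: when \<open>\<iota> x\<close> lies in
  \<open>H + d M\<close>, the classes of \<open>x\<close> and of \<open>0\<close> both go to the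
  zero class, which is the set \<open>D\<close> of coboundaries.\<close>

lemma injective_quotientD:
  assumes inj: "injective_in_cohomology (complex_of L) (shift (quotient_complex M H)) (induced_map M H \<iota>)"
    and L: "dg_lie (graded_of L)" and M: "dg_lie (graded_of M)"
    and H: "\<And>n. add_subgroup (H \<inter> homog M n)" and H_d: "\<And>h. h \<in> H \<Longrightarrow> dif M h \<in> H"
    and \<iota>_in: "\<And>n x. x \<in> homog L n \<Longrightarrow> \<iota> x \<in> homog M (n - 1)"
    and \<iota>_add: "\<And>n x y. \<lbrakk>x \<in> homog L n; y \<in> homog L n\<rbrakk> \<Longrightarrow> \<iota> (x + y) = \<iota> x + \<iota> y"
    and \<iota>_H: "\<And>n x. x \<in> homog L n \<Longrightarrow> dif M (\<iota> x) + \<iota> (dif L x) \<in> H"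
    and x: "x \<in> closed_part L n" and h: "h \<in> H \<inter> homog M (n - 1)" and m: "m \<in> homog M (n - 2)" "\<iota> x = h + dif M m"
  shows "x \<in> exact_part L n"
proof -
  interpret L: dg_lie "graded_of L" by fact
  interpret M: dg_lie "graded_of M" by fact
  have Mn: "add_subgroup (homog M n)" for n
    using M.zero_in[of n] M.diff_in[of _ n] by (simp add: add_subgroup_def)
  define B where "B = H \<inter> homog M (n - 1)"
  have B: "add_subgroup B" "B \<subseteq> homog M (n - 1)" using H by (auto simp: B_def)
  let ?Q = "homog_group M (n - 1) Mod B"
  define D where "D = (\<lambda>m. coset_of B (dif M m)) ` homog M (n - 2)"
  have dM: "dif M m \<in> homog M (n - 1)" if "m \<in> homog M (n - 2)" for m
    using M.d_in[of m "n - 2"] that by simp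
  have dY: "B <#>\<^bsub>homog_group M (n - 1)\<^esub> (dif M ` coset_of (H \<inter> homog M (n - 2)) m) = coset_of B (dif M m)"
    if m: "m \<in> homog M (n - 2)" for m
  proof -
    have d: "dif M (h + m) = dif M h + dif M m" "dif M h \<in> B" if "h \<in> H \<inter> homog M (n - 2)" for h
      using M.d_add[of h "n - 2" m] that m H_d dM by (auto simp: B_def)
    show ?thesis unfolding set_mult_homog
    proof (intro equalityI subsetI)
      fix z assume "z \<in> {h + k |h k. h \<in> B \<and> k \<in> dif M ` coset_of (H \<inter> homog M (n - 2)) m}"
      then obtain b h where "b \<in> B" "h \<in> H \<inter> homog M (n - 2)" "z = b + dif M (h + m)"
        by (auto simp: coset_of_def)
      then have "z = (b + dif M h) + dif M m" "b + dif M h \<in> B"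
        using d add_subgroupD(4)[OF B(1)] by (auto simp: algebra_simps)
      then show "z \<in> coset_of B (dif M m)" by (auto simp: coset_of_def)
    next
      fix z assume "z \<in> coset_of B (dif M m)"
      then obtain b where "b \<in> B" "z = b + dif M m" by (auto simp: coset_of_def)
      moreover have "m \<in> coset_of (H \<inter> homog M (n - 2)) m"
        using add_subgroupD(1)[OF H, of "n - 2"] by (auto simp: coset_of_def image_iff intro!: bexI[of _ 0])
      ultimately show "z \<in> {h + k |h k. h \<in> B \<and> k \<in> dif M ` coset_of (H \<inter> homog M (n - 2)) m}" by blast
    qed
  qed
  have "coboundaries (shift (quotient_complex M H)) n
      = (\<lambda>m. inv\<^bsub>?Q\<^esub> (B <#>\<^bsub>homog_group M (n - 1)\<^esub> (dif M ` coset_of (H \<inter> homog M (n - 2)) m))) ` homog M (n - 2)"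
    by (auto simp: coboundaries_def shift_def quotient_complex_def FactGroup_def RCOSETS_def r_coset_homog B_def)
  also have "\<dots> = (\<lambda>m. coset_of B (dif M (- m))) ` homog M (n - 2)"
    using inv_coset_quotient[OF B Mn dM] M.d_neg[of _ "n - 2"] by (intro image_cong refl) (simp add: dY)
  \<comment> \<open>The sign of the shift disappears because negation permutes
    \<open>homog M (n - 2)\<close>.\<close>
  also have "\<dots> = D"
    using M.neg_in[of _ "n - 2"] unfolding D_def by (force intro!: image_eqI[of _ _ "- _"])
  finally have cb: "coboundaries (shift (quotient_complex M H)) n = D" .
  have ind: "induced_map M H \<iota> n a = coset_of B (\<iota> a)" for a
    by (simp add: induced_map_def r_coset_homog B_def)
  have in_D: "coset_of B y \<in> D" if "y - dif M m \<in> B" "m \<in> homog M (n - 2)" for y m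
    using that coset_of_eq_iff[OF B(1)] by (auto simp: D_def)
  have map: "cohomology_map (complex_of L) (shift (quotient_complex M H)) (induced_map M H \<iota>) n (coset_of (exact_part L n) y) = D"
    if y: "y \<in> homog L n" and yh: "\<iota> y - dif M m \<in> B" "m \<in> homog M (n - 2)" for y m
  proof -
    define F where "F = induced_map M H \<iota> n ` coset_of (exact_part L n) y"
    have "F \<subseteq> D"
    proof
      fix X assume "X \<in> F"
      then obtain x' where x': "x' \<in> homog L (n - 1)" and X: "X = coset_of B (\<iota> (dif L x' + y))"
        by (auto simp: F_def ind coset_of_def exact_part_def)
      have dx: "dif L x' \<in> homog L n" using L.d_in[of x' "n - 1"] x' by simp
      have ix: "\<iota> x' \<in> homog M (n - 2)" using \<iota>_in[OF x'] by simp
      \<comment> \<open>By (2), \<open>\<iota>\<close> of \<open>dx'\<close> is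
        \<open>- d (\<iota> x')\<close> modulo \<open>H\<close>: changing \<open>y\<close> by this
        coboundary replaces \<open>m\<close> by \<open>m - \<iota> x'\<close>.\<close>
      have "dif M (\<iota> x') + \<iota> (dif L x') \<in> B"
        using \<iota>_H[OF x'] \<iota>_in[OF dx] dM[OF ix] M.add_in[of _ "n - 1"] by (simp add: B_def)
      then have "(\<iota> y - dif M m) + (dif M (\<iota> x') + \<iota> (dif L x')) \<in> B"
        by (rule add_subgroupD(4)[OF B(1) yh(1)])
      moreover have "dif M (m - \<iota> x') = dif M m - dif M (\<iota> x')"
        using M.d_diff[of m "n - 2" "\<iota> x'"] yh(2) ix by simp
      ultimately have "\<iota> (dif L x' + y) - dif M (m - \<iota> x') \<in> B"
        by (simp only: \<iota>_add[OF dx y]) (simp add: algebra_simps)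
      then show "X \<in> D" unfolding X
        using M.diff_in[of m "n - 2" "\<iota> x'"] yh(2) ix by (intro in_D[of _ "m - \<iota> x'"]) simp_all
    qed
    moreover have "F \<noteq> {}"
      using add_subgroupD(1)[OF add_subgroup_exact_part[OF L, of n]] by (auto simp: F_def coset_of_def)
    moreover have "cohomology_map (complex_of L) (shift (quotient_complex M H)) (induced_map M H \<iota>) n (coset_of (exact_part L n) y)
      = {X \<otimes>\<^bsub>?Q\<^esub> Y |X Y. X \<in> D \<and> Y \<in> F}"
      unfolding cohomology_map_def cb F_def
      by (auto simp: set_mult_def shift_def quotient_complex_def B_def)
    \<comment> \<open>\<open>D\<close> is a subgroup of \<open>?Q\<close>, so its product with a
      nonempty subset of itself is \<open>D\<close>.\<close>
    moreover have "{X \<otimes>\<^bsub>?Q\<^esub> Y |X Y. X \<in> D \<and> Y \<in> F} = D" if FD: "F \<subseteq> D" "F \<noteq> {}"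
    proof (intro equalityI subsetI)
      fix Z assume "Z \<in> {X \<otimes>\<^bsub>?Q\<^esub> Y |X Y. X \<in> D \<and> Y \<in> F}"
      then obtain X Y where XY: "Z = X \<otimes>\<^bsub>?Q\<^esub> Y" "X \<in> D" "Y \<in> D" using FD by blast
      then obtain a b where "a \<in> homog M (n - 2)" "b \<in> homog M (n - 2)"
        "X = coset_of B (dif M a)" "Y = coset_of B (dif M b)" unfolding D_def by blast
      moreover from this have "Z = coset_of B (dif M a + dif M b)"
        unfolding XY(1) by (simp only: coset_mult_quotient[OF B(1)])
      ultimately have "a \<in> homog M (n - 2)" "b \<in> homog M (n - 2)" "Z = coset_of B (dif M a + dif M b)" by blast+
      then show "Z \<in> D"
        using M.add_in[of a "n - 2" b] M.d_add[of a "n - 2" b] unfolding D_def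
        by (auto intro!: image_eqI[of _ _ "a + b"])
    next
      fix Z assume "Z \<in> D"
      then obtain a where a: "a \<in> homog M (n - 2)" "Z = coset_of B (dif M a)" by (auto simp: D_def)
      obtain Y where "Y \<in> F" using FD by blast
      then obtain b where b: "b \<in> homog M (n - 2)" "Y = coset_of B (dif M b)"
        using FD unfolding D_def by blast
      have "Z = coset_of B (dif M (a - b)) \<otimes>\<^bsub>?Q\<^esub> Y"
        using M.d_diff[of a "n - 2" b] a b(1)
        unfolding a(2) b(2) coset_mult_quotient[OF B(1)] by simp
      moreover have "coset_of B (dif M (a - b)) \<in> D"
        using M.diff_in[of a "n - 2" b] a b by (simp add: D_def)
      ultimately show "Z \<in> {X \<otimes>\<^bsub>?Q\<^esub> Y |X Y. X \<in> D \<and> Y \<in> F}" using \<open>Y \<in> F\<close> by blast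
    qed
    ultimately show ?thesis by simp
  qed
  have 0: "0 \<in> closed_part L n" using L.zero_in[of n] L.d_zero by (simp add: closed_part_def)
  have "\<iota> 0 = 0" using \<iota>_add[of 0 n 0] L.zero_in[of n] by simp
  then have "cohomology_map (complex_of L) (shift (quotient_complex M H)) (induced_map M H \<iota>) n (coset_of (exact_part L n) x)
    = cohomology_map (complex_of L) (shift (quotient_complex M H)) (induced_map M H \<iota>) n (coset_of (exact_part L n) 0)"
    using map[of x m] map[of 0 0] x h m M.zero_in[of "n - 2"] M.d_zero L.zero_in[of n] add_subgroupD(1)[OF B(1)]
    by (auto simp: B_def closed_part_def)
  moreover have "coset_of (exact_part L n) x \<in> carrier (cohomology (complex_of L) n)"
    "coset_of (exact_part L n) 0 \<in> carrier (cohomology (complex_of L) n)"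
    using x 0 by (auto simp: carrier_cohomology)
  ultimately have "coset_of (exact_part L n) x = coset_of (exact_part L n) 0"
    using inj unfolding injective_in_cohomology_def by (meson inj_onD)
  then show ?thesis using coset_of_eq_iff[OF add_subgroup_exact_part[OF L]] by simp
qed

section \<open>The zigzag\<close>

lemma realize_quasi_isomorphism:
  fixes G :: "('k::field_char_0, 'a::ab_group_add) graded_alg" and L :: "('k, 'b::ab_group_add) dgla"
  assumes R: "realization G S e r" and L: "dg_lie_algebra L"
    and \<phi>_in: "\<And>n x. x \<in> gh G n \<Longrightarrow> \<phi> n x \<in> homog L n"
    and \<phi>_add: "\<And>n x y. \<lbrakk>x \<in> gh G n; y \<in> gh G n\<rbrakk> \<Longrightarrow> \<phi> n (x + y) = \<phi> n x + \<phi> n y"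
    and \<phi>_scale: "\<And>n x c. x \<in> gh G n \<Longrightarrow> \<phi> n (gscal G c x) = scal L c (\<phi> n x)"
    and \<phi>_d: "\<And>n x. x \<in> gh G n \<Longrightarrow> \<phi> (n + 1) (gd G x) = dif L (\<phi> n x)"
    and \<phi>_br: "\<And>m n x y. \<lbrakk>x \<in> gh G m; y \<in> gh G n\<rbrakk> \<Longrightarrow> \<phi> (m + n) (gb G m x y) = brack L (\<phi> m x) (\<phi> n y)"
    and surj: "\<And>n z. \<lbrakk>z \<in> homog L n; dif L z = 0\<rbrakk> \<Longrightarrow> \<exists>x\<in>gh G n. gd G x = 0 \<and> \<phi> n x = z"
    and inj: "\<And>n x y. \<lbrakk>x \<in> gh G n; gd G x = 0; y \<in> homog L (n - 1); \<phi> n x = dif L y\<rbrakk>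
      \<Longrightarrow> \<exists>x'\<in>gh G (n - 1). gd G x' = x"
  shows "quasi_isomorphism_to (realize G S e r) L"
proof -
  interpret realization G S e r by fact
  have mor: "dgla_morphism R L (gsum r \<phi>)"
    by (rule realize_morphism[OF L \<phi>_in \<phi>_add \<phi>_scale \<phi>_d \<phi>_br])
  have f_e: "gsum r \<phi> (e n x) = \<phi> n x" for n x using \<phi>_add[of 0 n 0] by (intro gsum_e) simp
  have e_eq: "e n x = e n y \<longleftrightarrow> x = y" for n x y by (metis r_e)
  have "iso_in_cohomology (complex_of R) (complex_of L) (\<lambda>n. gsum r \<phi>)"
  proof (rule iso_in_cohomologyI)
    show "dg_lie (graded_of R)" by (rule dg_lie_graded_of[OF dg_lie_algebra_R])
    show "dg_lie (graded_of L)" by (rule dg_lie_graded_of[OF L])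
    fix n x assume x: "x \<in> homog R n"
    then show "gsum r \<phi> x \<in> homog L n" by (auto simp: f_e \<phi>_in)
    show "gsum r \<phi> (dif R x) = dif L (gsum r \<phi> x)"
      using x by (auto simp: f_e dif_e \<phi>_d)
  next
    fix n x y assume "x \<in> homog R n" "y \<in> homog R n"
    then show "gsum r \<phi> (x + y) = gsum r \<phi> x + gsum r \<phi> y"
      by (auto simp: f_e e_add[symmetric] \<phi>_add)
  next
    fix n z assume "z \<in> closed_part L n"
    then obtain x where "x \<in> gh G n" "gd G x = 0" "\<phi> n x = z" using surj by (auto simp: closed_part_def)
    then show "\<exists>x\<in>closed_part R n. gsum r \<phi> x = z"
      by (intro bexI[of _ "e n x"]) (auto simp: closed_part_def f_e dif_e)
  next
    fix n x assume "x \<in> closed_part R n" and B: "gsum r \<phi> x \<in> exact_part L n"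
    then obtain a where a: "x = e n a" "a \<in> gh G n" "e (n + 1) (gd G a) = e (n + 1) 0"
      by (auto simp: closed_part_def dif_e)
    moreover obtain y where "y \<in> homog L (n - 1)" "\<phi> n a = dif L y"
      using B by (auto simp: a(1) f_e exact_part_def)
    ultimately obtain b where "b \<in> gh G (n - 1)" "gd G b = a"
      using inj unfolding e_eq by blast
    then show "x \<in> exact_part R n" by (auto simp: exact_part_def a(1) dif_e intro!: image_eqI[of _ _ "e (n - 1) b"])
  qed
  then show ?thesis
    unfolding quasi_isomorphism_to_def using mor dg_lie_algebra_R L by blast
qed

text \<open>Degree and coefficient indices are packed into one natural number.\<close>

definition pack ::
  "int \<Rightarrow> ((nat \<Rightarrow> 'a \<times> 'a) \<times> (nat \<Rightarrow> 'a \<times> 'a)) \<times>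
     ((nat \<Rightarrow> (nat \<Rightarrow> 'b) \<times> (nat \<Rightarrow> 'b)) \<times> (nat \<Rightarrow> (nat \<Rightarrow> 'b) \<times> (nat \<Rightarrow> 'b)))
   \<Rightarrow> nat \<Rightarrow> 'a::ab_group_add \<times> 'b::ab_group_add" where
  "pack n x i =
    (case from_nat i of (m, c, d, k) \<Rightarrow>
       if m = n then (if d then fst else snd) ((if c then fst else snd) (fst x) k) else 0,
     case from_nat i of (m, c, d, j, k) \<Rightarrow>
       if m = n then (if d then fst else snd) ((if c then fst else snd) (snd x) j) k else 0)"

definition unpack ::
  "int \<Rightarrow> (nat \<Rightarrow> 'a::ab_group_add \<times> 'b::ab_group_add) \<Rightarrow>
     ((nat \<Rightarrow> 'a \<times> 'a) \<times> (nat \<Rightarrow> 'a \<times> 'a)) \<times>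
     ((nat \<Rightarrow> (nat \<Rightarrow> 'b) \<times> (nat \<Rightarrow> 'b)) \<times> (nat \<Rightarrow> (nat \<Rightarrow> 'b) \<times> (nat \<Rightarrow> 'b)))" where
  "unpack n u =
    (let a = (\<lambda>c d k. fst (u (to_nat (n, c :: bool, d :: bool, k :: nat))));
         b = (\<lambda>c d j k. snd (u (to_nat (n, c :: bool, d :: bool, j :: nat, k :: nat))))
     in ((\<lambda>k. (a True True k, a True False k), \<lambda>k. (a False True k, a False False k)),
         (\<lambda>j. (b True True j, b True False j), \<lambda>j. (b False True j, b False False j))))"

definition scale_seq :: "('k \<Rightarrow> 'a \<Rightarrow> 'a) \<Rightarrow> ('k \<Rightarrow> 'b \<Rightarrow> 'b) \<Rightarrow> 'k \<Rightarrow> (nat \<Rightarrow> 'a \<times> 'b) \<Rightarrow> nat \<Rightarrow> 'a \<times> 'b" where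
  "scale_seq s t c u i = (s c (fst (u i)), t c (snd (u i)))"

lemma vector_space_scale_seq:
  assumes "vector_space s" "vector_space t" shows "vector_space (scale_seq s t)"
  using vector_space_fun[OF vector_space_prod[OF assms]] by (simp add: scale_seq_def[abs_def])

text \<open>The degree is part of the encoded index, so different degrees occupy disjoint positions
  of the sequence; this yields the zero in the case \<open>m \<noteq> n\<close>.\<close>

lemma (in cartan) realization_pull:
  "realization pull (scale_seq (gscal L) (gscal M)) pack unpack"
proof (rule realization.intro[OF dg_lie_pull realization_axioms.intro])
  show "vector_space (scale_seq (gscal L) (gscal M))"
    by (rule vector_space_scale_seq[OF L.vs M.vs])
  show "pack n (x + y) = pack n x + pack n y" for n x y
    by (auto simp: fun_eq_iff pack_def split: prod.splits)
  show "pack n (gscal pull c x) = scale_seq (gscal L) (gscal M) c (pack n x)" for n x c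
    by (auto simp: fun_eq_iff pack_def scale_seq_def prod_simps path_gscal cone_simps split: prod.splits)
  show "unpack n (u + v) = unpack n u + unpack n v" for n u v
    by (auto simp: fun_eq_iff unpack_def Let_def)
  show "unpack n (scale_seq (gscal L) (gscal M) c u) = gscal pull c (unpack n u)" for n u c
    by (auto simp: fun_eq_iff unpack_def Let_def scale_seq_def prod_simps path_gscal cone_simps)
  show "unpack m (pack n x) = (if m = n then x else 0)" for m n x
    by (auto simp: prod_eq_iff fun_eq_iff unpack_def Let_def pack_def)
qed

definition put :: "int \<Rightarrow> 'b \<Rightarrow> nat \<Rightarrow> 'a::zero \<times> 'b::zero" where
  "put n v i = (0, if from_nat i = n then v else 0)"

lemma (in cartan) realization_target:
  "realization target (scale_seq (gscal L) (gscal M)) put (\<lambda>n u. snd (u (to_nat n)))"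
proof (rule realization.intro[OF dg_lie_target realization_axioms.intro])
  show "vector_space (scale_seq (gscal L) (gscal M))"
    by (rule vector_space_scale_seq[OF L.vs M.vs])
qed (auto simp: fun_eq_iff put_def scale_seq_def target_def)

text \<open>The zigzag is \<open>K\<close> <- \<open>X\<close> -> \<open>A\<close>. The left arrow
  is the step between the type of \<open>K\<close> and the sequences; the right arrow stays among
  the sequences.\<close>

lemma (in cartan) homotopy_abelian_zigzag:
  fixes K :: "('k, 'a) dgla"
  assumes K: "dg_lie_algebra K" "graded_of K = L"
  shows "homotopy_abelian TYPE(nat \<Rightarrow> 'a \<times> 'b) K"
proof -
  let ?S = "scale_seq (gscal L) (gscal M)"
  let ?r = "\<lambda>n u. snd (u (to_nat n))"
  let ?p = "put :: int \<Rightarrow> 'b \<Rightarrow> nat \<Rightarrow> 'a \<times> 'b"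
  define X :: "('k, nat \<Rightarrow> 'a \<times> 'b) dgla" where "X = realize pull ?S pack unpack"
  define A :: "('k, nat \<Rightarrow> 'a \<times> 'b) dgla" where "A = realize target ?S ?p ?r"
  interpret E: dg_hom pull L evL by (rule evL_hom)
  interpret T: realization target ?S ?p ?r by (rule realization_target)
  have LK: "gscal L = scal K" "gh L = homog K" "gd L = dif K" "\<And>m. gb L m = brack K"
    unfolding K(2)[symmetric] by simp_all
  have "quasi_isomorphism_to X K"
    unfolding X_def
  proof (rule realize_quasi_isomorphism[where \<phi> = "\<lambda>n. evL", OF realization_pull K(1)])
    fix n z assume "z \<in> homog K n" "dif K z = 0"
    then show "\<exists>x\<in>gh pull n. gd pull x = 0 \<and> evL x = z"
      using evL_surjective[of z n] by (auto simp: LK)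
  next
    fix n x y assume "x \<in> gh pull n" "gd pull x = 0" "y \<in> homog K (n - 1)" "evL x = dif K y"
    then show "\<exists>x'\<in>gh pull (n - 1). gd pull x' = x"
      using evL_injective[of x n y] by (auto simp: LK)
  qed (use E.hom_in E.hom_add E.hom_scale E.hom_d E.hom_br in \<open>simp_all add: LK\<close>)
  moreover have "quasi_isomorphism_to X A"
    unfolding X_def
  proof (rule realize_quasi_isomorphism[where \<phi> = "\<lambda>n x. ?p n (evW n x)", OF realization_pull])
    show "dg_lie_algebra A" unfolding A_def by (rule T.dg_lie_algebra_R)
  next
    fix n x assume x: "x \<in> gh pull n"
    show "?p n (evW n x) \<in> homog A n" by (simp add: A_def evW_in)
    show "?p n (evW n (gscal pull c x)) = scal A c (?p n (evW n x))" for c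
      by (simp only: evW_scale[OF x] T.e_scale A_def T.R_simps)
    show "?p (n + 1) (evW (n + 1) (gd pull x)) = dif A (?p n (evW n x))"
      using T.dif_e[of n "evW n x"] evW_zero[OF evV_d[OF x]] by (simp add: A_def target_def)
  next
    fix n x y assume "x \<in> gh pull n" "y \<in> gh pull n"
    then show "?p n (evW n (x + y)) = ?p n (evW n x) + ?p n (evW n y)"
      by (simp add: evW_add T.e_add)
  next
    fix m n x y assume "x \<in> gh pull m" "y \<in> gh pull n"
    then show "?p (m + n) (evW (m + n) (gb pull m x y)) = brack A (?p m (evW m x)) (?p n (evW n y))"
      using T.br_R_e[OF evW_in evW_in, of m x n y] evW_zero[OF evV_br] by (simp add: A_def target_def)
  next
    fix n z assume "z \<in> homog A n"
    then obtain w where "z = ?p n w" "w \<in> gh target n" by (auto simp: A_def)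
    then show "\<exists>x\<in>gh pull n. gd pull x = 0 \<and> ?p n (evW n x) = z"
      using evW_surjective[of w n] by blast
  next
    fix n x y assume x: "x \<in> gh pull n" "gd pull x = 0" and "y \<in> homog A (n - 1)" "?p n (evW n x) = dif A y"
    then obtain w where "y = ?p (n - 1) w" "w \<in> gh target (n - 1)" by (auto simp: A_def)
    \<comment> \<open>The target has zero differential, so an exact image is zero and the kernel
      statement \<open>evW_injective\<close> suffices.\<close>
    then have "dif A y = 0" using T.dif_e[of "n - 1" w] by (simp add: A_def target_def)
    then have "?r n (?p n (evW n x)) = 0" using \<open>?p n (evW n x) = dif A y\<close> by simp
    then have "evW n x = 0" by (simp add: put_def)
    then show "\<exists>x'\<in>gh pull (n - 1). gd pull x' = x" using evW_injective[OF x] by blast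
  qed
  moreover have "brack A u v = 0" for u v
    using T.e_zero by (simp add: A_def realize_def target_def gsum_def)
  then have "abelian_dgla A" by (simp add: abelian_dgla_def)
  ultimately show ?thesis
    unfolding homotopy_abelian_def by (blast intro: r_into_equivclp)
qed

theorem theorem1p1:
  fixes L :: "('k::field_char_0, 'a::ab_group_add) dgla"
    and M :: "('k, 'b::ab_group_add) dgla"
    and H :: "'b set"
    and \<ii> :: "'a \<Rightarrow> 'b"
  assumes "dg_lie_algebra L"
    and "dg_lie_algebra M"
    and "dg_lie_subalgebra H M"
    and "degree_map (-1) L M \<ii>"
    and "\<And>a b. \<lbrakk>a \<in> space_of L; b \<in> space_of L\<rbrakk> \<Longrightarrow> brack M (\<ii> a) (\<ii> b) = 0"
    and "\<And>a b. \<lbrakk>a \<in> space_of L; b \<in> space_of L\<rbrakk>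
           \<Longrightarrow> \<ii> (brack L a b) = brack M (\<ii> a) (dif M (\<ii> b))"
    and "\<And>a. a \<in> space_of L \<Longrightarrow> dif M (\<ii> a) + \<ii> (dif L a) \<in> H"
    and "injective_in_cohomology (complex_of (restrict_dgla M H)) (complex_of M) (\<lambda>n x. x)"
    and "injective_in_cohomology (complex_of L) (shift (quotient_complex M H)) (induced_map M H \<ii>)"
  shows "homotopy_abelian TYPE(nat \<Rightarrow> 'a \<times> 'b) L"
proof -
  interpret L: dg_lie_algebra L by fact
  interpret M: dg_lie_algebra M by fact
  interpret GL: dg_lie "graded_of L" by (rule dg_lie_graded_of[OF assms(1)])
  interpret GM: dg_lie "graded_of M" by (rule dg_lie_graded_of[OF assms(2)])
  interpret VM: vector_space "scal M" by (rule M.ambient)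
  note hs = homog_space[OF L.ambient]
  have H_span: "H = VM.span (\<Union>i. H \<inter> homog M i)" and H_d: "\<And>x. x \<in> H \<Longrightarrow> dif M x \<in> H"
    and H_br: "\<And>x y. \<lbrakk>x \<in> H; y \<in> H\<rbrakk> \<Longrightarrow> brack M x y \<in> H"
    using assms(3) by (auto simp: dg_lie_subalgebra_def)
  have H_sub: "VM.subspace H" by (subst H_span) (rule VM.subspace_span)
  have Hn: "VM.subspace (H \<inter> homog M n)" for n
    by (rule VM.subspace_inter[OF H_sub M.homog_subspace])
  have i_in: "\<ii> x \<in> homog M (n - 1)" if "x \<in> homog L n" for n x
    using assms(4) that by (auto simp: degree_map_def)
  have i_add: "\<ii> (x + y) = \<ii> x + \<ii> y" if "x \<in> homog L n" "y \<in> homog L n" for n x y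
    using assms(4) hs that by (simp add: degree_map_def linear_on_def)
  have i_scale: "\<ii> (scal L c x) = scal M c (\<ii> x)" if "x \<in> homog L n" for n c x
    using assms(4) hs[OF that] by (simp add: degree_map_def linear_on_def)
  interpret cartan "graded_of L" "graded_of M" "\<lambda>n. H \<inter> homog M n" \<ii>
  proof (unfold_locales, unfold graded_of_simps)
    show "H \<inter> homog M n \<subseteq> homog M n" for n by blast
    show "VM.subspace (H \<inter> homog M n)" for n by (rule Hn)
    show "dif M h \<in> H \<inter> homog M (n + 1)" if "h \<in> H \<inter> homog M n" for n h
      using that H_d M.dif_degree by blast
    show "brack M h h' \<in> H \<inter> homog M (m + n)" if "h \<in> H \<inter> homog M m" "h' \<in> H \<inter> homog M n" for m n h h'
      using that H_br M.brack_degree by blast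
    show "\<ii> x \<in> homog M (n - 1)" if "x \<in> homog L n" for n x by (rule i_in[OF that])
    show "\<ii> (x + y) = \<ii> x + \<ii> y" if "x \<in> homog L n" "y \<in> homog L n" for n x y by (rule i_add[OF that])
    show "\<ii> (scal L c x) = scal M c (\<ii> x)" if "x \<in> homog L n" for n c x by (rule i_scale[OF that])
    show "brack M (\<ii> x) (\<ii> y) = 0" if "x \<in> homog L m" "y \<in> homog L n" for m n x y
      by (rule assms(5)[OF hs[OF that(1)] hs[OF that(2)]])
    show "\<ii> (brack L x y) = brack M (\<ii> x) (dif M (\<ii> y))" if "x \<in> homog L m" "y \<in> homog L n" for m n x y
      by (rule assms(6)[OF hs[OF that(1)] hs[OF that(2)]])
    show "dif M (\<ii> x) + \<ii> (dif L x) \<in> H \<inter> homog M n" if "x \<in> homog L n" for n x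
      using assms(7)[OF hs[OF that]] M.dif_degree[OF i_in[OF that]] i_in[OF L.dif_degree[OF that]]
        GM.add_in[of _ n] by simp
  next
    fix h n u assume h: "h \<in> H \<inter> homog M n" and u: "u \<in> homog M (n - 1)" "h = dif M u"
    let ?R = "restrict_dgla M H"
    have R: "homog ?R n = H \<inter> homog M n" "dif ?R = dif M" for n by (simp_all add: restrict_dgla_def)
    have "dg_lie ((graded_of M)\<lparr>gh := \<lambda>n. H \<inter> homog M n\<rparr>)"
      by (rule GM.sub_dg_lie) (use Hn H_d H_br M.dif_degree M.brack_degree in auto)
    then have "dg_lie (graded_of ?R)" by (simp add: graded_of_def restrict_dgla_def)
    \<comment> \<open>Being \<open>dif M u\<close>, \<open>h\<close> is closed; its class in
      \<open>H\<close> dies in \<open>M\<close>, so (3) gives a primitive inside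
      \<open>H\<close>.\<close>
    then have "h \<in> exact_part ?R n"
      using h u GM.d_d[of u "n - 1"] GM.d_zero VM.subspace_0[OF Hn[of n]]
      by (intro injective_in_cohomologyD[OF assms(8) add_subgroup_exact_part[OF dg_lie_graded_of[OF assms(2)]] add_subgroup_exact_part])
         (auto simp: exact_part_def closed_part_def R)
    then show "\<exists>k\<in>H \<inter> homog M (n - 1). h = dif M k" by (auto simp: exact_part_def R)
  next
    fix x n h u
    assume x: "x \<in> homog L n" "dif L x = 0" and h: "h \<in> H \<inter> homog M (n - 1)" and u: "u \<in> homog M (n - 2)"
      and eq: "\<ii> x = h + dif M u"
    have "x \<in> exact_part L n"
      by (rule injective_quotientD[OF assms(9) dg_lie_graded_of[OF assms(1)] dg_lie_graded_of[OF assms(2)]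
            add_subgroup_subspace[OF M.ambient Hn] H_d i_in i_add assms(7)[OF hs] _ h u eq])
         (use x in \<open>auto simp: closed_part_def\<close>)
    then show "\<exists>x'\<in>homog L (n - 1). x = dif L x'" by (auto simp: exact_part_def)
  qed
  show ?thesis by (rule homotopy_abelian_zigzag[OF assms(1) refl])
qed

end
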